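(* Let $k$ be a field and let $H$ be a Hopf algebra over $k$ with invertible antipode $S$. Let $X$ and $X'$ be left $H$-modules with flat connections $\nabla_X:X\to H\otimes X$ and $\nabla_{X'}:X'\to H\otimes X'$ with respect to the differential calculi $\widehat{\mathcal{K}}^*(H)$ and $\mathcal{K}^*(H)$ respectively. Write $\nabla_X(x)=x_{\{-1\}}\otimes x_{\{0\}}$ and define $\sigma:X\otimes H\to H\otimes X$ by $\sigma(x\otimes h)=x_{\{-1\}}h\otimes x_{\{0\}}+h\otimes x$. Then the map $\nabla_{X\otimes X'}:X\otimes X'\to H\otimes X\otimes X'$ given by $$\nabla_{X\otimes X'}(x\otimes x')=\nabla_X(x)\otimes x'+(\sigma\otimes \mathrm{id}_{X'})\bigl(x\otimes\nabla_{X'}(x')\bigr)$$ defines a flat connection on the $H$-module $X\otimes X'$ with respect to $\mathcal{K}^*(H)$.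
   Context: Sweedler notation is used. $X\otimes X'$ carries the diagonal action $h(x\otimes x')=h_{(1)}x\otimes h_{(2)}x'$. The calculus $\mathcal{K}^*(H)$: $\mathcal{K}^n(H)=H^{\otimes (n+1)}$, with product $$(x^0\otimes\cdots\otimes x^n)(y^0\otimes\cdots\otimes y^m)= x^0\otimes\cdots\otimes x^{n-1}\otimes x^n_{(1)}y^0S^{-1}(x^n_{(2m+1)})\otimes\cdots\otimes x^n_{(m)}y^{m-1}S^{-1}(x^n_{(m+2)})\otimes x^n_{(m+1)}y^m$$ and differential $$d(h^0\otimes\cdots\otimes h^n)=-(1\otimes h^0\otimes\cdots\otimes h^n)+\sum_{j=0}^{n-1}(-1)^j\, h^0\otimes\cdots\otimes h^j_{(1)}\otimes h^j_{(2)}\otimes\cdots\otimes h^n+(-1)^n\, h^0\otimes\cdots\otimes h^{n-1}\otimes h^n_{(1)}S^{-1}(h^n_{(3)})\otimes h^n_{(2)}.$$ The calculus $\widehat{\mathcal{K}}^*(H)$ is given by the same formulas with $S^{-1}$ replaced by $S$ everywhere. Both are differential graded $k$-algebras with degree-zero part $H$. Connections: let $(\Omega^*,d)$ be a differential graded $k$-algebra with $\Omega^0=A$, and $M$ a left $A$-module. A connection on $M$ is a $k$-linear map $\nabla:M\to\Omega^1\otimes_A M$ with $\nabla(am)=a\nabla(m)+d(a)\otimes_A m$. It extends to $\widehat\nabla$ on $\Omega^*\otimes_A M$ by $\widehat\nabla(\omega\otimes m)=d(\omega)\otimes_A m+(-1)^{|\omega|}\omega\nabla(m)$. It is flat if $\widehat\nabla^2=0$.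 For both calculi one identifies $\Omega^1\otimes_H M=(H\otimes H)\otimes_H M\cong H\otimes M$ via $(g\otimes h)\otimes_H m\mapsto g\otimes hm$. *)

theory Defs
  imports Complex_Main "HOL-Library.Poly_Mapping"
begin

section \<open>Free vector spaces and their quotients\<close>

text \<open>The vector space over \<open>'k\<close> with basis \<open>'g\<close> is the type \<open>'g \<Rightarrow>\<^sub>0 'k\<close>.\<close>

definition fscale :: "'k::field \<Rightarrow> ('g \<Rightarrow>\<^sub>0 'k) \<Rightarrow> ('g \<Rightarrow>\<^sub>0 'k)" where
  "fscale c f = Poly_Mapping.map (\<lambda>a. c * a) f"

definition gen :: "'g \<Rightarrow> ('g \<Rightarrow>\<^sub>0 'k::field)" where
  "gen g = Poly_Mapping.single g 1"

definition lin_ext :: "('k::field \<Rightarrow> 'v \<Rightarrow> 'v) \<Rightarrow> ('g \<Rightarrow> 'v) \<Rightarrow> ('g \<Rightarrow>\<^sub>0 'k) \<Rightarrow> 'v::ab_group_add" where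
  "lin_ext s f t = (\<Sum>g\<in>Poly_Mapping.keys t. s (Poly_Mapping.lookup t g) (f g))"

abbreviation lext :: "('g \<Rightarrow> ('e \<Rightarrow>\<^sub>0 'k::field)) \<Rightarrow> ('g \<Rightarrow>\<^sub>0 'k) \<Rightarrow> ('e \<Rightarrow>\<^sub>0 'k)" where
  "lext \<equiv> lin_ext fscale"

lemma lookup_fscale [simp]: "Poly_Mapping.lookup (fscale c f) g = c * Poly_Mapping.lookup f g"
  by (simp add: fscale_def Poly_Mapping.map.rep_eq when_def)

lemma vector_space_fscale: "vector_space (fscale :: 'k::field \<Rightarrow> ('g \<Rightarrow>\<^sub>0 'k) \<Rightarrow> ('g \<Rightarrow>\<^sub>0 'k))"
  by unfold_locales (auto intro!: poly_mapping_eqI simp: lookup_add algebra_simps)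

text \<open>
  A type cannot depend on the scalar multiplications that define a tensor product, so the quotient
  of a free vector space by the span of a set \<open>N\<close> of relations is realised inside the free space
  itself, as the range of a fixed linear projection \<open>nf N\<close> with kernel \<open>span N\<close>: \<open>nf N f\<close> stands
  for the class of \<open>f\<close>, and it is a representative of that class.  Equality and the linear
  structure of the quotient are those of the type.  Since an element of the quotient is in
  particular a formal sum of generators, a linear map defined on the quotient by a formula on
  generators (in Sweedler notation, say) is written as the linear extension \<open>lext\<close> of that formula.
\<close>

definition nf :: "('g \<Rightarrow>\<^sub>0 'k::field) set \<Rightarrow> ('g \<Rightarrow>\<^sub>0 'k) \<Rightarrow> ('g \<Rightarrow>\<^sub>0 'k)" where
  "nf N = (SOME P. Vector_Spaces.linear fscale fscale P \<and> (\<forall>f. P (P f) = P f) \<and>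
                   (\<forall>f. P f = 0 \<longleftrightarrow> f \<in> module.span fscale N))"

lemma nf_properties:
  fixes N :: "('g \<Rightarrow>\<^sub>0 'k::field) set"
  shows linear_nf: "Vector_Spaces.linear fscale fscale (nf N)"
    and nf_idem: "nf N (nf N f) = nf N f"
    and nf_eq_0_iff: "nf N f = 0 \<longleftrightarrow> f \<in> module.span fscale N"
proof -
  interpret F: vector_space "fscale :: 'k \<Rightarrow> ('g \<Rightarrow>\<^sub>0 'k) \<Rightarrow> ('g \<Rightarrow>\<^sub>0 'k)"
    by (rule vector_space_fscale)
  interpret FF: vector_space_pair "fscale :: 'k \<Rightarrow> ('g \<Rightarrow>\<^sub>0 'k) \<Rightarrow> ('g \<Rightarrow>\<^sub>0 'k)"
    "fscale :: 'k \<Rightarrow> ('g \<Rightarrow>\<^sub>0 'k) \<Rightarrow> ('g \<Rightarrow>\<^sub>0 'k)" ..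
  have lid: "Vector_Spaces.linear fscale fscale (\<lambda>x::'g \<Rightarrow>\<^sub>0 'k. x)"
    by unfold_locales auto
  obtain g where g: "range g \<subseteq> F.span N" "Vector_Spaces.linear fscale fscale g"
    "\<forall>x\<in>F.span N. g x = x"
    using FF.linear_inj_on_left_inverse[OF lid, of N] by auto
  interpret g: Vector_Spaces.linear fscale fscale g by (rule g)
  let ?P = "\<lambda>f. f - g f"
  have gg: "g (g f) = g f" for f using g by blast
  have "Vector_Spaces.linear fscale fscale ?P"
    by unfold_locales (auto simp: g.add g.scale F.scale_right_diff_distrib)
  moreover have "?P (?P f) = ?P f" for f by (simp add: g.diff gg)
  moreover have "?P f = 0 \<longleftrightarrow> f \<in> F.span N" for f
    using g(1,3) by (metis eq_iff_diff_eq_0 rangeI subsetD)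
  ultimately have "\<exists>P::('g \<Rightarrow>\<^sub>0 'k) \<Rightarrow> ('g \<Rightarrow>\<^sub>0 'k). Vector_Spaces.linear fscale fscale P \<and>
      (\<forall>f. P (P f) = P f) \<and> (\<forall>f. P f = 0 \<longleftrightarrow> f \<in> module.span fscale N)" by blast
  from someI_ex[OF this] show "Vector_Spaces.linear fscale fscale (nf N)"
    "nf N (nf N f) = nf N f" "nf N f = 0 \<longleftrightarrow> f \<in> module.span fscale N"
    unfolding nf_def by auto
qed

lemma nf_eq_iff: "nf N f = nf N f' \<longleftrightarrow> f - f' \<in> module.span fscale N"
proof -
  interpret Vector_Spaces.linear fscale fscale "nf N" by (rule linear_nf)
  show ?thesis by (simp flip: nf_eq_0_iff add: diff)
qed


section \<open>Tensor products over the ground field\<close>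

text \<open>A vector space is a subspace \<open>carrier V\<close> of a type with scalar multiplication.\<close>

record ('k, 'v) vec =
  carrier :: "'v set"
  scale :: "'k \<Rightarrow> 'v \<Rightarrow> 'v"

definition vec_space :: "('k::field, 'v::ab_group_add, 'z) vec_scheme \<Rightarrow> bool" where
  "vec_space V \<longleftrightarrow> vector_space (scale V) \<and> module.subspace (scale V) (carrier V)"

definition linear_on :: "('k::field, 'v::ab_group_add, 'y) vec_scheme \<Rightarrow>
    ('k, 'w::ab_group_add, 'z) vec_scheme \<Rightarrow> ('v \<Rightarrow> 'w) \<Rightarrow> bool" where
  "linear_on V W f \<longleftrightarrow>
     (\<forall>v\<in>carrier V. f v \<in> carrier W) \<and>
     (\<forall>v\<in>carrier V. \<forall>v'\<in>carrier V. f (v + v') = f v + f v') \<and>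
     (\<forall>c. \<forall>v\<in>carrier V. f (scale V c v) = scale W c (f v))"

definition bilin_rel :: "('k::field, 'v::ab_group_add, 'y) vec_scheme \<Rightarrow>
    ('k, 'w::ab_group_add, 'z) vec_scheme \<Rightarrow> ('v \<times> 'w \<Rightarrow>\<^sub>0 'k) set" where
  "bilin_rel V W =
     {gen (v + v', w) - gen (v, w) - gen (v', w) |v v' w.
        v \<in> carrier V \<and> v' \<in> carrier V \<and> w \<in> carrier W} \<union>
     {gen (v, w + w') - gen (v, w) - gen (v, w') |v w w'.
        v \<in> carrier V \<and> w \<in> carrier W \<and> w' \<in> carrier W} \<union>
     {gen (scale V c v, w) - fscale c (gen (v, w)) |c v w. v \<in> carrier V \<and> w \<in> carrier W} \<union>
     {gen (v, scale W c w) - fscale c (gen (v, w)) |c v w. v \<in> carrier V \<and> w \<in> carrier W}"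

definition tensor :: "('k::field, 'v::ab_group_add, 'y) vec_scheme \<Rightarrow>
    ('k, 'w::ab_group_add, 'z) vec_scheme \<Rightarrow> ('k, 'v \<times> 'w \<Rightarrow>\<^sub>0 'k) vec" where
  "tensor V W =
     \<lparr>carrier = nf (bilin_rel V W) ` {f. Poly_Mapping.keys f \<subseteq> carrier V \<times> carrier W},
      scale = fscale\<rparr>"

definition tens :: "('k::field, 'v::ab_group_add, 'y) vec_scheme \<Rightarrow>
    ('k, 'w::ab_group_add, 'z) vec_scheme \<Rightarrow> 'v \<Rightarrow> 'w \<Rightarrow> ('v \<times> 'w \<Rightarrow>\<^sub>0 'k)" where
  "tens V W v w = nf (bilin_rel V W) (gen (v, w))"

text \<open>
  All tensor powers of a space whose carrier is the whole type live in one type, the \<open>n\<close>-th being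
  a quotient of the free space on lists of length \<open>n\<close>: \<open>mtens V [v\<^sub>1, \<dots>, v\<^sub>n]\<close> is \<open>v\<^sub>1 \<otimes> \<dots> \<otimes> v\<^sub>n\<close>.
\<close>

definition multilin_rel :: "('k::field, 'v::ab_group_add, 'z) vec_scheme \<Rightarrow> nat \<Rightarrow>
    ('v list \<Rightarrow>\<^sub>0 'k) set" where
  "multilin_rel V n =
     {gen (us @ (a + b) # ws) - gen (us @ a # ws) - gen (us @ b # ws) |us a b ws.
        length us + 1 + length ws = n} \<union>
     {gen (us @ scale V c a # ws) - fscale c (gen (us @ a # ws)) |us c a ws.
        length us + 1 + length ws = n}"

definition mtens :: "('k::field, 'v::ab_group_add, 'z) vec_scheme \<Rightarrow> 'v list \<Rightarrow> ('v list \<Rightarrow>\<^sub>0 'k)" where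
  "mtens V vs = nf (multilin_rel V (length vs)) (gen vs)"

definition tensor_power :: "('k::field, 'v::ab_group_add, 'z) vec_scheme \<Rightarrow> nat \<Rightarrow>
    ('k, 'v list \<Rightarrow>\<^sub>0 'k) vec" where
  "tensor_power V n =
     \<lparr>carrier = nf (multilin_rel V n) ` {f. \<forall>vs\<in>Poly_Mapping.keys f. length vs = n},
      scale = fscale\<rparr>"


section \<open>Hopf algebras and their modules\<close>

text \<open>The ring structure of the Hopf algebra is that of the type \<open>'h::ring_1\<close>; a Hopf algebra over
  a field is never zero because \<open>\<epsilon>(1) = 1\<close>.\<close>

record (overloaded) ('k::zero, 'h) hopf = "('k, 'h) vec" +
  comult :: "'h \<Rightarrow> ('h \<times> 'h \<Rightarrow>\<^sub>0 'k)"
  counit :: "'h \<Rightarrow> 'k"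
  antipode :: "'h \<Rightarrow> 'h"

locale hopf_algebra =
  fixes H :: "('k::field, 'h::ring_1) hopf"
  assumes carrier_H: "carrier H = UNIV"
    and vector_space_H: "vector_space (scale H)"
    and scale_mult_left: "scale H c (g * h) = scale H c g * h"
    and scale_mult_right: "scale H c (g * h) = g * scale H c h"
    and comult_linear: "linear_on H (tensor H H) (comult H)"
    and coassoc:
      "lext (\<lambda>(a, b). lext (\<lambda>(a1, a2). mtens H [a1, a2, b]) (comult H a)) (comult H h) =
       lext (\<lambda>(a, b). lext (\<lambda>(b1, b2). mtens H [a, b1, b2]) (comult H b)) (comult H h)"
    and counit_linear: "Vector_Spaces.linear (scale H) (*) (counit H)"
    and counit_left: "lin_ext (scale H) (\<lambda>(a, b). scale H (counit H a) b) (comult H h) = h"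
    and counit_right: "lin_ext (scale H) (\<lambda>(a, b). scale H (counit H b) a) (comult H h) = h"
    and comult_mult: "comult H (g * h) =
      lext (\<lambda>(a, b). lext (\<lambda>(c, e). tens H H (a * c) (b * e)) (comult H h)) (comult H g)"
    and comult_one: "comult H 1 = tens H H 1 1"
    and counit_mult: "counit H (g * h) = counit H g * counit H h"
    and counit_one: "counit H 1 = 1"
    and antipode_linear: "Vector_Spaces.linear (scale H) (scale H) (antipode H)"
    and antipode_left:
      "lin_ext (scale H) (\<lambda>(a, b). antipode H a * b) (comult H h) = scale H (counit H h) 1"
    and antipode_right:
      "lin_ext (scale H) (\<lambda>(a, b). a * antipode H b) (comult H h) = scale H (counit H h) 1"

text \<open>\<open>iter_comult H n h\<close> is \<open>h\<^sub>(\<^sub>1\<^sub>) \<otimes> \<dots> \<otimes> h\<^sub>(\<^sub>n\<^sub>+\<^sub>1\<^sub>)\<close>; Sweedler indices start at 1, list indices at 0.\<close>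

primrec iter_comult :: "('k::field, 'h::ring_1) hopf \<Rightarrow> nat \<Rightarrow> 'h \<Rightarrow> ('h list \<Rightarrow>\<^sub>0 'k)" where
  "iter_comult H 0 h = mtens H [h]"
| "iter_comult H (Suc n) h =
     lext (\<lambda>(a, b). lext (\<lambda>bs. mtens H (a # bs)) (iter_comult H n b)) (comult H h)"

record ('k, 'a, 'm) lmodule = "('k, 'm) vec" +
  act :: "'a \<Rightarrow> 'm \<Rightarrow> 'm"

definition left_module :: "('k::field, 'a::ring_1, 'z) vec_scheme \<Rightarrow>
    ('k, 'a, 'm::ab_group_add) lmodule \<Rightarrow> bool" where
  "left_module A M \<longleftrightarrow> vec_space M \<and>
     (\<forall>a. \<forall>m\<in>carrier M. act M a m \<in> carrier M) \<and>
     (\<forall>a. \<forall>m\<in>carrier M. \<forall>m'\<in>carrier M. act M a (m + m') = act M a m + act M a m') \<and>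
     (\<forall>a b. \<forall>m\<in>carrier M. act M (a + b) m = act M a m + act M b m) \<and>
     (\<forall>a b. \<forall>m\<in>carrier M. act M (a * b) m = act M a (act M b m)) \<and>
     (\<forall>m\<in>carrier M. act M 1 m = m) \<and>
     (\<forall>c a. \<forall>m\<in>carrier M. act M (scale A c a) m = scale M c (act M a m))"

definition tensor_module :: "('k::field, 'h::ring_1) hopf \<Rightarrow> ('k, 'h, 'x::ab_group_add) lmodule \<Rightarrow>
    ('k, 'h, 'y::ab_group_add) lmodule \<Rightarrow> ('k, 'h, 'x \<times> 'y \<Rightarrow>\<^sub>0 'k) lmodule" where
  "tensor_module H X Y =
     \<lparr>carrier = carrier (tensor X Y), scale = fscale,
      act = (\<lambda>h. lext (\<lambda>(x, y). lext (\<lambda>(a, b). tens X Y (act X a x) (act Y b y)) (comult H h)))\<rparr>"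


section \<open>Connections over a differential graded algebra\<close>

text \<open>\<open>incl\<close> is the identification of the algebra \<open>'a\<close> with the degree-zero part.\<close>

record ('k, 'a, 'w) calculus =
  grade :: "nat \<Rightarrow> ('k, 'w) vec"
  incl :: "'a \<Rightarrow> 'w"
  prd :: "'w \<Rightarrow> 'w \<Rightarrow> 'w"
  dif :: "'w \<Rightarrow> 'w"

text \<open>\<open>\<Omega>\<^sup>n \<otimes>\<^sub>A M\<close> as the quotient of \<open>\<Omega>\<^sup>n \<otimes>\<^sub>k M\<close> by \<open>\<omega>a \<otimes> m = \<omega> \<otimes> am\<close>; \<open>\<Omega>\<^sup>* \<otimes>\<^sub>A M\<close> is their direct sum
  and is treated degree by degree.\<close>

definition bal_rel :: "('k::field, 'a, 'w::ab_group_add) calculus \<Rightarrow>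
    ('k, 'a, 'm::ab_group_add) lmodule \<Rightarrow> nat \<Rightarrow> ('w \<times> 'm \<Rightarrow>\<^sub>0 'k) set" where
  "bal_rel \<Omega> M n = bilin_rel (grade \<Omega> n) M \<union>
     {gen (prd \<Omega> \<omega> (incl \<Omega> a), m) - gen (\<omega>, act M a m) |\<omega> a m.
        \<omega> \<in> carrier (grade \<Omega> n) \<and> m \<in> carrier M}"

definition btensor :: "('k::field, 'a, 'w::ab_group_add) calculus \<Rightarrow>
    ('k, 'a, 'm::ab_group_add) lmodule \<Rightarrow> nat \<Rightarrow> ('k, 'w \<times> 'm \<Rightarrow>\<^sub>0 'k) vec" where
  "btensor \<Omega> M n =
     \<lparr>carrier = nf (bal_rel \<Omega> M n) `
        {f. Poly_Mapping.keys f \<subseteq> carrier (grade \<Omega> n) \<times> carrier M},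
      scale = fscale\<rparr>"

definition btens :: "('k::field, 'a, 'w::ab_group_add) calculus \<Rightarrow>
    ('k, 'a, 'm::ab_group_add) lmodule \<Rightarrow> nat \<Rightarrow> 'w \<Rightarrow> 'm \<Rightarrow> ('w \<times> 'm \<Rightarrow>\<^sub>0 'k)" where
  "btens \<Omega> M n \<omega> m = nf (bal_rel \<Omega> M n) (gen (\<omega>, m))"

text \<open>Left multiplication by \<open>\<omega> \<in> \<Omega>\<^sup>p\<close> as a map \<open>\<Omega>\<^sup>q \<otimes>\<^sub>A M \<rightarrow> \<Omega>\<^sup>p\<^sup>+\<^sup>q \<otimes>\<^sub>A M\<close>.\<close>

definition lmult :: "('k::field, 'a, 'w::ab_group_add) calculus \<Rightarrow>
    ('k, 'a, 'm::ab_group_add) lmodule \<Rightarrow> nat \<Rightarrow> nat \<Rightarrow> 'w \<Rightarrow> ('w \<times> 'm \<Rightarrow>\<^sub>0 'k) \<Rightarrow> ('w \<times> 'm \<Rightarrow>\<^sub>0 'k)" where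
  "lmult \<Omega> M p q \<omega> = lext (\<lambda>(\<eta>, m). btens \<Omega> M (p + q) (prd \<Omega> \<omega> \<eta>) m)"

definition connection :: "('k::field, 'a, 'w::ab_group_add) calculus \<Rightarrow>
    ('k, 'a, 'm::ab_group_add) lmodule \<Rightarrow> ('m \<Rightarrow> ('w \<times> 'm \<Rightarrow>\<^sub>0 'k)) \<Rightarrow> bool" where
  "connection \<Omega> M nabla \<longleftrightarrow> linear_on M (btensor \<Omega> M 1) nabla \<and>
     (\<forall>a. \<forall>m\<in>carrier M.
        nabla (act M a m) = lmult \<Omega> M 0 1 (incl \<Omega> a) (nabla m) + btens \<Omega> M 1 (dif \<Omega> (incl \<Omega> a)) m)"

definition connection_ext :: "('k::field, 'a, 'w::ab_group_add) calculus \<Rightarrow>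
    ('k, 'a, 'm::ab_group_add) lmodule \<Rightarrow> ('m \<Rightarrow> ('w \<times> 'm \<Rightarrow>\<^sub>0 'k)) \<Rightarrow> nat \<Rightarrow>
    ('w \<times> 'm \<Rightarrow>\<^sub>0 'k) \<Rightarrow> ('w \<times> 'm \<Rightarrow>\<^sub>0 'k)" where
  "connection_ext \<Omega> M nabla n =
     lext (\<lambda>(\<omega>, m). btens \<Omega> M (n + 1) (dif \<Omega> \<omega>) m + fscale ((-1) ^ n) (lmult \<Omega> M n 1 \<omega> (nabla m)))"

definition flat :: "('k::field, 'a, 'w::ab_group_add) calculus \<Rightarrow>
    ('k, 'a, 'm::ab_group_add) lmodule \<Rightarrow> ('m \<Rightarrow> ('w \<times> 'm \<Rightarrow>\<^sub>0 'k)) \<Rightarrow> bool" where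
  "flat \<Omega> M nabla \<longleftrightarrow> (\<forall>n. \<forall>t\<in>carrier (btensor \<Omega> M n).
     connection_ext \<Omega> M nabla (n + 1) (connection_ext \<Omega> M nabla n t) = 0)"


section \<open>The two calculi of a Hopf algebra\<close>

text \<open>\<open>T\<close> is \<open>S\<^sup>-\<^sup>1\<close> for one calculus and \<open>S\<close> for the other.  In \<open>K_prd_gen\<close> and \<open>K_dif_gen\<close> the lists
  stand for pure tensors of degree \<open>length - 1\<close>.\<close>

definition K_prd_gen :: "('k::field, 'h::ring_1) hopf \<Rightarrow> ('h \<Rightarrow> 'h) \<Rightarrow> 'h list \<Rightarrow> 'h list \<Rightarrow>
    ('h list \<Rightarrow>\<^sub>0 'k)" where
  "K_prd_gen H T xs ys =
     (let m = length ys - 1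
      in lext (\<lambda>zs. mtens H (butlast xs @
                      map (\<lambda>i. zs ! i * ys ! i * T (zs ! (2 * m - i))) [0..<m] @
                      [zs ! m * ys ! m]))
           (iter_comult H (2 * m) (last xs)))"

definition K_dif_gen :: "('k::field, 'h::ring_1) hopf \<Rightarrow> ('h \<Rightarrow> 'h) \<Rightarrow> 'h list \<Rightarrow> ('h list \<Rightarrow>\<^sub>0 'k)" where
  "K_dif_gen H T hs =
     (let n = length hs - 1
      in - mtens H (1 # hs)
         + (\<Sum>j<n. fscale ((-1) ^ j)
              (lext (\<lambda>(a, b). mtens H (take j hs @ [a, b] @ drop (j + 1) hs)) (comult H (hs ! j))))
         + fscale ((-1) ^ n)
              (lext (\<lambda>zs. mtens H (butlast hs @ [zs ! 0 * T (zs ! 2), zs ! 1]))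
                 (iter_comult H 2 (last hs))))"

definition K_calculus :: "('k::field, 'h::ring_1) hopf \<Rightarrow> ('h \<Rightarrow> 'h) \<Rightarrow>
    ('k, 'h, 'h list \<Rightarrow>\<^sub>0 'k) calculus" where
  "K_calculus H T =
     \<lparr>grade = (\<lambda>n. tensor_power H (n + 1)),
      incl = (\<lambda>h. mtens H [h]),
      prd = (\<lambda>\<omega> \<eta>. lext (\<lambda>xs. lext (K_prd_gen H T xs) \<eta>) \<omega>),
      dif = lext (K_dif_gen H T)\<rparr>"

definition K :: "('k::field, 'h::ring_1) hopf \<Rightarrow> ('k, 'h, 'h list \<Rightarrow>\<^sub>0 'k) calculus" where
  "K H = K_calculus H (inv (antipode H))"

definition K_hat :: "('k::field, 'h::ring_1) hopf \<Rightarrow> ('k, 'h, 'h list \<Rightarrow>\<^sub>0 'k) calculus" where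
  "K_hat H = K_calculus H (antipode H)"

text \<open>The identification \<open>\<Omega>\<^sup>1 \<otimes>\<^sub>H M \<cong> H \<otimes> M\<close>, \<open>(g \<otimes> h) \<otimes> m \<mapsto> g \<otimes> hm\<close>.\<close>

definition ident :: "('k::field, 'h::ring_1) hopf \<Rightarrow> ('k, 'h, 'm::ab_group_add) lmodule \<Rightarrow>
    (('h list \<Rightarrow>\<^sub>0 'k) \<times> 'm \<Rightarrow>\<^sub>0 'k) \<Rightarrow> ('h \<times> 'm \<Rightarrow>\<^sub>0 'k)" where
  "ident H M = lext (\<lambda>(\<omega>, m). lext (\<lambda>gh. tens H M (gh ! 0) (act M (gh ! 1) m)) \<omega>)"

definition flat_connection :: "('k::field, 'h::ring_1) hopf \<Rightarrow> ('k, 'h, 'h list \<Rightarrow>\<^sub>0 'k) calculus \<Rightarrow>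
    ('k, 'h, 'm::ab_group_add) lmodule \<Rightarrow> ('m \<Rightarrow> ('h \<times> 'm \<Rightarrow>\<^sub>0 'k)) \<Rightarrow> bool" where
  "flat_connection H \<Omega> M nabla \<longleftrightarrow>
     (\<exists>nabla'. connection \<Omega> M nabla' \<and> flat \<Omega> M nabla' \<and> (\<forall>m\<in>carrier M. nabla m = ident H M (nabla' m)))"


section \<open>The connection on a tensor product\<close>

text \<open>\<open>t \<otimes> y\<close> for \<open>t \<in> H \<otimes> X\<close>, viewed in \<open>H \<otimes> (X \<otimes> Y)\<close>.\<close>

definition tens_right :: "('k::field, 'h::ring_1) hopf \<Rightarrow> ('k, 'h, 'x::ab_group_add) lmodule \<Rightarrow>
    ('k, 'h, 'y::ab_group_add) lmodule \<Rightarrow> ('h \<times> 'x \<Rightarrow>\<^sub>0 'k) \<Rightarrow> 'y \<Rightarrow> ('h \<times> ('x \<times> 'y \<Rightarrow>\<^sub>0 'k) \<Rightarrow>\<^sub>0 'k)" where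
  "tens_right H X Y t y = lext (\<lambda>(g, x). tens H (tensor X Y) g (tens X Y x y)) t"

definition sigma :: "('k::field, 'h::ring_1) hopf \<Rightarrow> ('k, 'h, 'x::ab_group_add) lmodule \<Rightarrow>
    ('x \<Rightarrow> ('h \<times> 'x \<Rightarrow>\<^sub>0 'k)) \<Rightarrow> ('x \<times> 'h \<Rightarrow>\<^sub>0 'k) \<Rightarrow> ('h \<times> 'x \<Rightarrow>\<^sub>0 'k)" where
  "sigma H X nablaX = lext (\<lambda>(x, h). lext (\<lambda>(g, x0). tens H X (g * h) x0) (nablaX x) + tens H X h x)"

text \<open>\<open>\<sigma> \<otimes> id\<close>, with source \<open>X \<otimes> (H \<otimes> Y)\<close> and target \<open>H \<otimes> (X \<otimes> Y)\<close>.\<close>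

definition sigma_id :: "('k::field, 'h::ring_1) hopf \<Rightarrow> ('k, 'h, 'x::ab_group_add) lmodule \<Rightarrow>
    ('k, 'h, 'y::ab_group_add) lmodule \<Rightarrow> ('x \<Rightarrow> ('h \<times> 'x \<Rightarrow>\<^sub>0 'k)) \<Rightarrow>
    ('x \<times> ('h \<times> 'y \<Rightarrow>\<^sub>0 'k) \<Rightarrow>\<^sub>0 'k) \<Rightarrow> ('h \<times> ('x \<times> 'y \<Rightarrow>\<^sub>0 'k) \<Rightarrow>\<^sub>0 'k)" where
  "sigma_id H X Y nablaX =
     lext (\<lambda>(x, u). lext (\<lambda>(h, y). tens_right H X Y (sigma H X nablaX (tens X H x h)) y) u)"

definition nabla_formula :: "('k::field, 'h::ring_1) hopf \<Rightarrow> ('k, 'h, 'x::ab_group_add) lmodule \<Rightarrow>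
    ('k, 'h, 'y::ab_group_add) lmodule \<Rightarrow> ('x \<Rightarrow> ('h \<times> 'x \<Rightarrow>\<^sub>0 'k)) \<Rightarrow> ('y \<Rightarrow> ('h \<times> 'y \<Rightarrow>\<^sub>0 'k)) \<Rightarrow>
    'x \<Rightarrow> 'y \<Rightarrow> ('h \<times> ('x \<times> 'y \<Rightarrow>\<^sub>0 'k) \<Rightarrow>\<^sub>0 'k)" where
  "nabla_formula H X Y nablaX nablaY x y =
     tens_right H X Y (nablaX x) y + sigma_id H X Y nablaX (tens X (tensor H Y) x (nablaY y))"

definition nabla_tensor :: "('k::field, 'h::ring_1) hopf \<Rightarrow> ('k, 'h, 'x::ab_group_add) lmodule \<Rightarrow>
    ('k, 'h, 'y::ab_group_add) lmodule \<Rightarrow> ('x \<Rightarrow> ('h \<times> 'x \<Rightarrow>\<^sub>0 'k)) \<Rightarrow> ('y \<Rightarrow> ('h \<times> 'y \<Rightarrow>\<^sub>0 'k)) \<Rightarrow>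
    ('x \<times> 'y \<Rightarrow>\<^sub>0 'k) \<Rightarrow> ('h \<times> ('x \<times> 'y \<Rightarrow>\<^sub>0 'k) \<Rightarrow>\<^sub>0 'k)" where
  "nabla_tensor H X Y nablaX nablaY = lext (\<lambda>(x, y). nabla_formula H X Y nablaX nablaY x y)"

end

(*
  Write rho(m) = nabla(m) + 1 (x) m.  In K^*(H) built with T in place of S^-1, a connection on M is
  the same thing as a linear map rho: M -> H (x) M with rho(hm) = h_1 m_(-1) T(h_3) (x) h_2 m_(0), and
  under Omega^n (x)_H M = H^n (x) M the extended connection becomes, up to sign, the cobar differential
  of rho; hence flatness is coassociativity of rho.  In terms of rho the proposed formula on X (x) X'
  reads rho(x (x) x') = x_(-1) x'_(-1) (x) x_(0) (x) x'_(0).  This is coassociative because Delta is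
  multiplicative, and it is compatible with the action for T because in rho(h_1 x (x) h_2 x') the
  factor S(h_3) coming from X meets the factor h_4 coming from X' and the two cancel.
*)
theory Submission
  imports Defs
begin

text \<open>The shift by 1 (x) m absorbs the inhomogeneous term of the Leibniz rule. In degree one h
  (g (x) m) = h_1 g T(h_3) (x) h_2 m, while d(h) (x) m corresponds to h_1 T(h_3) (x) h_2 m - 1 (x)
  hm, which is h (1 (x) m) - 1 (x) hm; so the Leibniz rule says exactly that rho is H-linear for
  this action. The summand h (x) x of sigma is the same shift: with the components of rho_X one has
  sigma(x (x) h) = x_(-1) h (x) x_(0). Applied to the shift in nabla_X'(x') = rho_X'(x') - 1 (x) x',
  this gives -rho_X(x) (x) x', which leaves only -1 (x) x (x) x' of the summand nabla_X(x) (x) x'.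
  What shapes the formal argument is that an element of a tensor product is one formal sum, picked
  by a projection of which little is known. A Sweedler expression is a linear extension over
  whichever generators that sum contains, and an identity between tensors is used by summing one
  function over both sides. The sum may be computed from pure tensors once the function is
  multilinear on the carriers, and most side conditions below are claims of that kind.\<close>

interpretation free: vector_space "fscale :: 'k::field \<Rightarrow> ('g \<Rightarrow>\<^sub>0 'k) \<Rightarrow> ('g \<Rightarrow>\<^sub>0 'k)"
  by (rule vector_space_fscale)

section \<open>Linear extension\<close>

lemma lext_superset:
  assumes "finite A" "Poly_Mapping.keys t \<subseteq> A"
  shows "lext f t = (\<Sum>g\<in>A. fscale (Poly_Mapping.lookup t g) (f g))"
  unfolding lin_ext_def
  by (rule sum.mono_neutral_left) (use assms in \<open>auto simp: in_keys_iff\<close>)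

lemma lext_add [simp]: "lext f (t + u) = lext f t + lext f u"
proof -
  let ?A = "Poly_Mapping.keys t \<union> Poly_Mapping.keys u"
  have "lext f (t + u) = (\<Sum>g\<in>?A. fscale (Poly_Mapping.lookup (t + u) g) (f g))"
    by (rule lext_superset) (auto dest: subsetD[OF Poly_Mapping.keys_add])
  then show ?thesis
    by (simp add: lext_superset[of ?A t] lext_superset[of ?A u] lookup_add
        free.scale_left_distrib sum.distrib)
qed

lemma keys_fscale: "Poly_Mapping.keys (fscale c t) \<subseteq> Poly_Mapping.keys t"
  by (auto simp: in_keys_iff)

lemma lext_fscale [simp]: "lext f (fscale c t) = fscale c (lext f t)"
  by (subst lext_superset[OF finite_keys keys_fscale]) (simp add: lin_ext_def free.scale_sum_right)

lemma lext_zero [simp]: "lext f 0 = 0"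
  by (simp add: lin_ext_def)

lemma lext_minus [simp]: "lext f (- t) = - lext f t"
  using lext_fscale[of f "- 1" t] by (simp del: lext_fscale)

lemma lext_diff [simp]: "lext f (t - u) = lext f t - lext f u"
  using lext_add[of f t "- u"] by simp

lemma lext_sum: "lext f (\<Sum>i\<in>I. t i) = (\<Sum>i\<in>I. lext f (t i))"
  by (induction I rule: infinite_finite_induct) auto

lemma lext_gen [simp]: "lext f (gen g) = f g"
  by (simp add: gen_def lin_ext_def)

lemma lext_fun_add: "lext (\<lambda>g. f g + f' g) t = lext f t + lext f' t"
  by (simp add: lin_ext_def free.scale_right_distrib sum.distrib)

lemma lext_fun_fscale: "lext (\<lambda>g. fscale c (f g)) t = fscale c (lext f t)"
  by (simp add: lin_ext_def free.scale_sum_right mult.commute)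

lemma lext_fun_zero [simp]: "lext (\<lambda>g. 0) t = 0"
  by (simp add: lin_ext_def)

lemma lext_fun_minus: "lext (\<lambda>g. - f g) t = - lext f t"
  by (simp add: lin_ext_def sum_negf)

lemma lext_fun_diff: "lext (\<lambda>g. f g - f' g) t = lext f t - lext f' t"
  using lext_fun_add[of f "\<lambda>g. - f' g"] by (simp add: lext_fun_minus)

lemma lext_fun_sum: "lext (\<lambda>g. \<Sum>i\<in>I. f i g) t = (\<Sum>i\<in>I. lext (f i) t)"
  by (induction I rule: infinite_finite_induct) (auto simp: lext_fun_add)

lemma lext_cong:
  "t = t' \<Longrightarrow> (\<And>g. g \<in> Poly_Mapping.keys t' \<Longrightarrow> f g = f' g) \<Longrightarrow> lext f t = lext f' t'"
  by (simp add: lin_ext_def)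

lemma lext_lext: "lext f (lext g t) = lext (\<lambda>x. lext f (g x)) t"
  by (simp add: lin_ext_def[of fscale g] lin_ext_def[of fscale "\<lambda>x. lext f (g x)"] lext_sum)

lemma lext_swap: "lext (\<lambda>x. lext (f x) u) t = lext (\<lambda>y. lext (\<lambda>x. f x y) t) u"
  by (simp add: lin_ext_def[of fscale "f _"] lin_ext_def[of fscale "\<lambda>y. lext (\<lambda>x. f x y) t"]
      lext_fun_sum lext_fun_fscale)

lemma lext_gen_id [simp]: "lext gen t = t"
proof (rule poly_mapping_eqI)
  fix k
  have "Poly_Mapping.lookup (lext gen t) k =
      (\<Sum>g\<in>Poly_Mapping.keys t. if g = k then Poly_Mapping.lookup t g else 0)"
    unfolding lin_ext_def lookup_sum gen_def lookup_fscale
    by (rule sum.cong) (auto simp: lookup_single when_def)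
  then show "Poly_Mapping.lookup (lext gen t) k = Poly_Mapping.lookup t k"
    by (simp add: in_keys_iff)
qed

text \<open>\<open>C\<close> is meant to be a subspace.\<close>

definition lin :: "'v set \<Rightarrow> ('k::field \<Rightarrow> 'v \<Rightarrow> 'v) \<Rightarrow> ('v::ab_group_add \<Rightarrow> ('e \<Rightarrow>\<^sub>0 'k)) \<Rightarrow> bool" where
  "lin C s f \<longleftrightarrow> (\<forall>v\<in>C. \<forall>v'\<in>C. f (v + v') = f v + f v') \<and> (\<forall>c. \<forall>v\<in>C. f (s c v) = fscale c (f v))"

lemma lin_lext [simp]: "lin C fscale (lext f)"
  by (simp add: lin_def)

text \<open>Maps such as \<open>btens\<close> are linear only on a carrier, so linearity of
  \<open>F\<close> is asked on \<open>C\<close> alone. The subspace property keeps all partial sums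
  of the extension inside \<open>C\<close>, where additivity applies.\<close>

lemma lin_lin_ext:
  assumes "lin C s F" "vector_space s" "module.subspace s C" "\<And>g. g \<in> Poly_Mapping.keys t \<Longrightarrow> f g \<in> C"
  shows "F (lin_ext s f t) = lext (\<lambda>g. F (f g)) t"
proof -
  interpret vector_space s by fact
  have 0: "F 0 = 0"
    using assms(1,3) subspace_0 scale_zero_left[of 0] free.scale_zero_left
    by (metis lin_def)
  have "finite A \<Longrightarrow> A \<subseteq> Poly_Mapping.keys t \<Longrightarrow>
      F (\<Sum>g\<in>A. s (Poly_Mapping.lookup t g) (f g)) = (\<Sum>g\<in>A. fscale (Poly_Mapping.lookup t g) (F (f g)))" for A
  proof (induction A rule: finite_induct)
    case (insert x A)
    then have "(\<Sum>g\<in>A. s (Poly_Mapping.lookup t g) (f g)) \<in> C"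
      "s (Poly_Mapping.lookup t x) (f x) \<in> C" "f x \<in> C"
      using assms(3,4) by (auto intro!: subspace_sum subspace_scale)
    then show ?case using insert assms(1) by (simp add: lin_def)
  qed (simp add: 0)
  then show ?thesis by (simp add: lin_ext_def)
qed

text \<open>The formal counterpart of a Sweedler sum: for \<open>t = comult H h\<close> it is the
  sum of F(h_1, h_2). Currying lets nested coproducts bind their components one after the
  other.\<close>

definition bsum :: "('a \<times> 'b \<Rightarrow>\<^sub>0 'k::field) \<Rightarrow> ('a \<Rightarrow> 'b \<Rightarrow> ('e \<Rightarrow>\<^sub>0 'k)) \<Rightarrow> ('e \<Rightarrow>\<^sub>0 'k)" where
  "bsum t F = lext (case_prod F) t"

lemma bsum_simps [simp]:
  "bsum (t + u) F = bsum t F + bsum u F"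
  "bsum (t - u) F = bsum t F - bsum u F"
  "bsum (fscale c t) F = fscale c (bsum t F)"
  "bsum (- t) F = - bsum t F"
  "bsum 0 F = 0"
  "bsum (gen (a, b)) F = F a b"
  "bsum t (\<lambda>a b. 0) = 0"
  by (auto simp: bsum_def case_prod_unfold)

lemma bsum_fun:
  "bsum t (\<lambda>a b. F a b + F' a b) = bsum t F + bsum t F'"
  "bsum t (\<lambda>a b. F a b - F' a b) = bsum t F - bsum t F'"
  "bsum t (\<lambda>a b. - F a b) = - bsum t F"
  "bsum t (\<lambda>a b. fscale c (F a b)) = fscale c (bsum t F)"
  by (simp_all add: bsum_def case_prod_unfold lext_fun_add lext_fun_diff lext_fun_minus lext_fun_fscale)

lemma lext_bsum: "lext f (bsum t F) = bsum t (\<lambda>a b. lext f (F a b))"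
  by (simp add: bsum_def lext_lext case_prod_unfold)

lemma bsum_bsum: "bsum (bsum t F) G = bsum t (\<lambda>a b. bsum (F a b) G)"
  by (simp add: bsum_def lext_lext case_prod_unfold)

lemma bsum_swap: "bsum t (\<lambda>a b. bsum u (F a b)) = bsum u (\<lambda>x y. bsum t (\<lambda>a b. F a b x y))"
  unfolding bsum_def case_prod_unfold by (rule lext_swap)

lemma bsum_cong:
  "t = t' \<Longrightarrow> (\<And>a b. (a, b) \<in> Poly_Mapping.keys t' \<Longrightarrow> F a b = F' a b) \<Longrightarrow> bsum t F = bsum t' F'"
  unfolding bsum_def by (rule lext_cong) auto

section \<open>Quotients of free spaces\<close>

definition quot :: "('g \<Rightarrow>\<^sub>0 'k::field) set \<Rightarrow> 'g set \<Rightarrow> ('g \<Rightarrow>\<^sub>0 'k) set" where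
  "quot N B = nf N ` {f. Poly_Mapping.keys f \<subseteq> B}"

lemma subspace_keys: "free.subspace {f. Poly_Mapping.keys f \<subseteq> B}"
proof (rule free.subspaceI)
  fix x y :: "'b \<Rightarrow>\<^sub>0 'a" and c :: 'a
  assume "x \<in> {f. Poly_Mapping.keys f \<subseteq> B}"
  then show "fscale c x \<in> {f. Poly_Mapping.keys f \<subseteq> B}"
    using keys_fscale[of c x] by blast
  assume "y \<in> {f. Poly_Mapping.keys f \<subseteq> B}"
  then show "x + y \<in> {f. Poly_Mapping.keys f \<subseteq> B}"
    using Poly_Mapping.keys_add[of x y] \<open>x \<in> _\<close> by blast
qed simp

lemma keys_gen [simp]: "Poly_Mapping.keys (gen g :: 'g \<Rightarrow>\<^sub>0 'k::field) = {g}"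
  by (simp add: gen_def)

lemma nf_linear [simp]:
  "nf N (t + u) = nf N t + nf N u" "nf N (t - u) = nf N t - nf N u" "nf N (fscale c t) = fscale c (nf N t)"
  "nf N 0 = 0"
proof -
  interpret Vector_Spaces.linear fscale fscale "nf N" by (rule linear_nf)
  show "nf N (t + u) = nf N t + nf N u" "nf N (t - u) = nf N t - nf N u"
    "nf N (fscale c t) = fscale c (nf N t)" "nf N 0 = 0"
    by (rule add diff scale zero)+
qed

lemma nf_gen_eqI: "f - f' \<in> N \<Longrightarrow> nf N f = nf N f'"
  by (simp add: nf_eq_iff free.span_base)

text \<open>The projection \<open>nf N\<close> is only known to exist, and its value on a generator
  is unknown. But \<open>nf N t\<close> and \<open>t\<close> differ by an element of the span of
  \<open>N\<close>, and relations supported in \<open>B\<close> span a space supported in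
  \<open>B\<close>.\<close>

lemma keys_nf:
  assumes "\<And>r. r \<in> N \<Longrightarrow> Poly_Mapping.keys r \<subseteq> B" "Poly_Mapping.keys t \<subseteq> B"
  shows "Poly_Mapping.keys (nf N t) \<subseteq> B"
proof -
  have "nf N t - t \<in> free.span N"
    by (simp flip: nf_eq_0_iff add: nf_idem)
  moreover have "free.span N \<subseteq> {f. Poly_Mapping.keys f \<subseteq> B}"
    by (rule free.span_minimal) (use assms subspace_keys in auto)
  ultimately have "nf N t - t \<in> {f. Poly_Mapping.keys f \<subseteq> B}" by blast
  moreover have "t \<in> {f. Poly_Mapping.keys f \<subseteq> B}" using assms by simp
  ultimately have "(nf N t - t) + t \<in> {f. Poly_Mapping.keys f \<subseteq> B}"
    by (rule free.subspace_add[OF subspace_keys])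
  then show ?thesis by simp
qed

lemma quot_iff:
  assumes "\<And>r. r \<in> N \<Longrightarrow> Poly_Mapping.keys r \<subseteq> B"
  shows "t \<in> quot N B \<longleftrightarrow> Poly_Mapping.keys t \<subseteq> B \<and> nf N t = t"
  using keys_nf[OF assms] by (auto simp: quot_def nf_idem image_iff intro: exI[of _ t])

lemma subspace_quot: "free.subspace (quot N B)"
proof -
  interpret Vector_Spaces.linear fscale fscale "nf N" by (rule linear_nf)
  show ?thesis
    unfolding quot_def by (rule subspace_image) (rule subspace_keys)
qed

lemma nf_gen_in_quot: "b \<in> B \<Longrightarrow> nf N (gen b) \<in> quot N B"
  by (auto simp: quot_def)

lemma lext_nf_gen: "lext (\<lambda>b. nf N (gen b)) t = nf N t"
proof -
  have "lin UNIV fscale (nf N)" by (simp add: lin_def)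
  from lin_lin_ext[OF this vector_space_fscale, of t gen] show ?thesis by simp
qed

text \<open>The universal property of the quotient: a linear extension that kills the relations
  cannot see which representative \<open>nf\<close> has chosen.\<close>

lemma lext_nf:
  assumes "\<And>r. r \<in> N \<Longrightarrow> lext f r = 0"
  shows "lext f (nf N t) = lext f t"
proof -
  have "nf N t - t \<in> free.span N"
    by (simp flip: nf_eq_0_iff add: nf_idem)
  moreover have "free.span N \<subseteq> {t. lext f t = 0}"
    by (rule free.span_minimal) (use assms in \<open>auto intro!: free.subspaceI\<close>)
  ultimately have "lext f (nf N t - t) = 0" by blast
  then show ?thesis by simp
qed

section \<open>Tensor products\<close>

definition bilin :: "('k::field, 'v::ab_group_add, 'y) vec_scheme \<Rightarrow>
    ('k, 'w::ab_group_add, 'z) vec_scheme \<Rightarrow> ('v \<Rightarrow> 'w \<Rightarrow> ('e \<Rightarrow>\<^sub>0 'k)) \<Rightarrow> bool" where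
  "bilin V W F \<longleftrightarrow> (\<forall>w\<in>carrier W. lin (carrier V) (scale V) (\<lambda>v. F v w)) \<and>
     (\<forall>v\<in>carrier V. lin (carrier W) (scale W) (F v))"

lemma bilinD:
  assumes "bilin V W F"
  shows "v \<in> carrier V \<Longrightarrow> v' \<in> carrier V \<Longrightarrow> w \<in> carrier W \<Longrightarrow> F (v + v') w = F v w + F v' w"
    "v \<in> carrier V \<Longrightarrow> w \<in> carrier W \<Longrightarrow> w' \<in> carrier W \<Longrightarrow> F v (w + w') = F v w + F v w'"
    "v \<in> carrier V \<Longrightarrow> w \<in> carrier W \<Longrightarrow> F (scale V c v) w = fscale c (F v w)"
    "v \<in> carrier V \<Longrightarrow> w \<in> carrier W \<Longrightarrow> F v (scale W c w) = fscale c (F v w)"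
  using assms by (auto simp: bilin_def lin_def)

lemma bilinI:
  assumes "\<And>v v' w. v \<in> carrier V \<Longrightarrow> v' \<in> carrier V \<Longrightarrow> w \<in> carrier W \<Longrightarrow> F (v + v') w = F v w + F v' w"
    "\<And>v w w'. v \<in> carrier V \<Longrightarrow> w \<in> carrier W \<Longrightarrow> w' \<in> carrier W \<Longrightarrow> F v (w + w') = F v w + F v w'"
    "\<And>c v w. v \<in> carrier V \<Longrightarrow> w \<in> carrier W \<Longrightarrow> F (scale V c v) w = fscale c (F v w)"
    "\<And>c v w. v \<in> carrier V \<Longrightarrow> w \<in> carrier W \<Longrightarrow> F v (scale W c w) = fscale c (F v w)"
  shows "bilin V W F"
  using assms by (auto simp: bilin_def lin_def)

text \<open>Further relations may be present in \<open>N\<close>, so that this serves both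
  \<open>tens\<close> and the balanced tensor \<open>btens\<close>.\<close>

lemma bilin_nf:
  assumes "bilin_rel V W \<subseteq> N"
  shows "bilin V W (\<lambda>v w. nf N (gen (v, w)))"
proof (rule bilinI)
  show "nf N (gen (v + v', w)) = nf N (gen (v, w)) + nf N (gen (v', w))"
    if "v \<in> carrier V" "v' \<in> carrier V" "w \<in> carrier W" for v v' w
    using that unfolding nf_linear[symmetric]
    by (intro nf_gen_eqI subsetD[OF assms]) (force simp: bilin_rel_def diff_diff_eq)
  show "nf N (gen (v, w + w')) = nf N (gen (v, w)) + nf N (gen (v, w'))"
    if "v \<in> carrier V" "w \<in> carrier W" "w' \<in> carrier W" for v w w'
    using that unfolding nf_linear[symmetric]
    by (intro nf_gen_eqI subsetD[OF assms]) (force simp: bilin_rel_def diff_diff_eq)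
  show "nf N (gen (scale V c v, w)) = fscale c (nf N (gen (v, w)))"
    if "v \<in> carrier V" "w \<in> carrier W" for c v w
    using that unfolding nf_linear[symmetric]
    by (intro nf_gen_eqI subsetD[OF assms]) (force simp: bilin_rel_def)
  show "nf N (gen (v, scale W c w)) = fscale c (nf N (gen (v, w)))"
    if "v \<in> carrier V" "w \<in> carrier W" for c v w
    using that unfolding nf_linear[symmetric]
    by (intro nf_gen_eqI subsetD[OF assms]) (force simp: bilin_rel_def)
qed

lemma bilin_tens: "bilin V W (tens V W)"
  using bilin_nf[of V W "bilin_rel V W"] by (simp add: tens_def[abs_def])

lemmas tens_lin = bilinD[OF bilin_tens]

text \<open>The universal property of the tensor product. It makes Sweedler formulas computable: the
  unknown formal sum behind v (x) w may be replaced by the single pair (v, w) whenever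
  \<open>F\<close> is bilinear.\<close>

lemma bsum_tens:
  assumes "bilin V W F" "v \<in> carrier V" "w \<in> carrier W"
  shows "bsum (tens V W v w) F = F v w"
proof -
  have "lext (case_prod F) r = 0" if "r \<in> bilin_rel V W" for r
    using that by (auto simp: bilin_rel_def bilinD[OF assms(1)])
  then show ?thesis using assms by (simp add: tens_def bsum_def lext_nf)
qed

lemma carrier_tensor: "carrier (tensor V W) = quot (bilin_rel V W) (carrier V \<times> carrier W)"
  and scale_tensor [simp]: "scale (tensor V W) = fscale"
  by (simp_all add: tensor_def quot_def)

lemma vec_space_closed:
  assumes "vec_space V"
  shows "v \<in> carrier V \<Longrightarrow> v' \<in> carrier V \<Longrightarrow> v + v' \<in> carrier V" "v \<in> carrier V \<Longrightarrow> scale V c v \<in> carrier V"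
    "0 \<in> carrier V"
proof -
  interpret vector_space "scale V" using assms by (simp add: vec_space_def)
  show "v \<in> carrier V \<Longrightarrow> v' \<in> carrier V \<Longrightarrow> v + v' \<in> carrier V" "v \<in> carrier V \<Longrightarrow> scale V c v \<in> carrier V"
    "0 \<in> carrier V"
    using assms by (auto simp: vec_space_def intro: subspace_add subspace_scale subspace_0)
qed

lemma keys_diff_subset: "Poly_Mapping.keys t \<subseteq> B \<Longrightarrow> Poly_Mapping.keys u \<subseteq> B \<Longrightarrow> Poly_Mapping.keys (t - u) \<subseteq> B"
  and keys_fscale_subset: "Poly_Mapping.keys t \<subseteq> B \<Longrightarrow> Poly_Mapping.keys (fscale c t) \<subseteq> B"
  using free.subspace_diff[OF subspace_keys, of t B u]
    free.subspace_scale[OF subspace_keys, of t B c] by auto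

lemma keys_bilin_rel:
  assumes "vec_space V" "vec_space W" "r \<in> bilin_rel V W"
  shows "Poly_Mapping.keys r \<subseteq> carrier V \<times> carrier W"
  using assms(3) unfolding bilin_rel_def
  by (elim UnE CollectE exE conjE; hypsubst)
    (intro keys_diff_subset keys_fscale_subset; simp add: vec_space_closed[OF assms(1)] vec_space_closed[OF assms(2)])+

lemma tens_in_tensor: "v \<in> carrier V \<Longrightarrow> w \<in> carrier W \<Longrightarrow> tens V W v w \<in> carrier (tensor V W)"
  by (simp add: carrier_tensor tens_def nf_gen_in_quot)

lemma keys_tensor:
  assumes "vec_space V" "vec_space W" "t \<in> carrier (tensor V W)" "(v, w) \<in> Poly_Mapping.keys t"
  shows "v \<in> carrier V" "w \<in> carrier W"
  using assms by (auto simp: carrier_tensor quot_iff[OF keys_bilin_rel])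

lemma bsum_tens_id:
  assumes "vec_space V" "vec_space W" "t \<in> carrier (tensor V W)"
  shows "bsum t (tens V W) = t"
  using assms lext_nf_gen[of "bilin_rel V W" t]
  by (simp add: bsum_def tens_def case_prod_unfold carrier_tensor quot_iff[OF keys_bilin_rel])

text \<open>An element of the tensor product is a normal form, hence the sum of the pure tensors of
  its own generators; linearity of \<open>f\<close> on the carrier does the rest.\<close>

lemma lin_tensor_expand:
  assumes "vec_space V" "vec_space W" "t \<in> carrier (tensor V W)" "lin (carrier (tensor V W)) fscale f"
  shows "f t = bsum t (\<lambda>v w. f (tens V W v w))"
proof -
  have "f (bsum t (tens V W)) = bsum t (\<lambda>v w. f (tens V W v w))"
    unfolding bsum_def
    by (subst lin_lin_ext[OF assms(4)])
      (use keys_tensor[OF assms(1-3)] subspace_quot in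
        \<open>auto intro!: tens_in_tensor vector_space_fscale simp: carrier_tensor[symmetric] case_prod_unfold
          intro: lext_cong\<close>, simp add: carrier_tensor subspace_quot)
  then show ?thesis using bsum_tens_id[OF assms(1-3)] by simp
qed

lemma bsum_in_subspace:
  assumes "free.subspace C" "\<And>a b. (a, b) \<in> Poly_Mapping.keys t \<Longrightarrow> F a b \<in> C"
  shows "bsum t F \<in> C"
  unfolding bsum_def lin_ext_def
  by (intro free.subspace_sum free.subspace_scale assms(1)) (use assms(2) in auto)

lemma lext_in_subspace:
  assumes "free.subspace C" "\<And>a. a \<in> Poly_Mapping.keys t \<Longrightarrow> f a \<in> C"
  shows "lext f t \<in> C"
  unfolding lin_ext_def
  by (intro free.subspace_sum free.subspace_scale assms)

lemma subspace_tensor: "free.subspace (carrier (tensor V W))"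
  by (simp add: carrier_tensor subspace_quot)

section \<open>Tensor powers and multilinear maps\<close>

definition multilin :: "('k::field, 'v::ab_group_add, 'z) vec_scheme \<Rightarrow> nat \<Rightarrow> ('v list \<Rightarrow> ('e \<Rightarrow>\<^sub>0 'k)) \<Rightarrow> bool" where
  "multilin V n G \<longleftrightarrow> (\<forall>vs i. length vs = n \<longrightarrow> i < n \<longrightarrow> lin UNIV (scale V) (\<lambda>a. G (vs[i := a])))"

text \<open>The relations are stated by splitting a list at a slot, \<open>multilin\<close> by
  updating a slot; the index that translates between them is \<open>length us\<close>.\<close>

lemma multilin_rel_cases:
  assumes "r \<in> multilin_rel V n"
  obtains vs i a b where "length vs = n" "i < n" "r = gen (vs[i := a + b]) - gen (vs[i := a]) - gen (vs[i := b])"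
  | vs i c a where "length vs = n" "i < n" "r = gen (vs[i := scale V c a]) - fscale c (gen (vs[i := a]))"
  using assms unfolding multilin_rel_def
proof (elim UnE CollectE exE conjE)
  fix us a b ws
  assume "r = gen (us @ (a + b) # ws) - gen (us @ a # ws) - gen (us @ b # ws)" "length us + 1 + length ws = n"
  then show thesis
    using that(1)[of "us @ a # ws" "length us" a b] by simp
next
  fix us a ws c
  assume "r = gen (us @ scale V c a # ws) - fscale c (gen (us @ a # ws))" "length us + 1 + length ws = n"
  then show thesis
    using that(2)[of "us @ a # ws" "length us" c a] by simp
qed

lemma multilin_mtens:
  fixes V :: "('k::field, 'v::ab_group_add, 'z) vec_scheme"
  shows "multilin V n (mtens V)"
  unfolding multilin_def lin_def
proof (intro allI impI conjI ballI)
  fix vs :: "'v list" and i a b c assume vs: "length vs = n" "i < n"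
  have upd: "vs[i := x] = take i vs @ x # drop (Suc i) vs" for x
    using vs by (simp add: upd_conv_take_nth_drop)
  have len: "length (take i vs) + 1 + length (drop (Suc i) vs) = n"
    using vs by simp
  have "gen (vs[i := a + b]) - (gen (vs[i := a]) + gen (vs[i := b])) \<in> multilin_rel V n"
    unfolding upd multilin_rel_def diff_diff_eq[symmetric] using len by blast
  then show "mtens V (vs[i := a + b]) = mtens V (vs[i := a]) + mtens V (vs[i := b])"
    unfolding mtens_def length_list_update vs nf_linear[symmetric] by (rule nf_gen_eqI)
  have "gen (vs[i := scale V c a]) - fscale c (gen (vs[i := a])) \<in> multilin_rel V n"
    unfolding upd multilin_rel_def using len by blast
  then show "mtens V (vs[i := scale V c a]) = fscale c (mtens V (vs[i := a]))"
    unfolding mtens_def length_list_update vs nf_linear[symmetric] by (rule nf_gen_eqI)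
qed

lemma lext_mtens:
  assumes "multilin V (length vs) G"
  shows "lext G (mtens V vs) = G vs"
proof -
  have "lext G r = 0" if "r \<in> multilin_rel V (length vs)" for r
    using that by (rule multilin_rel_cases) (use assms in \<open>auto simp: multilin_def lin_def\<close>)
  then show ?thesis by (simp add: mtens_def lext_nf)
qed

lemma carrier_tensor_power: "carrier (tensor_power V n) = quot (multilin_rel V n) {vs. length vs = n}"
  and scale_tensor_power [simp]: "scale (tensor_power V n) = fscale"
  by (auto simp: tensor_power_def quot_def subset_iff)

lemma keys_multilin_rel: "r \<in> multilin_rel V n \<Longrightarrow> Poly_Mapping.keys r \<subseteq> {vs. length vs = n}"
  by (erule multilin_rel_cases; hypsubst; intro keys_diff_subset keys_fscale_subset; simp)

lemma subspace_tensor_power: "free.subspace (carrier (tensor_power V n))"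
  by (simp add: carrier_tensor_power subspace_quot)

lemma vec_space_tensor_power: "vec_space (tensor_power V n)"
  by (simp add: vec_space_def subspace_tensor_power vector_space_fscale)

lemma mtens_in_tensor_power: "length vs = n \<Longrightarrow> mtens V vs \<in> carrier (tensor_power V n)"
  unfolding carrier_tensor_power mtens_def by (simp add: nf_gen_in_quot)

lemma keys_tensor_power: "t \<in> carrier (tensor_power V n) \<Longrightarrow> vs \<in> Poly_Mapping.keys t \<Longrightarrow> length vs = n"
  by (auto simp: carrier_tensor_power quot_iff[OF keys_multilin_rel])

lemma lext_mtens_id: "t \<in> carrier (tensor_power V n) \<Longrightarrow> lext (mtens V) t = t"
proof -
  assume t: "t \<in> carrier (tensor_power V n)"
  have "lext (mtens V) t = lext (\<lambda>vs. nf (multilin_rel V n) (gen vs)) t"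
    by (rule lext_cong) (auto simp: mtens_def keys_tensor_power[OF t])
  then show ?thesis
    using t by (simp add: lext_nf_gen carrier_tensor_power quot_iff[OF keys_multilin_rel])
qed

lemma lin_tensor_power_expand:
  assumes "t \<in> carrier (tensor_power V n)" "lin (carrier (tensor_power V n)) fscale f"
  shows "f t = lext (\<lambda>vs. f (mtens V vs)) t"
proof -
  have "f (lext (mtens V) t) = lext (\<lambda>vs. f (mtens V vs)) t"
    by (rule lin_lin_ext[OF assms(2) vector_space_fscale subspace_tensor_power])
      (use keys_tensor_power[OF assms(1)] in \<open>auto intro: mtens_in_tensor_power\<close>)
  then show ?thesis using lext_mtens_id[OF assms(1)] by simp
qed

lemma lin_tensor_power_eqI:
  assumes "t \<in> carrier (tensor_power V n)" "lin (carrier (tensor_power V n)) fscale f"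
    "lin (carrier (tensor_power V n)) fscale f'"
    "\<And>vs. length vs = n \<Longrightarrow> f (mtens V vs) = f' (mtens V vs)"
  shows "f t = f' t"
  using lin_tensor_power_expand[OF assms(1,2)] lin_tensor_power_expand[OF assms(1,3)]
    keys_tensor_power[OF assms(1)] assms(4) lext_cong[of t t "\<lambda>vs. f (mtens V vs)" "\<lambda>vs. f' (mtens V vs)"]
  by metis

lemma lin_tensor_eqI:
  assumes "vec_space V" "vec_space W" "t \<in> carrier (tensor V W)" "lin (carrier (tensor V W)) fscale f"
    "lin (carrier (tensor V W)) fscale f'"
    "\<And>v w. v \<in> carrier V \<Longrightarrow> w \<in> carrier W \<Longrightarrow> f (tens V W v w) = f' (tens V W v w)"
  shows "f t = f' t"
  unfolding lin_tensor_expand[OF assms(1-4)] lin_tensor_expand[OF assms(1-3,5)]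
  by (rule bsum_cong) (use assms(6) keys_tensor[OF assms(1-3)] in auto)

definition trilin :: "('k::field, 'u::ab_group_add, 'x) vec_scheme \<Rightarrow> ('k, 'v::ab_group_add, 'y) vec_scheme \<Rightarrow>
    ('k, 'w::ab_group_add, 'z) vec_scheme \<Rightarrow> ('u \<Rightarrow> 'v \<Rightarrow> 'w \<Rightarrow> ('e \<Rightarrow>\<^sub>0 'k)) \<Rightarrow> bool" where
  "trilin U V W F \<longleftrightarrow> (\<forall>w\<in>carrier W. bilin U V (\<lambda>u v. F u v w)) \<and> (\<forall>u\<in>carrier U. bilin V W (F u))"

lemma lin_UNIV_iff:
  "lin UNIV s f \<longleftrightarrow> (\<forall>a b. f (a + b) = f a + f b) \<and> (\<forall>c a. f (s c a) = fscale c (f a))"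
  by (auto simp: lin_def)

lemma multilin_Cons: "multilin V (Suc n) G \<Longrightarrow> multilin V n (\<lambda>vs. G (v # vs))"
  unfolding multilin_def
proof (intro allI impI)
  fix vs :: "'b list" and i
  assume "\<forall>vs i. length vs = Suc n \<longrightarrow> i < Suc n \<longrightarrow> lin UNIV (scale V) (\<lambda>a. G (vs[i := a]))"
    "length vs = n" "i < n"
  then have "lin UNIV (scale V) (\<lambda>a. G ((v # vs)[Suc i := a]))" by (auto simp del: list_update.simps)
  then show "lin UNIV (scale V) (\<lambda>a. G (v # vs[i := a]))" by simp
qed

lemma multilin_1I: "lin UNIV (scale V) (\<lambda>a. G [a]) \<Longrightarrow> multilin V (Suc 0) G"
  by (auto simp: multilin_def length_Suc_conv)

lemma multilin_2I:
  assumes "\<And>b. lin UNIV (scale V) (\<lambda>a. G [a, b])" "\<And>a. lin UNIV (scale V) (\<lambda>b. G [a, b])"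
  shows "multilin V (Suc (Suc 0)) G"
  using assms by (auto simp: multilin_def length_Suc_conv less_Suc_eq numeral_eq_Suc)

lemma multilin_3I:
  assumes "\<And>b c. lin UNIV (scale V) (\<lambda>a. G [a, b, c])" "\<And>a c. lin UNIV (scale V) (\<lambda>b. G [a, b, c])"
    "\<And>a b. lin UNIV (scale V) (\<lambda>c. G [a, b, c])"
  shows "multilin V (Suc (Suc (Suc 0))) G"
  using assms by (auto simp: multilin_def length_Suc_conv less_Suc_eq numeral_eq_Suc)

context hopf_algebra
begin

section \<open>Sweedler calculus\<close>

declare carrier_H [simp]

lemma vec_space_H: "vec_space H"
proof -
  interpret vector_space "scale H" by (rule vector_space_H)
  show ?thesis by (simp add: vec_space_def vector_space_H subspace_UNIV)
qed

lemma mult_scale [simp]: "scale H c g * h = scale H c (g * h)" "g * scale H c h = scale H c (g * h)"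
  by (simp_all flip: scale_mult_left scale_mult_right)

lemma comult_lin [simp]:
  "comult H (g + h) = comult H g + comult H h" "comult H (scale H c h) = fscale c (comult H h)"
  using comult_linear by (simp_all add: linear_on_def)

lemma antipode_lin [simp]:
  "antipode H (g + h) = antipode H g + antipode H h" "antipode H (scale H c h) = scale H c (antipode H h)"
proof -
  interpret Vector_Spaces.linear "scale H" "scale H" "antipode H" by (rule antipode_linear)
  show "antipode H (g + h) = antipode H g + antipode H h" "antipode H (scale H c h) = scale H c (antipode H h)"
    by (simp_all add: add scale)
qed

lemma bilin_H_iff: "bilin H H F \<longleftrightarrow> (\<forall>b. lin UNIV (scale H) (\<lambda>a. F a b)) \<and> (\<forall>a. lin UNIV (scale H) (F a))"
  by (simp add: bilin_def)

lemma trilin_H_iff: "trilin H H H F \<longleftrightarrow> (\<forall>b c. lin UNIV (scale H) (\<lambda>a. F a b c)) \<and>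
    (\<forall>a c. lin UNIV (scale H) (\<lambda>b. F a b c)) \<and> (\<forall>a b. lin UNIV (scale H) (F a b))"
  by (auto simp: trilin_def bilin_H_iff)

lemma bsum_comult_one:
  assumes "bilin H H F"
  shows "bsum (comult H 1) F = F 1 1"
  by (simp add: comult_one bsum_tens[OF assms])

lemma bsum_comult_mult:
  assumes "bilin H H F"
  shows "bsum (comult H (g * h)) F =
    bsum (comult H g) (\<lambda>a b. bsum (comult H h) (\<lambda>c e. F (a * c) (b * e)))"
  by (simp add: comult_mult bsum_def[symmetric] bsum_bsum bsum_tens[OF assms])

text \<open>The axiom compares elements of the third tensor power, realised on lists. Evaluating
  \<open>F\<close> on the list entries turns it into a rule for nested Sweedler sums.\<close>

lemma bsum_coassoc:
  assumes "trilin H H H F"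
  shows "bsum (comult H h) (\<lambda>a b. bsum (comult H a) (\<lambda>a1 a2. F a1 a2 b)) =
    bsum (comult H h) (\<lambda>a b. bsum (comult H b) (F a))"
proof -
  let ?G = "\<lambda>vs. F (vs ! 0) (vs ! 1) (vs ! 2)"
  have "multilin H 3 ?G"
    using assms unfolding numeral_3_eq_3 trilin_H_iff by (intro multilin_3I) simp_all
  then have "lext ?G (mtens H [a, b, c]) = F a b c" for a b c
    by (subst lext_mtens) (simp_all add: numeral_3_eq_3)
  then show ?thesis
    using arg_cong[OF coassoc[of h], of "lext ?G"] by (simp add: bsum_def[symmetric] lext_bsum)
qed

lemma lin_H_lin_ext: "lin UNIV (scale H) F \<Longrightarrow> F (lin_ext (scale H) f t) = lext (\<lambda>g. F (f g)) t"
  using vec_space_H by (intro lin_lin_ext) (auto simp: vec_space_def)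

text \<open>Pushed through a linear \<open>F\<close>, the counit axiom, an equation in
  \<open>H\<close>, becomes one between sums in an arbitrary free space.\<close>

lemma bsum_counit_left:
  assumes "lin UNIV (scale H) F"
  shows "bsum (comult H h) (\<lambda>a b. fscale (counit H a) (F b)) = F h"
proof -
  have "F h = F (lin_ext (scale H) (\<lambda>(a, b). scale H (counit H a) b) (comult H h))"
    by (simp add: counit_left)
  also have "\<dots> = bsum (comult H h) (\<lambda>a b. fscale (counit H a) (F b))"
    using assms by (simp add: lin_H_lin_ext bsum_def case_prod_unfold lin_UNIV_iff)
  finally show ?thesis by simp
qed

lemma bsum_antipode_left:
  assumes "lin UNIV (scale H) F"
  shows "bsum (comult H h) (\<lambda>a b. F (antipode H a * b)) = fscale (counit H h) (F 1)"
proof -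
  have "fscale (counit H h) (F 1) = F (lin_ext (scale H) (\<lambda>(a, b). antipode H a * b) (comult H h))"
    using assms by (simp add: antipode_left lin_UNIV_iff)
  also have "\<dots> = bsum (comult H h) (\<lambda>a b. F (antipode H a * b))"
    using assms by (simp add: lin_H_lin_ext bsum_def case_prod_unfold)
  finally show ?thesis by simp
qed

lemma iter_comult_in: "iter_comult H n h \<in> carrier (tensor_power H (Suc n))"
proof (induction n arbitrary: h)
  case (Suc n)
  show ?case
    unfolding iter_comult.simps
    by (auto simp: Suc keys_tensor_power[OF Suc]
        intro!: lext_in_subspace subspace_tensor_power mtens_in_tensor_power)
qed (simp add: mtens_in_tensor_power)

lemma lext_iter_comult_Suc:
  assumes "multilin H (Suc (Suc n)) G"
  shows "lext G (iter_comult H (Suc n) h) =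
    bsum (comult H h) (\<lambda>a b. lext (\<lambda>bs. G (a # bs)) (iter_comult H n b))"
proof -
  have "lext (\<lambda>bs. lext G (mtens H (a # bs))) (iter_comult H n b) = lext (\<lambda>bs. G (a # bs)) (iter_comult H n b)"
    for a b
    by (rule lext_cong) (use assms keys_tensor_power[OF iter_comult_in] in \<open>auto simp: lext_mtens\<close>)
  then show ?thesis
    by (simp add: lext_lext bsum_def[symmetric] lext_bsum)
qed

lemma lext_iter_comult_0: "multilin H (Suc 0) G \<Longrightarrow> lext G (iter_comult H 0 h) = G [h]"
  by (simp add: lext_mtens)

lemma lext_iter_comult_2:
  assumes "multilin H 3 G"
  shows "lext G (iter_comult H 2 h) =
    bsum (comult H h) (\<lambda>a b. bsum (comult H b) (\<lambda>b1 b2. G [a, b1, b2]))"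
proof -
  note G = assms[unfolded numeral_3_eq_3]
  note G1 = multilin_Cons[OF G]
  show ?thesis
    unfolding numeral_2_eq_2 lext_iter_comult_Suc[OF G] lext_iter_comult_Suc[OF G1]
      lext_iter_comult_0[OF multilin_Cons[OF G1]] ..
qed

text \<open>In Sweedler notation: (h_1, h_2, S(h_3) h_4, h_5, h_6) and (h_1, h_2, 1, h_3, h_4) agree
  under a five-linear \<open>G\<close>. The left side is bracketed into the triples of
  \<open>p\<close> and \<open>q\<close> because these arise from acting on the two factors of a
  tensor product separately.\<close>

lemma bsum_antipode_cancel:
  assumes G: "\<And>b e c d. lin UNIV (scale H) (\<lambda>a. G a b e c d)" "\<And>a e c d. lin UNIV (scale H) (\<lambda>b. G a b e c d)"
    "\<And>a b c d. lin UNIV (scale H) (\<lambda>e. G a b e c d)" "\<And>a b e d. lin UNIV (scale H) (\<lambda>c. G a b e c d)"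
    "\<And>a b e c. lin UNIV (scale H) (\<lambda>d. G a b e c d)"
  shows "bsum (comult H h) (\<lambda>p q. bsum (comult H p) (\<lambda>p1 p'. bsum (comult H p') (\<lambda>p2 p3.
      bsum (comult H q) (\<lambda>q1 q'. bsum (comult H q') (\<lambda>q2 q3. G p1 p2 (antipode H p3 * q1) q2 q3))))) =
    bsum (comult H h) (\<lambda>h1 h'. bsum (comult H h') (\<lambda>h2 h''. bsum (comult H h'') (\<lambda>h3 h4. G h1 h2 1 h3 h4)))"
proof -
  note G' [simp] = G[unfolded lin_UNIV_iff, THEN conjunct1, rule_format] G[unfolded lin_UNIV_iff, THEN conjunct2, rule_format]
  note [simp] = trilin_H_iff lin_UNIV_iff bsum_fun distrib_left distrib_right
  \<comment> \<open>Hiding the inner sums in \<open>R\<close> and \<open>E\<close> makes each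
    regrouping below a single use of \<open>bsum_coassoc\<close> for a trilinear function.\<close>
  define R where "R p1 p2 p3 q = bsum (comult H q) (\<lambda>q1 q'. bsum (comult H q') (\<lambda>q2 q3.
      G p1 p2 (antipode H p3 * q1) q2 q3))" for p1 p2 p3 q
  define E where "E p1 p2 e q' = bsum (comult H q') (\<lambda>q2 q3. G p1 p2 e q2 q3)" for p1 p2 e q'
  have [simp]: "R (p + p') p2 p3 q = R p p2 p3 q + R p' p2 p3 q" "R (scale H c p) p2 p3 q = fscale c (R p p2 p3 q)"
    "R p1 (p + p') p3 q = R p1 p p3 q + R p1 p' p3 q" "R p1 (scale H c p) p3 q = fscale c (R p1 p p3 q)"
    "R p1 p2 (p + p') q = R p1 p2 p q + R p1 p2 p' q" "R p1 p2 (scale H c p) q = fscale c (R p1 p2 p q)"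
    "R p1 p2 p3 (p + p') = R p1 p2 p3 p + R p1 p2 p3 p'" "R p1 p2 p3 (scale H c p) = fscale c (R p1 p2 p3 p)"
    for p1 p2 p3 q p p' c
    by (simp_all add: R_def)
  have [simp]: "E p1 p2 (e + e') q = E p1 p2 e q + E p1 p2 e' q" "E p1 p2 (scale H c e) q = fscale c (E p1 p2 e q)"
    "E p1 p2 e (q + q') = E p1 p2 e q + E p1 p2 e q'" "E p1 p2 e (scale H c q) = fscale c (E p1 p2 e q)"
    for p1 p2 e e' q q' c
    by (simp_all add: E_def)
  \<comment> \<open>Coassociativity brings the antipode next to its neighbour, the antipode axiom
    turns the pair into a counit, and the counit disappears into the remaining leg.\<close>
  have cancel: "bsum (comult H w) (\<lambda>p3 q. R p1 p2 p3 q) = E p1 p2 1 w" for p1 p2 w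
  proof -
    have "bsum (comult H w) (\<lambda>p3 q. R p1 p2 p3 q) =
        bsum (comult H w) (\<lambda>a b. bsum (comult H b) (\<lambda>b1 b2. E p1 p2 (antipode H a * b1) b2))"
      by (simp add: R_def E_def)
    also have "\<dots> = bsum (comult H w) (\<lambda>a b. bsum (comult H a) (\<lambda>a1 a2. E p1 p2 (antipode H a1 * a2) b))"
      by (rule bsum_coassoc[symmetric]) simp
    also have "\<dots> = bsum (comult H w) (\<lambda>a b. fscale (counit H a) (E p1 p2 1 b))"
      by (intro bsum_cong refl bsum_antipode_left) simp
    also have "\<dots> = E p1 p2 1 w"
      by (rule bsum_counit_left) simp
    finally show ?thesis .
  qed
  \<comment> \<open>Rebracketing twice to the right puts \<open>p3\<close> and \<open>q\<close> into
    one coproduct, where \<open>cancel\<close> applies.\<close>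
  have "bsum (comult H h) (\<lambda>p q. bsum (comult H p) (\<lambda>p1 p'. bsum (comult H p') (\<lambda>p2 p3. R p1 p2 p3 q))) =
      bsum (comult H h) (\<lambda>p1 r. bsum (comult H r) (\<lambda>p' q. bsum (comult H p') (\<lambda>p2 p3. R p1 p2 p3 q)))"
    by (rule bsum_coassoc) simp
  also have "\<dots> = bsum (comult H h) (\<lambda>p1 r. bsum (comult H r) (\<lambda>p2 w. bsum (comult H w) (\<lambda>p3 q. R p1 p2 p3 q)))"
    by (intro bsum_cong refl bsum_coassoc) simp
  also have "\<dots> = bsum (comult H h) (\<lambda>p1 r. bsum (comult H r) (\<lambda>p2 w. E p1 p2 1 w))"
    by (simp add: cancel)
  finally show ?thesis by (simp add: R_def E_def)
qed

end

section \<open>Closure properties of linear and multilinear maps\<close>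

lemma linD: "lin C s f \<Longrightarrow> v \<in> C \<Longrightarrow> v' \<in> C \<Longrightarrow> f (v + v') = f v + f v'"
  "lin C s f \<Longrightarrow> v \<in> C \<Longrightarrow> f (s c v) = fscale c (f v)"
  by (auto simp: lin_def)

lemma lin_comp:
  assumes "lin D s' g" "\<And>v. v \<in> C \<Longrightarrow> f v \<in> D" "\<And>v v'. v \<in> C \<Longrightarrow> v' \<in> C \<Longrightarrow> f (v + v') = f v + f v'"
    "\<And>c v. v \<in> C \<Longrightarrow> f (s c v) = s' c (f v)"
  shows "lin C s (\<lambda>v. g (f v))"
  using assms by (auto simp: lin_def)

lemma lin_fun_add: "lin C s f \<Longrightarrow> lin C s g \<Longrightarrow> lin C s (\<lambda>v. f v + g v)"
  and lin_fun_diff: "lin C s f \<Longrightarrow> lin C s g \<Longrightarrow> lin C s (\<lambda>v. f v - g v)"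
  and lin_fun_fscale: "lin C s f \<Longrightarrow> lin C s (\<lambda>v. fscale a (f v))"
  by (auto simp: lin_def free.scale_right_distrib free.scale_right_diff_distrib mult.commute)

lemma lin_fun_sum: "(\<And>i. i \<in> I \<Longrightarrow> lin C s (f i)) \<Longrightarrow> lin C s (\<lambda>v. \<Sum>i\<in>I. f i v)"
  by (auto simp: lin_def sum.distrib free.scale_sum_right)

lemma lin_fun_bsum: "(\<And>a b. (a, b) \<in> Poly_Mapping.keys t \<Longrightarrow> lin C s (\<lambda>v. F v a b)) \<Longrightarrow> lin C s (\<lambda>v. bsum t (F v))"
  by (auto simp: lin_def simp flip: bsum_fun intro!: bsum_cong)

lemma lin_fun_lext: "(\<And>a. a \<in> Poly_Mapping.keys t \<Longrightarrow> lin C s (\<lambda>v. F v a)) \<Longrightarrow> lin C s (\<lambda>v. lext (F v) t)"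
  by (auto simp: lin_def simp flip: lext_fun_add lext_fun_fscale intro!: lext_cong)

lemma multilin_fun_add: "multilin V n F \<Longrightarrow> multilin V n G \<Longrightarrow> multilin V n (\<lambda>v. F v + G v)"
  and multilin_fun_diff: "multilin V n F \<Longrightarrow> multilin V n G \<Longrightarrow> multilin V n (\<lambda>v. F v - G v)"
  and multilin_fun_fscale: "multilin V n F \<Longrightarrow> multilin V n (\<lambda>v. fscale c (F v))"
  and multilin_fun_sum: "(\<And>i. i \<in> I \<Longrightarrow> multilin V n (P i)) \<Longrightarrow> multilin V n (\<lambda>v. \<Sum>i\<in>I. P i v)"
  and multilin_fun_bsum: "(\<And>a b. (a, b) \<in> Poly_Mapping.keys t \<Longrightarrow> multilin V n (\<lambda>v. L v a b)) \<Longrightarrow>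
    multilin V n (\<lambda>v. bsum t (L v))"
  unfolding multilin_def
  by (simp_all add: lin_fun_add lin_fun_diff lin_fun_fscale lin_fun_sum lin_fun_bsum)

lemma multilin_append:
  fixes V :: "('k::field, 'v::ab_group_add, 'z) vec_scheme"
  assumes "multilin V (n + length ws) G"
  shows "multilin V n (\<lambda>us. G (us @ ws))"
  unfolding multilin_def
proof (intro allI impI)
  fix vs :: "'v list" and i assume "length vs = n" "i < n"
  then show "lin UNIV (scale V) (\<lambda>a. G (vs[i := a] @ ws))"
    using assms[unfolded multilin_def, rule_format, of "vs @ ws" i] by (simp add: list_update_append)
qed

lemma multilin_lin_mid:
  assumes "multilin V (length us + Suc (length ws)) G"
  shows "lin UNIV (scale V) (\<lambda>a. G (us @ a # ws))"
  using assms[unfolded multilin_def, rule_format, of "us @ undefined # ws" "length us"] by simp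

text \<open>The last tensor factor plays a special part in product and differential, since its
  iterated coproduct enters; hence multilinearity in the earlier slots and linearity in the last one
  are checked separately.\<close>

lemma multilin_snocI:
  fixes V :: "('k::field, 'v::ab_group_add, 'z) vec_scheme"
  assumes "\<And>h. multilin V n (\<lambda>us. F us h)" "\<And>us. length us = n \<Longrightarrow> lin UNIV (scale V) (F us)"
  shows "multilin V (Suc n) (\<lambda>vs. F (butlast vs) (last vs))"
  unfolding multilin_def
proof (intro allI impI)
  fix vs :: "'v list" and i assume "length vs = Suc n" "i < Suc n"
  then obtain us h where [simp]: "vs = us @ [h]" "length us = n"
    by (cases vs rule: rev_cases) auto
  show "lin UNIV (scale V) (\<lambda>a. F (butlast (vs[i := a])) (last (vs[i := a])))"
  proof (cases "i = n")
    case True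
    then show ?thesis using assms(2) by (simp add: list_update_append)
  next
    case False
    then show ?thesis using assms(1) \<open>i < Suc n\<close>
      by (simp add: list_update_append multilin_def)
  qed
qed

lemma multilin_cong:
  "(\<And>vs. length vs = n \<Longrightarrow> F vs = G vs) \<Longrightarrow> multilin V n F \<longleftrightarrow> multilin V n G"
  by (auto simp: multilin_def)

context hopf_algebra
begin

text \<open>Slot \<open>j\<close> is doubled: slots before it keep their index, slot
  \<open>j\<close> itself is covered by linearity of the coproduct, and a later slot
  \<open>i\<close> becomes slot \<open>Suc i\<close>.\<close>

lemma multilin_coface:
  assumes G: "multilin H (Suc n) G" and j: "j < n"
  shows "multilin H n (\<lambda>us. bsum (comult H (us ! j)) (\<lambda>a b. G (take j us @ a # b # drop (Suc j) us)))"
  unfolding multilin_def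
proof (intro allI impI)
  fix vs :: "'h list" and i assume vs: "length vs = n" "i < n"
  let ?L = "\<lambda>a b. take j vs @ a # b # drop (Suc j) vs"
  consider "i < j" | "i = j" | "j < i" by linarith
  then show "lin UNIV (scale H)
      (\<lambda>x. bsum (comult H (vs[i := x] ! j)) (\<lambda>a b. G (take j (vs[i := x]) @ a # b # drop (Suc j) (vs[i := x]))))"
  proof cases
    case 1
    have "lin UNIV (scale H) (\<lambda>x. G ((?L a b)[i := x]))" for a b
      using G vs j by (simp add: multilin_def)
    then show ?thesis
      using 1 vs j by (auto simp: list_update_append take_update_swap intro!: lin_fun_bsum)
  next
    case 2
    then show ?thesis using vs by (simp add: lin_UNIV_iff)
  next
    case 3
    then obtain k where k: "i = Suc (j + k)" by (auto dest: less_imp_Suc_add)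
    have "drop (Suc j) (vs[i := x]) = (drop (Suc j) vs)[k := x]" for x
      by (simp add: k drop_update_swap)
    moreover have "lin UNIV (scale H) (\<lambda>x. G ((?L a b)[Suc i := x]))" for a b
      using G vs j by (simp add: multilin_def)
    moreover have "(?L a b)[Suc i := x] = take j vs @ a # b # (drop (Suc j) vs)[k := x]" for x a b
      using vs j by (simp add: k list_update_append Suc_diff_le)
    ultimately show ?thesis
      by (simp add: k lin_fun_bsum)
  qed
qed

end

section \<open>The calculus in low degrees\<close>

text \<open>Keeping \<open>T\<close> a parameter lets one development cover both calculi; two
  instances are used together once the two modules meet.\<close>

locale hopf_calculus = hopf_algebra H for H :: "('k::field, 'h::ring_1) hopf" +
  fixes T :: "'h \<Rightarrow> 'h"
  assumes T_lin [simp]: "T (g + h) = T g + T h" "T (scale H c h) = scale H c (T h)"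
begin

abbreviation "Om \<equiv> K_calculus H T"

lemma grade_Om [simp]: "grade Om n = tensor_power H (Suc n)"
  and incl_Om [simp]: "incl Om h = mtens H [h]"
  by (simp_all add: K_calculus_def)

lemma prd_Om_lin [simp]: "prd Om (w + w') e = prd Om w e + prd Om w' e" "prd Om (fscale c w) e = fscale c (prd Om w e)"
  "prd Om w (e + e') = prd Om w e + prd Om w e'" "prd Om w (fscale c e) = fscale c (prd Om w e)"
  by (simp_all add: K_calculus_def lext_fun_add lext_fun_fscale)

lemma dif_Om_lin [simp]: "dif Om (w + w') = dif Om w + dif Om w'" "dif Om (fscale c w) = fscale c (dif Om w)"
  by (simp_all add: K_calculus_def)

lemma mtens_mid [simp]:
  "mtens H (us @ (a + b) # ws) = mtens H (us @ a # ws) + mtens H (us @ b # ws)"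
  "mtens H (us @ scale H c a # ws) = fscale c (mtens H (us @ a # ws))"
  using multilin_lin_mid[OF multilin_mtens, where V = H and us = us and ws = ws] by (auto simp: lin_UNIV_iff)

lemma mtens_mid2 [simp]:
  "mtens H (us @ u # (a + b) # ws) = mtens H (us @ u # a # ws) + mtens H (us @ u # b # ws)"
  "mtens H (us @ u # scale H c a # ws) = fscale c (mtens H (us @ u # a # ws))"
  using mtens_mid[of "us @ [u]"] by auto

lemma multilin_mtens_append: "multilin H n (\<lambda>us. mtens H (us @ ws))"
  by (rule multilin_append) (rule multilin_mtens)

text \<open>No antipode occurs in the product for m = 0. This is the right action of H on forms,
  over which the tensor product with a module is balanced.\<close>

lemma prd_degree_0:
  assumes "xs \<noteq> []"
  shows "prd Om (mtens H xs) (mtens H [a]) = mtens H (butlast xs @ [last xs * a])"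
proof -
  have gen: "K_prd_gen H T xs [a] = mtens H (butlast xs @ [last xs * a])" for xs a
    unfolding K_prd_gen_def
    by (simp, subst lext_mtens) (auto intro: multilin_1I simp: lin_UNIV_iff distrib_right)
  have ys: "lext (K_prd_gen H T xs) (mtens H [a]) = mtens H (butlast xs @ [last xs * a])" for xs
    by (subst lext_mtens) (auto intro: multilin_1I simp: lin_UNIV_iff distrib_left gen)
  have "multilin H (Suc (length xs - 1)) (\<lambda>xs. mtens H (butlast xs @ [last xs * a]))"
    by (rule multilin_snocI) (auto intro: multilin_mtens_append simp: lin_UNIV_iff distrib_right)
  then show ?thesis using assms
    by (simp add: K_calculus_def ys lext_mtens)
qed

lemma multilin_prd_degree_1:
  "multilin H (Suc n) (\<lambda>vs. bsum (comult H (last vs)) (\<lambda>a b. bsum (comult H b) (\<lambda>b1 b2.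
      mtens H (butlast vs @ [a * y0 * T b2, b1 * y1]))))"
  by (rule multilin_snocI)
    (auto intro!: multilin_mtens_append multilin_fun_bsum simp: lin_UNIV_iff)

text \<open>Right factors of degree 0 and 1 are the ones that occur: balancing multiplies by
  elements of H, and the extended connection multiplies by values of the connection, which have
  degree 1.\<close>

lemma prd_degree_1:
  assumes "xs \<noteq> []"
  shows "prd Om (mtens H xs) (mtens H [y0, y1]) = bsum (comult H (last xs)) (\<lambda>a b. bsum (comult H b) (\<lambda>b1 b2.
      mtens H (butlast xs @ [a * y0 * T b2, b1 * y1])))"
proof -
  have gen: "K_prd_gen H T xs [y0, y1] = bsum (comult H (last xs)) (\<lambda>a b. bsum (comult H b) (\<lambda>b1 b2.
      mtens H (butlast xs @ [a * y0 * T b2, b1 * y1])))" for xs y0 y1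
    unfolding K_prd_gen_def Let_def
    by (simp, subst lext_iter_comult_2)
      (auto intro!: multilin_3I simp: lin_UNIV_iff distrib_right distrib_left numeral_3_eq_3)
  have ys: "lext (K_prd_gen H T xs) (mtens H [y0, y1]) = bsum (comult H (last xs)) (\<lambda>a b. bsum (comult H b) (\<lambda>b1 b2.
      mtens H (butlast xs @ [a * y0 * T b2, b1 * y1])))" for xs
    by (subst lext_mtens)
      (auto intro!: multilin_2I simp: lin_UNIV_iff distrib_left distrib_right gen bsum_fun)
  have "multilin H (length xs) (\<lambda>vs. bsum (comult H (last vs)) (\<lambda>a b. bsum (comult H b) (\<lambda>b1 b2.
      mtens H (butlast vs @ [a * y0 * T b2, b1 * y1]))))"
    using multilin_prd_degree_1[of "length xs - 1"] assms by simp
  then show ?thesis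
    by (simp add: K_calculus_def ys lext_mtens)
qed

text \<open>The last factor is split off because it is absorbed into the module when \<Omega>^n
  (x)_H M is identified with H^n (x) M.\<close>

definition dif_snoc :: "'h list \<Rightarrow> 'h \<Rightarrow> ('h list \<Rightarrow>\<^sub>0 'k)" where
  "dif_snoc us h = (\<Sum>j<length us. fscale ((-1) ^ j) (bsum (comult H (us ! j))
        (\<lambda>a b. mtens H (take j us @ a # b # drop (Suc j) us @ [h]))))
    - mtens H (1 # us @ [h])
    + fscale ((-1) ^ length us) (bsum (comult H h) (\<lambda>a b. bsum (comult H b) (\<lambda>b1 b2. mtens H (us @ [a * T b2, b1]))))"

lemma K_dif_gen_snoc: "K_dif_gen H T (us @ [h]) = dif_snoc us h"
proof -
  have "lext (\<lambda>zs. mtens H (us @ [zs ! 0 * T (zs ! 2), zs ! 1])) (iter_comult H 2 h) =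
      bsum (comult H h) (\<lambda>a b. bsum (comult H b) (\<lambda>b1 b2. mtens H (us @ [a * T b2, b1])))"
    by (subst lext_iter_comult_2)
      (auto intro!: multilin_3I simp: lin_UNIV_iff distrib_right distrib_left numeral_3_eq_3)
  then show ?thesis
    by (simp add: K_dif_gen_def dif_snoc_def bsum_def[symmetric] nth_append Let_def)
qed

lemma dif_snoc: "dif Om (mtens H (us @ [h])) = dif_snoc us h"
proof -
  let ?n = "length us"
  have c: "multilin H ?n (\<lambda>us. mtens H (1 # us @ [h]))" for h
  proof -
    have "multilin H (?n + length [h]) (\<lambda>us. mtens H (1 # us))"
      by (rule multilin_Cons[where G = "mtens H"]) (rule multilin_mtens)
    from multilin_append[OF this] show ?thesis by simp
  qed
  have s: "multilin H ?n (\<lambda>us. bsum (comult H (us ! j)) (\<lambda>a b. mtens H (take j us @ a # b # drop (Suc j) us @ [h])))"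
    if "j < ?n" for j h
    using multilin_coface[of ?n "\<lambda>us. mtens H (us @ [h])" j] that by (simp add: multilin_mtens_append)
  \<comment> \<open>This is \<open>dif_snoc\<close> with the number of factors frozen at
    \<open>?n\<close>, so that signs and range of summation stay fixed while a slot varies.\<close>
  let ?D = "\<lambda>us h. (\<Sum>j<?n. fscale ((-1) ^ j) (bsum (comult H (us ! j))
        (\<lambda>a b. mtens H (take j us @ a # b # drop (Suc j) us @ [h]))))
    - mtens H (1 # us @ [h])
    + fscale ((-1) ^ ?n) (bsum (comult H h) (\<lambda>a b. bsum (comult H b) (\<lambda>b1 b2. mtens H (us @ [a * T b2, b1]))))"
  have l: "lin UNIV (scale H) (\<lambda>h. mtens H (1 # us @ [h]))"
    "lin UNIV (scale H) (\<lambda>h. mtens H (take j us @ a # b # drop (Suc j) us @ [h]))" for us j a b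
    using mtens_mid[of "1 # us" _ _ "[]"] mtens_mid[of "take j us @ a # b # drop (Suc j) us" _ _ "[]"]
    by (simp_all add: lin_UNIV_iff)
  have l3: "lin UNIV (scale H) (\<lambda>h. bsum (comult H h) (\<lambda>a b. bsum (comult H b) (\<lambda>b1 b2. mtens H (us @ [a * T b2, b1]))))" for us
    by (simp add: lin_UNIV_iff)
  have "multilin H (Suc ?n) (\<lambda>vs. ?D (butlast vs) (last vs))"
    by (rule multilin_snocI)
      (auto intro!: c s l l3 lin_fun_bsum lin_fun_add lin_fun_diff lin_fun_sum lin_fun_fscale
        multilin_fun_add multilin_fun_diff multilin_fun_sum multilin_fun_fscale multilin_fun_bsum
        multilin_mtens_append simp del: bsum_simps)
  \<comment> \<open>Multilinearity concerns only lists of length \<open>Suc ?n\<close>, and on these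
    the two expressions agree.\<close>
  then have "multilin H (Suc ?n) (K_dif_gen H T)"
  proof (rule multilin_cong[THEN iffD1, rotated])
    fix vs :: "'h list" assume "length vs = Suc ?n"
    then obtain us' h' where "vs = us' @ [h']" "length us' = ?n" by (cases vs rule: rev_cases) auto
    then show "?D (butlast vs) (last vs) = K_dif_gen H T vs"
      by (simp add: K_dif_gen_snoc dif_snoc_def)
  qed
  then show ?thesis by (simp add: K_calculus_def lext_mtens K_dif_gen_snoc)
qed

lemma snoc_cases:
  assumes "length vs = Suc n"
  obtains us h where "vs = us @ [h]" "length us = n"
  using assms by (cases vs rule: rev_cases) auto

lemma prd_incl_in: "w \<in> carrier (tensor_power H (Suc n)) \<Longrightarrow> prd Om w (mtens H [a]) \<in> carrier (tensor_power H (Suc n))"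
proof -
  assume w: "w \<in> carrier (tensor_power H (Suc n))"
  have "prd Om w (mtens H [a]) = lext (\<lambda>vs. prd Om (mtens H vs) (mtens H [a])) w"
    by (rule lin_tensor_power_expand[OF w]) (simp add: lin_def)
  also have "\<dots> \<in> carrier (tensor_power H (Suc n))"
  proof (rule lext_in_subspace[OF subspace_tensor_power])
    fix vs assume "vs \<in> Poly_Mapping.keys w"
    from keys_tensor_power[OF w this] obtain us h where "vs = us @ [h]" "length us = n"
      by (rule snoc_cases)
    then show "prd Om (mtens H vs) (mtens H [a]) \<in> carrier (tensor_power H (Suc n))"
      by (simp add: prd_degree_0 mtens_in_tensor_power)
  qed
  finally show ?thesis .
qed

lemma dif_in: "w \<in> carrier (tensor_power H (Suc n)) \<Longrightarrow> dif Om w \<in> carrier (tensor_power H (Suc (Suc n)))"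
proof -
  assume w: "w \<in> carrier (tensor_power H (Suc n))"
  note cl = free.subspace_add[OF subspace_tensor_power] free.subspace_diff[OF subspace_tensor_power]
    free.subspace_sum[OF subspace_tensor_power] free.subspace_scale[OF subspace_tensor_power]
    bsum_in_subspace[OF subspace_tensor_power]
  have "dif Om w = lext (\<lambda>vs. dif Om (mtens H vs)) w"
    by (rule lin_tensor_power_expand[OF w]) (simp add: lin_def)
  also have "\<dots> \<in> carrier (tensor_power H (Suc (Suc n)))"
  proof (rule lext_in_subspace[OF subspace_tensor_power])
    fix vs assume "vs \<in> Poly_Mapping.keys w"
    from keys_tensor_power[OF w this] obtain us h where "vs = us @ [h]" "length us = n"
      by (rule snoc_cases)
    then show "dif Om (mtens H vs) \<in> carrier (tensor_power H (Suc (Suc n)))"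
      by (auto simp: dif_snoc dif_snoc_def intro!: cl mtens_in_tensor_power)
  qed
  finally show ?thesis .
qed

lemma prd_degree_1_in:
  assumes w: "w \<in> carrier (tensor_power H (Suc n))" and e: "e \<in> carrier (tensor_power H 2)"
  shows "prd Om w e \<in> carrier (tensor_power H (Suc (Suc n)))"
proof -
  have "prd Om w e = lext (\<lambda>ys. prd Om w (mtens H ys)) e"
    by (rule lin_tensor_power_expand[OF e]) (simp add: lin_def)
  also have "\<dots> = lext (\<lambda>ys. lext (\<lambda>vs. prd Om (mtens H vs) (mtens H ys)) w) e"
    by (intro lext_cong refl lin_tensor_power_expand[OF w]) (simp add: lin_def)
  also have "\<dots> \<in> carrier (tensor_power H (Suc (Suc n)))"
  proof (intro lext_in_subspace subspace_tensor_power)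
    fix ys vs assume "ys \<in> Poly_Mapping.keys e" "vs \<in> Poly_Mapping.keys w"
    then have "length ys = 2" "length vs = Suc n"
      using keys_tensor_power[OF w] keys_tensor_power[OF e] by auto
    then obtain y0 y1 where "ys = [y0, y1]" by (auto simp: length_Suc_conv numeral_2_eq_2)
    with \<open>length vs = Suc n\<close> show "prd Om (mtens H vs) (mtens H ys) \<in> carrier (tensor_power H (Suc (Suc n)))"
      by (subst \<open>ys = _\<close>, subst prd_degree_1)
        (auto intro!: bsum_in_subspace subspace_tensor_power mtens_in_tensor_power)
  qed
  finally show ?thesis .
qed

end

section \<open>The balanced tensor product and linear maps out of it\<close>

locale hopf_module = hopf_calculus H T
  for H :: "('k::field, 'h::ring_1) hopf" and T :: "'h \<Rightarrow> 'h" +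
  fixes M :: "('k, 'h, 'm::ab_group_add) lmodule"
  assumes left_module_M: "left_module H M"
begin

lemma vec_space_M: "vec_space M"
  using left_module_M by (simp add: left_module_def)

lemma act_simps [simp]:
  "m \<in> carrier M \<Longrightarrow> act M a m \<in> carrier M"
  "m \<in> carrier M \<Longrightarrow> m' \<in> carrier M \<Longrightarrow> act M a (m + m') = act M a m + act M a m'"
  "m \<in> carrier M \<Longrightarrow> act M (a + b) m = act M a m + act M b m"
  "m \<in> carrier M \<Longrightarrow> act M (a * b) m = act M a (act M b m)"
  "m \<in> carrier M \<Longrightarrow> act M 1 m = m"
  "m \<in> carrier M \<Longrightarrow> act M (scale H c a) m = scale M c (act M a m)"
  using left_module_M by (simp_all add: left_module_def)

text \<open>The module axioms state homogeneity in the algebra argument. Since c1 commutes with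
  every \<open>a\<close>, acting by c1 before or after \<open>a\<close> gives homogeneity in the
  module argument.\<close>

lemma act_scale [simp]:
  assumes "m \<in> carrier M"
  shows "act M a (scale M c m) = scale M c (act M a m)"
proof -
  have "scale H c 1 * a = a * scale H c 1" by simp
  moreover have "scale M c m = act M (scale H c 1) m" using assms by simp
  ultimately have "act M a (scale M c m) = act M (scale H c 1 * a) m"
    using assms by (metis act_simps(4))
  then show ?thesis using assms by (simp del: mult_scale)
qed

lemmas M_closed [simp] = vec_space_closed[OF vec_space_M]

lemmas tens_HM_lin [simp] = tens_lin[where V = H and W = M, simplified]

lemma bilin_btens: "bilin (tensor_power H (Suc n)) M (btens Om M n)"
  using bilin_nf[of "grade Om n" M "bal_rel Om M n"] by (simp add: btens_def[abs_def] bal_rel_def)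

lemma btens_balanced:
  assumes "w \<in> carrier (tensor_power H (Suc n))" "m \<in> carrier M"
  shows "btens Om M n (prd Om w (mtens H [a])) m = btens Om M n w (act M a m)"
  unfolding btens_def by (rule nf_gen_eqI) (use assms in \<open>auto simp: bal_rel_def\<close>)

lemma keys_bal_rel:
  assumes "r \<in> bal_rel Om M n"
  shows "Poly_Mapping.keys r \<subseteq> carrier (tensor_power H (Suc n)) \<times> carrier M"
  using assms unfolding bal_rel_def
proof (elim UnE)
  assume "r \<in> bilin_rel (grade Om n) M"
  then show ?thesis
    using keys_bilin_rel[OF vec_space_tensor_power vec_space_M, of r H "Suc n"] by simp
next
  assume "r \<in> {gen (prd Om \<omega> (incl Om a), m) - gen (\<omega>, act M a m) |\<omega> a m.
    \<omega> \<in> carrier (grade Om n) \<and> m \<in> carrier M}"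
  then show ?thesis
    by (elim CollectE exE conjE; hypsubst) (intro keys_diff_subset; simp add: prd_incl_in)
qed

lemma carrier_btensor:
  "carrier (btensor Om M n) = quot (bal_rel Om M n) (carrier (tensor_power H (Suc n)) \<times> carrier M)"
  and scale_btensor [simp]: "scale (btensor Om M n) = fscale"
  by (simp_all add: btensor_def quot_def)

lemma subspace_btensor: "free.subspace (carrier (btensor Om M n))"
  by (simp add: carrier_btensor subspace_quot)

lemma btens_in:
  "w \<in> carrier (tensor_power H (Suc n)) \<Longrightarrow> m \<in> carrier M \<Longrightarrow> btens Om M n w m \<in> carrier (btensor Om M n)"
  by (simp add: carrier_btensor btens_def nf_gen_in_quot)

lemma keys_btensor:
  assumes "t \<in> carrier (btensor Om M n)" "(w, m) \<in> Poly_Mapping.keys t"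
  shows "w \<in> carrier (tensor_power H (Suc n))" "m \<in> carrier M"
  using assms by (auto simp: carrier_btensor quot_iff[OF keys_bal_rel])

lemma lin_btensor_expand:
  assumes t: "t \<in> carrier (btensor Om M n)" and f: "lin (carrier (btensor Om M n)) fscale f"
  shows "f t = bsum t (\<lambda>w m. f (btens Om M n w m))"
proof -
  have "bsum t (btens Om M n) = t"
    using t lext_nf_gen[of "bal_rel Om M n" t]
    by (simp add: bsum_def btens_def case_prod_unfold carrier_btensor quot_iff[OF keys_bal_rel])
  moreover have "f (bsum t (btens Om M n)) = bsum t (\<lambda>w m. f (btens Om M n w m))"
    unfolding bsum_def
    by (subst lin_lin_ext[OF f vector_space_fscale subspace_btensor])
      (use keys_btensor[OF t] in \<open>auto intro!: btens_in simp: case_prod_unfold intro: lext_cong\<close>)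
  ultimately show ?thesis by simp
qed

text \<open>As \<open>us\<close> has length \<open>n\<close>, this is the identification of \<open>H\<^sup>n \<otimes> M\<close> with \<open>\<Omega>\<^sup>n \<otimes>\<^sub>H M\<close>.\<close>

definition cotens :: "'h list \<Rightarrow> 'm \<Rightarrow> (('h list \<Rightarrow>\<^sub>0 'k) \<times> 'm \<Rightarrow>\<^sub>0 'k)" where
  "cotens us m = btens Om M (length us) (mtens H (us @ [1])) m"

text \<open>Write us (x) h as (us (x) 1) h and move h across the balanced tensor sign.\<close>

lemma btens_snoc:
  assumes "length us = n" "m \<in> carrier M"
  shows "btens Om M n (mtens H (us @ [h])) m = cotens us (act M h m)"
  using btens_balanced[of "mtens H (us @ [1])" n m h] assms
  by (simp add: prd_degree_0 cotens_def mtens_in_tensor_power)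

lemma cotens_in: "length us = n \<Longrightarrow> m \<in> carrier M \<Longrightarrow> cotens us m \<in> carrier (btensor Om M n)"
  by (auto simp: cotens_def intro!: btens_in mtens_in_tensor_power)

text \<open>By \<open>btens_snoc\<close> the elements \<open>cotens us m\<close> span, so they may
  replace pure balanced tensors in proofs of equality.\<close>

lemma lin_btensor_eqI:
  assumes t: "t \<in> carrier (btensor Om M n)"
    and f: "lin (carrier (btensor Om M n)) fscale f" "lin (carrier (btensor Om M n)) fscale f'"
    and eq: "\<And>us m. length us = n \<Longrightarrow> m \<in> carrier M \<Longrightarrow> f (cotens us m) = f' (cotens us m)"
  shows "f t = f' t"
  unfolding lin_btensor_expand[OF t f(1)] lin_btensor_expand[OF t f(2)]
proof (rule bsum_cong[OF refl])
  fix w m assume "(w, m) \<in> Poly_Mapping.keys t"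
  note w = keys_btensor[OF t this]
  show "f (btens Om M n w m) = f' (btens Om M n w m)"
  proof (rule lin_tensor_power_eqI[OF w(1)])
    show "lin (carrier (tensor_power H (Suc n))) fscale (\<lambda>w. f (btens Om M n w m))"
      "lin (carrier (tensor_power H (Suc n))) fscale (\<lambda>w. f' (btens Om M n w m))"
      using w bilinD[OF bilin_btens] btens_in by (auto intro!: f[THEN lin_comp])
    fix vs :: "'h list" assume "length vs = Suc n"
    then obtain us h where "vs = us @ [h]" "length us = n" by (rule snoc_cases)
    then show "f (btens Om M n (mtens H vs) m) = f' (btens Om M n (mtens H vs) m)"
      using w by (simp add: btens_snoc eq)
  qed
qed

text \<open>The universal property of the balanced tensor product. Balancedness is asked on pure
  tensors and passes to all forms because both sides are linear in the form.\<close>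

lemma bsum_btens:
  assumes F: "bilin (tensor_power H (Suc n)) M F"
    and bal: "\<And>us h a m. length us = n \<Longrightarrow> m \<in> carrier M \<Longrightarrow>
      F (mtens H (us @ [h * a])) m = F (mtens H (us @ [h])) (act M a m)"
    and w: "w \<in> carrier (tensor_power H (Suc n))" and m: "m \<in> carrier M"
  shows "bsum (btens Om M n w m) F = F w m"
proof -
  have "F (prd Om v (mtens H [a])) m' = F v (act M a m')"
    if "v \<in> carrier (tensor_power H (Suc n))" "m' \<in> carrier M" for v a m'
  proof (rule lin_tensor_power_eqI[OF that(1)])
    show "lin (carrier (tensor_power H (Suc n))) fscale (\<lambda>v. F (prd Om v (mtens H [a])) m')"
      "lin (carrier (tensor_power H (Suc n))) fscale (\<lambda>v. F v (act M a m'))"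
      using that(2) bilinD[OF F] by (simp_all add: lin_def prd_incl_in)
    fix vs :: "'h list" assume "length vs = Suc n"
    then obtain us h where "vs = us @ [h]" "length us = n" by (rule snoc_cases)
    then show "F (prd Om (mtens H vs) (mtens H [a])) m' = F (mtens H vs) (act M a m')"
      using that(2) by (simp add: prd_degree_0 bal)
  qed
  then have "lext (case_prod F) r = 0" if "r \<in> bal_rel Om M n" for r
    using that by (auto simp: bal_rel_def bilin_rel_def bilinD[OF F, simplified])
  then show ?thesis using w m by (simp add: btens_def bsum_def lext_nf)
qed

definition mlin :: "nat \<Rightarrow> ('h list \<Rightarrow> 'm \<Rightarrow> ('e \<Rightarrow>\<^sub>0 'k)) \<Rightarrow> bool" where
  "mlin n G \<longleftrightarrow> (\<forall>m\<in>carrier M. multilin H n (\<lambda>us. G us m)) \<and>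
     (\<forall>us. length us = n \<longrightarrow> lin (carrier M) (scale M) (G us))"

lemma mlin_cotens: "mlin n cotens"
proof -
  have "multilin H n (\<lambda>us. cotens us m)" if "m \<in> carrier M" for m
  proof -
    have "lin UNIV (scale H) (\<lambda>a. btens Om M n (mtens H (vs[i := a] @ [1])) m)"
      if "length vs = n" "i < n" for vs i
      using multilin_mtens_append[of n "[1]"] that \<open>m \<in> carrier M\<close> bilinD[OF bilin_btens]
      by (simp add: multilin_def lin_UNIV_iff mtens_in_tensor_power)
    then show ?thesis by (simp add: multilin_def cotens_def)
  qed
  moreover have "lin (carrier M) (scale M) (cotens us)" if "length us = n" for us
    using that bilinD[OF bilin_btens] by (simp add: lin_def cotens_def mtens_in_tensor_power)
  ultimately show ?thesis by (simp add: mlin_def)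
qed

text \<open>The map out of \<Omega>^n (x)_H M induced by \<open>G\<close>: it sends (us (x) h) (x) m
  to G us (hm). With \<open>ev_cotens\<close> it shows that the elements \<open>cotens us m\<close>
  satisfy no relations beyond multilinearity.\<close>

definition ev :: "('h list \<Rightarrow> 'm \<Rightarrow> ('e \<Rightarrow>\<^sub>0 'k)) \<Rightarrow> (('h list \<Rightarrow>\<^sub>0 'k) \<times> 'm \<Rightarrow>\<^sub>0 'k) \<Rightarrow> ('e \<Rightarrow>\<^sub>0 'k)" where
  "ev G t = bsum t (\<lambda>w m. lext (\<lambda>hs. G (butlast hs) (act M (last hs) m)) w)"

lemma ev_cotens:
  assumes G: "mlin n G" and us: "length us = n" and m: "m \<in> carrier M"
  shows "ev G (cotens us m) = G us m"
proof -
  let ?F = "\<lambda>w m. lext (\<lambda>hs. G (butlast hs) (act M (last hs) m)) w"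
  have "multilin H (Suc n) (\<lambda>hs. G (butlast hs) (act M (last hs) m))" if "m \<in> carrier M" for m
    by (rule multilin_snocI) (use G that in \<open>auto simp: mlin_def lin_def\<close>)
  then have F: "?F (mtens H (us @ [h])) m = G us (act M h m)" if "length us = n" "m \<in> carrier M" for us h m
    by (subst lext_mtens) (use that in simp_all)
  have lF: "lin (carrier M) (scale M) (?F w)" if "w \<in> carrier (tensor_power H (Suc n))" for w
  proof (rule lin_fun_lext)
    fix hs assume "hs \<in> Poly_Mapping.keys w"
    with keys_tensor_power[OF that] have "length (butlast hs) = n" by simp
    then show "lin (carrier M) (scale M) (\<lambda>m. G (butlast hs) (act M (last hs) m))"
      using G by (auto simp: mlin_def lin_def)
  qed
  have "bsum (btens Om M n (mtens H (us @ [1])) m) ?F = ?F (mtens H (us @ [1])) m"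
  proof (rule bsum_btens)
    show "bilin (tensor_power H (Suc n)) M ?F" using lF by (simp add: bilin_def)
    show "?F (mtens H (us @ [h * a])) m = ?F (mtens H (us @ [h])) (act M a m)"
      if "length us = n" "m \<in> carrier M" for us h a m
      using that by (simp add: F)
  qed (use us m in \<open>simp_all add: mtens_in_tensor_power\<close>)
  then show ?thesis using us m by (simp add: ev_def cotens_def F)
qed

lemma bilin_cotens_snoc: "bilin H M (\<lambda>g. cotens (us @ [g]))"
  using mlin_cotens[of "Suc (length us)"] multilin_lin_mid[of H us "[]" "\<lambda>us. cotens us m" for m]
  by (auto simp: bilin_def mlin_def)

lemma bilin_cotens_single: "bilin H M (\<lambda>g. cotens [g])"
  using bilin_cotens_snoc[of "[]"] by simp

text \<open>The inverse of \<open>ident\<close> on the carriers, as \<open>of_tensor_ident\<close>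
  and \<open>ident_of_tensor\<close> show.\<close>

definition of_tensor :: "('h \<times> 'm \<Rightarrow>\<^sub>0 'k) \<Rightarrow> (('h list \<Rightarrow>\<^sub>0 'k) \<times> 'm \<Rightarrow>\<^sub>0 'k)" where
  "of_tensor u = bsum u (\<lambda>g m. cotens [g] m)"

lemma of_tensor_lin [simp]: "of_tensor (u + v) = of_tensor u + of_tensor v" "of_tensor (fscale c u) = fscale c (of_tensor u)"
  by (simp_all add: of_tensor_def)

lemma of_tensor_tens: "m \<in> carrier M \<Longrightarrow> of_tensor (tens H M g m) = cotens [g] m"
  by (simp add: of_tensor_def bsum_tens[OF bilin_cotens_single])

lemma of_tensor_in: "u \<in> carrier (tensor H M) \<Longrightarrow> of_tensor u \<in> carrier (btensor Om M 1)"
  unfolding of_tensor_def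
  by (rule bsum_in_subspace[OF subspace_btensor])
    (auto intro!: cotens_in dest: keys_tensor[OF vec_space_H vec_space_M])

lemma mlin_tens: "mlin 1 (\<lambda>us. tens H M (us ! 0))"
  by (auto simp: mlin_def lin_def intro!: multilin_1I)

lemma ident_eq_ev:
  assumes t: "t \<in> carrier (btensor Om M 1)"
  shows "ident H M t = ev (\<lambda>us. tens H M (us ! 0)) t"
  unfolding ident_def bsum_def[symmetric] ev_def
proof (intro bsum_cong lext_cong refl)
  fix w m hs assume "(w, m) \<in> Poly_Mapping.keys t" "hs \<in> Poly_Mapping.keys w"
  with keys_btensor[OF t] keys_tensor_power have "length hs = Suc 1" by blast
  then show "tens H M (hs ! 0) (act M (hs ! 1) m) = tens H M (butlast hs ! 0) (act M (last hs) m)"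
    by (auto simp: length_Suc_conv)
qed

lemma ident_cotens: "m \<in> carrier M \<Longrightarrow> ident H M (cotens [g] m) = tens H M g m"
  by (simp add: ident_eq_ev cotens_in ev_cotens[OF mlin_tens])

lemma of_tensor_ident:
  assumes t: "t \<in> carrier (btensor Om M 1)"
  shows "of_tensor (ident H M t) = t"
proof (rule lin_btensor_eqI[OF t])
  show "lin (carrier (btensor Om M 1)) fscale (\<lambda>t. of_tensor (ident H M t))"
    "lin (carrier (btensor Om M 1)) fscale (\<lambda>t. t)"
    by (simp_all add: lin_def ident_def bsum_def[symmetric])
  fix us :: "'h list" and m assume "length us = 1" "m \<in> carrier M"
  then show "of_tensor (ident H M (cotens us m)) = cotens us m"
    by (auto simp: length_Suc_conv ident_cotens of_tensor_tens)
qed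

lemma ident_of_tensor:
  assumes u: "u \<in> carrier (tensor H M)"
  shows "ident H M (of_tensor u) = u"
proof (rule lin_tensor_eqI[OF vec_space_H vec_space_M u])
  show "lin (carrier (tensor H M)) fscale (\<lambda>u. ident H M (of_tensor u))"
    "lin (carrier (tensor H M)) fscale (\<lambda>u. u)"
    by (simp_all add: lin_def ident_def bsum_def[symmetric])
qed (simp add: of_tensor_tens ident_cotens)

lemma ident_in:
  assumes t: "t \<in> carrier (btensor Om M 1)"
  shows "ident H M t \<in> carrier (tensor H M)"
proof -
  have "ident H M t = bsum t (\<lambda>w m. lext (\<lambda>gh. tens H M (gh ! 0) (act M (gh ! 1) m)) w)"
    by (simp add: ident_def bsum_def)
  also have "\<dots> \<in> carrier (tensor H M)"
    using keys_btensor[OF t]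
    by (auto intro!: bsum_in_subspace lext_in_subspace subspace_tensor tens_in_tensor)
  finally show ?thesis .
qed

end

lemma lin_sum_on:
  assumes "lin C s f" "vector_space s" "module.subspace s C" "\<And>i. i \<in> I \<Longrightarrow> x i \<in> C"
  shows "f (\<Sum>i\<in>I. x i) = (\<Sum>i\<in>I. f (x i))"
proof -
  interpret vector_space s by fact
  have 0: "f 0 = 0"
    using assms(1,3) subspace_0 scale_zero_left[of 0] free.scale_zero_left by (metis lin_def)
  show ?thesis
    using assms(4)
  proof (induction I rule: infinite_finite_induct)
    case (insert i I)
    then have "(\<Sum>i\<in>I. x i) \<in> C" using assms(3) by (auto intro!: subspace_sum)
    then show ?case using insert assms(1) by (simp add: lin_def)
  qed (simp_all add: 0)
qed

lemma lin_diff_on: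
  assumes "lin C s f" "vector_space s" "module.subspace s C" "x \<in> C" "y \<in> C"
  shows "f (x - y) = f x - f y"
proof -
  interpret vector_space s by fact
  have "f (x + s (- 1) y) = f x + f (s (- 1) y)"
    using assms(1,4) subspace_scale[OF assms(3,5)] unfolding lin_def by blast
  moreover have "f (s (- 1) y) = fscale (- 1) (f y)"
    using assms(1,5) unfolding lin_def by blast
  ultimately show ?thesis by simp
qed

text \<open>The terms with \<open>i < j\<close> cancel those with \<open>j \<le> i\<close>.\<close>

lemma cosimplicial_cancel:
  fixes A :: "nat \<Rightarrow> nat \<Rightarrow> ('e \<Rightarrow>\<^sub>0 'k::field)"
  assumes "\<And>i j. i < j \<Longrightarrow> j \<le> Suc N \<Longrightarrow> A i j = A (j - 1) i"
  shows "(\<Sum>i\<le>N. \<Sum>j\<le>Suc N. fscale ((-1) ^ (i + j)) (A i j)) = 0"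
proof -
  let ?f = "\<lambda>(i, j). fscale ((-1) ^ (i + j)) (A i j)"
  let ?U = "{(i, j). i < j \<and> j \<le> Suc N}" and ?L = "{(i, j). j \<le> i \<and> i \<le> N}"
  have fin: "finite ?U" "finite ?L"
    by (rule finite_subset[of _ "{..Suc N} \<times> {..Suc N}"]; auto)+
  have "sum ?f ?U = (\<Sum>p\<in>?L. - ?f p)"
    by (rule sum.reindex_bij_witness[of _ "\<lambda>(i, j). (j, Suc i)" "\<lambda>(i, j). (j - 1, i)"])
      (auto simp: assms add.commute minus_one_power_iff split: if_splits)
  then have "sum ?f ?U + sum ?f ?L = 0" by (simp add: sum_negf)
  moreover have "sum ?f ?U + sum ?f ?L = sum ?f ({..N} \<times> {..Suc N})"
    by (subst sum.union_disjoint[symmetric]) (auto simp: fin intro!: sum.cong)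
  ultimately show ?thesis by (simp add: sum.cartesian_product del: sum.atMost_Suc)
qed

section \<open>Flat connections as compatible coactions\<close>

definition compatible :: "('k::field, 'h::ring_1) hopf \<Rightarrow> ('h \<Rightarrow> 'h) \<Rightarrow> ('k, 'h, 'm::ab_group_add) lmodule \<Rightarrow>
    ('m \<Rightarrow> ('h \<times> 'm \<Rightarrow>\<^sub>0 'k)) \<Rightarrow> bool" where
  "compatible H T M rho \<longleftrightarrow> (\<forall>h. \<forall>m\<in>carrier M. rho (act M h m) =
     bsum (rho m) (\<lambda>g m0. bsum (comult H h) (\<lambda>a b. bsum (comult H b)
       (\<lambda>b1 b2. tens H M (a * g * T b2) (act M b1 m0)))))"

definition coassociative :: "('k::field, 'h::ring_1) hopf \<Rightarrow> ('k, 'h, 'm::ab_group_add) lmodule \<Rightarrow>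
    ('m \<Rightarrow> ('h \<times> 'm \<Rightarrow>\<^sub>0 'k)) \<Rightarrow> bool" where
  "coassociative H M rho \<longleftrightarrow> (\<forall>m\<in>carrier M.
     bsum (rho m) (\<lambda>g m0. bsum (comult H g) (\<lambda>a b. tens H (tensor H M) a (tens H M b m0))) =
     bsum (rho m) (\<lambda>g m0. bsum (rho m0) (\<lambda>g' m1. tens H (tensor H M) g (tens H M g' m1))))"

text \<open>Compatibility and coassociativity stay outside the locale: the first will correspond to
  being a connection, the second to flatness, and these equivalences are proved one at a
  time.\<close>

locale hopf_coaction = hopf_module H T M
  for H :: "('k::field, 'h::ring_1) hopf" and T :: "'h \<Rightarrow> 'h" and M :: "('k, 'h, 'm::ab_group_add) lmodule" +
  fixes rho :: "'m \<Rightarrow> ('h \<times> 'm \<Rightarrow>\<^sub>0 'k)"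
  assumes rho_in: "m \<in> carrier M \<Longrightarrow> rho m \<in> carrier (tensor H M)"
    and rho_lin: "lin (carrier M) (scale M) rho"
begin

lemma keys_rho: "m \<in> carrier M \<Longrightarrow> (g, m0) \<in> Poly_Mapping.keys (rho m) \<Longrightarrow> m0 \<in> carrier M"
  using keys_tensor(2)[OF vec_space_H vec_space_M rho_in] .

lemma bsum_rho_lin [simp]:
  "m \<in> carrier M \<Longrightarrow> m' \<in> carrier M \<Longrightarrow> bsum (rho (m + m')) F = bsum (rho m) F + bsum (rho m') F"
  "m \<in> carrier M \<Longrightarrow> bsum (rho (scale M c m)) F = fscale c (bsum (rho m) F)"
  using rho_lin by (simp_all add: lin_def)

lemma bsum_compatible:
  assumes "compatible H T M rho" "bilin H M F" "m \<in> carrier M"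
  shows "bsum (rho (act M h m)) F = bsum (rho m) (\<lambda>g m0. bsum (comult H h) (\<lambda>a b. bsum (comult H b)
       (\<lambda>b1 b2. F (a * g * T b2) (act M b1 m0))))"
  using assms(1,3)
  by (simp add: compatible_def bsum_bsum) (intro bsum_cong refl bsum_tens[OF assms(2)]; simp add: keys_rho[OF assms(3)])

text \<open>Coassociativity is an equation in H (x) (H (x) M); this form makes it usable under any
  trilinear expression.\<close>

lemma bsum_coassociative:
  assumes "coassociative H M rho" and F: "trilin H H M F" and m: "m \<in> carrier M"
  shows "bsum (rho m) (\<lambda>g m0. bsum (comult H g) (\<lambda>a b. F a b m0)) =
    bsum (rho m) (\<lambda>g m0. bsum (rho m0) (F g))"
proof -
  have F1: "bilin H M (F a)" for a
    using F by (simp add: trilin_def)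
  \<comment> \<open>\<open>F\<close> factors through the iterated tensor product as this bilinear
    map, whose second argument is an element of H (x) M.\<close>
  let ?F = "\<lambda>a t. bsum t (F a)"
  have "bilin H (tensor H M) ?F"
  proof -
    have "lin UNIV (scale H) (\<lambda>a. bsum t (F a))" if "t \<in> carrier (tensor H M)" for t
      using F keys_tensor[OF vec_space_H vec_space_M that] by (auto simp: trilin_def bilin_def intro!: lin_fun_bsum)
    then show ?thesis by (simp add: bilin_def lin_def)
  qed
  note t = bsum_tens[OF this]
  have "bsum (tens H (tensor H M) a (tens H M b m0)) ?F = F a b m0" if "m0 \<in> carrier M" for a b m0
    using that F1 by (simp add: t tens_in_tensor bsum_tens)
  note t = this
  have "bsum (bsum (rho m) (\<lambda>g m0. bsum (comult H g) (\<lambda>a b. tens H (tensor H M) a (tens H M b m0)))) ?F =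
      bsum (bsum (rho m) (\<lambda>g m0. bsum (rho m0) (\<lambda>g' m1. tens H (tensor H M) g (tens H M g' m1)))) ?F"
    using assms by (simp add: coassociative_def)
  moreover have "bsum (bsum (rho m) (\<lambda>g m0. bsum (comult H g) (\<lambda>a b. tens H (tensor H M) a (tens H M b m0)))) ?F
      = bsum (rho m) (\<lambda>g m0. bsum (comult H g) (\<lambda>a b. F a b m0))"
    unfolding bsum_bsum using m by (intro bsum_cong refl t) (auto dest: keys_rho)
  moreover have "bsum (bsum (rho m) (\<lambda>g m0. bsum (rho m0) (\<lambda>g' m1. tens H (tensor H M) g (tens H M g' m1)))) ?F
      = bsum (rho m) (\<lambda>g m0. bsum (rho m0) (F g))"
    unfolding bsum_bsum using m by (intro bsum_cong refl t) (auto dest: keys_rho)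
  ultimately show ?thesis by simp
qed

lemma btens_bsum:
  assumes "m \<in> carrier M" "\<And>a b. (a, b) \<in> Poly_Mapping.keys t \<Longrightarrow> F a b \<in> carrier (tensor_power H (Suc n))"
  shows "btens Om M n (bsum t F) m = bsum t (\<lambda>a b. btens Om M n (F a b) m)"
proof -
  have "lin (carrier (tensor_power H (Suc n))) fscale (\<lambda>w. btens Om M n w m)"
    using bilin_btens[of n] assms(1) by (simp add: bilin_def)
  from lin_lin_ext[OF this vector_space_fscale subspace_tensor_power, of t "case_prod F"] assms(2)
  show ?thesis by (auto simp: bsum_def case_prod_unfold)
qed

lemma btens_prd:
  assumes us: "length us = n" and m: "m \<in> carrier M"
  shows "btens Om M (Suc n) (prd Om (mtens H (us @ [h])) (mtens H [y0, y1])) m =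
    bsum (comult H h) (\<lambda>a b. bsum (comult H b) (\<lambda>b1 b2. cotens (us @ [a * y0 * T b2]) (act M b1 (act M y1 m))))"
proof -
  have "btens Om M (Suc n) (mtens H (us @ [g, g'])) m = cotens (us @ [g]) (act M g' m)" for g g'
    using btens_snoc[of "us @ [g]" "Suc n" m g'] us m by simp
  then show ?thesis
    using us m
    by (simp add: prd_degree_1 btens_bsum bsum_in_subspace subspace_tensor_power mtens_in_tensor_power)
qed

text \<open>The last factor h of the form multiplies g (x) 1 to h_1 g T(h_3) (x) h_2, and h_2 then
  moves onto m.\<close>

lemma lmult_cotens:
  assumes us: "length us = n" and m: "m \<in> carrier M"
  shows "lmult Om M n 1 (mtens H (us @ [h])) (cotens [g] m) =
    bsum (comult H h) (\<lambda>a b. bsum (comult H b) (\<lambda>b1 b2. cotens (us @ [a * g * T b2]) (act M b1 m)))"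
proof -
  let ?w = "mtens H (us @ [h])"
  let ?F = "\<lambda>e m. btens Om M (Suc n) (prd Om ?w e) m"
  have w: "?w \<in> carrier (tensor_power H (Suc n))" using us by (simp add: mtens_in_tensor_power)
  have "bsum (btens Om M 1 (mtens H [g, 1]) m) ?F = ?F (mtens H [g, 1]) m"
  proof (rule bsum_btens)
    show "bilin (tensor_power H (Suc 1)) M ?F"
      using bilinD[OF bilin_btens] prd_degree_1_in[OF w]
      by (intro bilinI) (simp_all add: numeral_2_eq_2)
    fix us' :: "'h list" and h' a and m' assume "length us' = 1" "m' \<in> carrier M"
    then show "?F (mtens H (us' @ [h' * a])) m' = ?F (mtens H (us' @ [h'])) (act M a m')"
      by (auto simp: length_Suc_conv btens_prd us)
  qed (use m in \<open>auto simp: mtens_in_tensor_power\<close>)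
  then show ?thesis
    using us m by (simp add: lmult_def bsum_def[symmetric] cotens_def[of "[g]"] btens_prd)
qed

lemma btens_dif:
  assumes us: "length us = n" and m: "m \<in> carrier M"
  shows "btens Om M (Suc n) (dif Om (mtens H (us @ [h]))) m =
    (\<Sum>j<n. fscale ((-1) ^ j) (bsum (comult H (us ! j)) (\<lambda>a b. cotens (take j us @ a # b # drop (Suc j) us) (act M h m))))
    - cotens (1 # us) (act M h m)
    + fscale ((-1) ^ n) (bsum (comult H h) (\<lambda>a b. bsum (comult H b) (\<lambda>b1 b2. cotens (us @ [a * T b2]) (act M b1 m))))"
proof -
  have l: "lin (carrier (tensor_power H (Suc (Suc n)))) fscale (\<lambda>w. btens Om M (Suc n) w m)"
    using bilin_btens[of "Suc n"] m by (simp add: bilin_def)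
  note sub = subspace_tensor_power[of H "Suc (Suc n)"]
  note cl = free.subspace_diff[OF sub] free.subspace_sum[OF sub] free.subspace_scale[OF sub] bsum_in_subspace[OF sub]
  have e: "btens Om M (Suc n) (mtens H (vs @ [g])) m = cotens vs (act M g m)" if "length vs = Suc n" for vs g
    using btens_snoc[OF that m] .
  have t1: "bsum (comult H (us ! j)) (\<lambda>a b. mtens H (take j us @ a # b # drop (Suc j) us @ [h])) \<in> carrier (tensor_power H (Suc (Suc n)))"
    if "j < n" for j using that us by (intro bsum_in_subspace[OF sub] mtens_in_tensor_power) simp
  have t2: "mtens H (1 # us @ [h]) \<in> carrier (tensor_power H (Suc (Suc n)))"
    using us by (auto intro!: mtens_in_tensor_power)
  have t3: "bsum (comult H h) (\<lambda>a b. bsum (comult H b) (\<lambda>b1 b2. mtens H (us @ [a * T b2, b1]))) \<in> carrier (tensor_power H (Suc (Suc n)))"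
    using us by (intro bsum_in_subspace[OF sub] mtens_in_tensor_power) simp
  have e1: "btens Om M (Suc n) (bsum (comult H (us ! j)) (\<lambda>a b. mtens H (take j us @ a # b # drop (Suc j) us @ [h]))) m =
      bsum (comult H (us ! j)) (\<lambda>a b. cotens (take j us @ a # b # drop (Suc j) us) (act M h m))" if "j < n" for j
    using e[of "take j us @ _ # _ # drop (Suc j) us" h] that us
    by (simp add: btens_bsum[OF m] mtens_in_tensor_power)
  have e3: "btens Om M (Suc n) (bsum (comult H h) (\<lambda>a b. bsum (comult H b) (\<lambda>b1 b2. mtens H (us @ [a * T b2, b1])))) m =
      bsum (comult H h) (\<lambda>a b. bsum (comult H b) (\<lambda>b1 b2. cotens (us @ [a * T b2]) (act M b1 m)))"
    using e[of "us @ [_]"] us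
    by (simp add: btens_bsum[OF m] mtens_in_tensor_power cl)
  have "btens Om M (Suc n) (dif Om (mtens H (us @ [h]))) m =
    (\<Sum>j<n. fscale ((-1) ^ j) (btens Om M (Suc n) (bsum (comult H (us ! j))
      (\<lambda>a b. mtens H (take j us @ a # b # drop (Suc j) us @ [h]))) m))
    - btens Om M (Suc n) (mtens H (1 # us @ [h])) m
    + fscale ((-1) ^ n) (btens Om M (Suc n) (bsum (comult H h) (\<lambda>a b. bsum (comult H b) (\<lambda>b1 b2. mtens H (us @ [a * T b2, b1])))) m)"
  proof -
    \<comment> \<open>The summands of the differential are abstracted, since \<open>btens\<close>
      distributes over them only once they are known to lie in the carrier.\<close>
    have expand: "btens Om M (Suc n) ((\<Sum>j<n. fscale (\<epsilon> j) (D j)) - B + fscale c E) m =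
        (\<Sum>j<n. fscale (\<epsilon> j) (btens Om M (Suc n) (D j) m)) - btens Om M (Suc n) B m + fscale c (btens Om M (Suc n) E m)"
      if D: "\<And>j. j < n \<Longrightarrow> D j \<in> carrier (tensor_power H (Suc (Suc n)))"
        and BE: "B \<in> carrier (tensor_power H (Suc (Suc n)))" "E \<in> carrier (tensor_power H (Suc (Suc n)))"
      for \<epsilon> D B c E
    proof -
      have D': "fscale (\<epsilon> j) (D j) \<in> carrier (tensor_power H (Suc (Suc n)))" if "j < n" for j
        using D[OF that] by (rule free.subspace_scale[OF sub])
      then have S: "(\<Sum>j<n. fscale (\<epsilon> j) (D j)) \<in> carrier (tensor_power H (Suc (Suc n)))"
        by (intro free.subspace_sum[OF sub]) simp
      have "btens Om M (Suc n) (\<Sum>j<n. fscale (\<epsilon> j) (D j)) m = (\<Sum>j<n. fscale (\<epsilon> j) (btens Om M (Suc n) (D j) m))"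
        using D' linD(2)[OF l D] by (subst lin_sum_on[OF l vector_space_fscale sub]) (auto intro!: sum.cong)
      then show ?thesis
        using S BE by (simp add: linD[OF l] lin_diff_on[OF l vector_space_fscale sub] free.subspace_diff[OF sub]
            free.subspace_scale[OF sub])
    qed
    show ?thesis
      unfolding dif_snoc dif_snoc_def us by (rule expand) (use t1 t2 t3 in auto)
  qed
  then show ?thesis
    using e[of "1 # us" h] us by (auto simp: e1 e3 intro!: sum.cong)
qed

end

text \<open>The assumption lets \<open>rho\<close> and \<open>nab\<close> determine each other, so
  the locale serves both directions of the correspondence: one starts from a given connection, the
  other from a given coaction.\<close>

locale hopf_connection = hopf_coaction H T M rho
  for H :: "('k::field, 'h::ring_1) hopf" and T :: "'h \<Rightarrow> 'h" and M :: "('k, 'h, 'm::ab_group_add) lmodule"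
    and rho :: "'m \<Rightarrow> ('h \<times> 'm \<Rightarrow>\<^sub>0 'k)" +
  fixes nab :: "'m \<Rightarrow> (('h list \<Rightarrow>\<^sub>0 'k) \<times> 'm \<Rightarrow>\<^sub>0 'k)"
  assumes nab: "m \<in> carrier M \<Longrightarrow> nab m = of_tensor (rho m) - cotens [1] m"
begin

text \<open>The left action of H on \<Omega>^1 (x)_H M, transported to H (x) M.\<close>

definition adj :: "'h \<Rightarrow> ('h \<times> 'm \<Rightarrow>\<^sub>0 'k) \<Rightarrow> ('h \<times> 'm \<Rightarrow>\<^sub>0 'k)" where
  "adj h u = bsum u (\<lambda>g m0. bsum (comult H h) (\<lambda>a b. bsum (comult H b)
       (\<lambda>b1 b2. tens H M (a * g * T b2) (act M b1 m0))))"

lemma compatible_iff: "compatible H T M rho \<longleftrightarrow> (\<forall>h. \<forall>m\<in>carrier M. rho (act M h m) = adj h (rho m))"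
  by (simp add: compatible_def adj_def)

lemma adj_in: "u \<in> carrier (tensor H M) \<Longrightarrow> adj h u \<in> carrier (tensor H M)"
  unfolding adj_def
  by (auto intro!: bsum_in_subspace subspace_tensor tens_in_tensor dest: keys_tensor[OF vec_space_H vec_space_M])

lemma nab_in: "m \<in> carrier M \<Longrightarrow> nab m \<in> carrier (btensor Om M 1)"
  using free.subspace_diff[OF subspace_btensor, of "of_tensor (rho m)" 1 "cotens [1] m"]
  by (simp add: nab of_tensor_in rho_in cotens_in del: One_nat_def)

lemma nab_lin:
  "m \<in> carrier M \<Longrightarrow> m' \<in> carrier M \<Longrightarrow> nab (m + m') = nab m + nab m'"
  "m \<in> carrier M \<Longrightarrow> nab (scale M c m) = fscale c (nab m)"
  using rho_lin bilinD(2,4)[OF bilin_cotens_single]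
  by (simp_all add: nab lin_def free.scale_right_diff_distrib)

lemma lmult_lin [simp]:
  "lmult Om M n q w (t + t') = lmult Om M n q w t + lmult Om M n q w t'"
  "lmult Om M n q w (t - t') = lmult Om M n q w t - lmult Om M n q w t'"
  "lmult Om M n q w (fscale c t) = fscale c (lmult Om M n q w t)"
  by (simp_all add: lmult_def)

lemma lmult_of_tensor:
  assumes us: "length us = n" and u: "u \<in> carrier (tensor H M)"
  shows "lmult Om M n 1 (mtens H (us @ [h])) (of_tensor u) = bsum (adj h u) (\<lambda>g m. cotens (us @ [g]) m)"
proof -
  have "lmult Om M n 1 (mtens H (us @ [h])) (of_tensor u) =
      bsum u (\<lambda>g m. lmult Om M n 1 (mtens H (us @ [h])) (cotens [g] m))"
    by (simp add: lmult_def of_tensor_def lext_bsum)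
  also have "\<dots> = bsum u (\<lambda>g m. bsum (comult H h) (\<lambda>a b. bsum (comult H b)
      (\<lambda>b1 b2. cotens (us @ [a * g * T b2]) (act M b1 m))))"
    by (intro bsum_cong refl lmult_cotens[OF us] keys_tensor(2)[OF vec_space_H vec_space_M u])
  also have "\<dots> = bsum (adj h u) (\<lambda>g m. cotens (us @ [g]) m)"
    unfolding adj_def bsum_bsum
    by (intro bsum_cong refl bsum_tens[OF bilin_cotens_snoc, symmetric])
      (auto dest: keys_tensor(2)[OF vec_space_H vec_space_M u])
  finally show ?thesis .
qed

text \<open>The negative of the cobar differential of \<open>rho\<close>, as
  \<open>cob_eq_faces\<close> makes precise.\<close>

definition cob :: "'h list \<Rightarrow> 'm \<Rightarrow> (('h list \<Rightarrow>\<^sub>0 'k) \<times> 'm \<Rightarrow>\<^sub>0 'k)" where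
  "cob us m = (\<Sum>j<length us. fscale ((-1) ^ j)
      (bsum (comult H (us ! j)) (\<lambda>a b. cotens (take j us @ a # b # drop (Suc j) us) m)))
    - cotens (1 # us) m + fscale ((-1) ^ length us) (bsum (rho m) (\<lambda>g m0. cotens (us @ [g]) m0))"

definition ext_gen :: "nat \<Rightarrow> ('h list \<Rightarrow>\<^sub>0 'k) \<Rightarrow> 'm \<Rightarrow> (('h list \<Rightarrow>\<^sub>0 'k) \<times> 'm \<Rightarrow>\<^sub>0 'k)" where
  "ext_gen n w m = btens Om M (Suc n) (dif Om w) m + fscale ((-1) ^ n) (lmult Om M n 1 w (nab m))"

lemma connection_ext_eq: "connection_ext Om M nab n t = bsum t (ext_gen n)"
  by (simp add: connection_ext_def bsum_def ext_gen_def[abs_def])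

text \<open>The terms \<open>us \<otimes> h\<^sub>(\<^sub>1\<^sub>) T(h\<^sub>(\<^sub>3\<^sub>)) \<otimes> h\<^sub>(\<^sub>2\<^sub>) m\<close> of the differential and of the product with \<open>nab m\<close> cancel.\<close>

lemma ext_gen_adj:
  assumes us: "length us = n" and m: "m \<in> carrier M"
  shows "ext_gen n (mtens H (us @ [h])) m =
    (\<Sum>j<n. fscale ((-1) ^ j) (bsum (comult H (us ! j)) (\<lambda>a b. cotens (take j us @ a # b # drop (Suc j) us) (act M h m))))
    - cotens (1 # us) (act M h m)
    + fscale ((-1) ^ n) (bsum (adj h (rho m)) (\<lambda>g m0. cotens (us @ [g]) m0))"
proof -
  have "lmult Om M n 1 (mtens H (us @ [h])) (nab m) = bsum (adj h (rho m)) (\<lambda>g m0. cotens (us @ [g]) m0)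
      - bsum (comult H h) (\<lambda>a b. bsum (comult H b) (\<lambda>b1 b2. cotens (us @ [a * T b2]) (act M b1 m)))"
    using lmult_of_tensor[OF us rho_in[OF m]] lmult_cotens[OF us m, of h 1] m
    by (simp add: nab del: One_nat_def)
  then show ?thesis
    using us m by (simp add: ext_gen_def btens_dif free.scale_right_diff_distrib)
qed

text \<open>By the degree 0 case of \<open>ext_gen_adj\<close>, the Leibniz rule compares rho(am) -
  1 (x) am with a rho(m) - 1 (x) am. The shift drops out, and \<open>of_tensor\<close> is
  injective.\<close>

lemma connection_iff: "connection Om M nab \<longleftrightarrow> compatible H T M rho"
proof -
  have "nab (act M a m) = lmult Om M 0 1 (incl Om a) (nab m) + btens Om M 1 (dif Om (incl Om a)) m \<longleftrightarrow>
      rho (act M a m) = adj a (rho m)" if m: "m \<in> carrier M" for a m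
  proof -
    have "lmult Om M 0 1 (incl Om a) (nab m) + btens Om M 1 (dif Om (incl Om a)) m =
        of_tensor (adj a (rho m)) - cotens [1] (act M a m)"
      using ext_gen_adj[of "[]" 0 m a] m by (simp add: ext_gen_def of_tensor_def add.commute)
    moreover have "of_tensor (rho (act M a m)) = of_tensor (adj a (rho m)) \<longleftrightarrow> rho (act M a m) = adj a (rho m)"
    proof
      assume "of_tensor (rho (act M a m)) = of_tensor (adj a (rho m))"
      then have "ident H M (of_tensor (rho (act M a m))) = ident H M (of_tensor (adj a (rho m)))" by simp
      then show "rho (act M a m) = adj a (rho m)"
        using m by (simp add: ident_of_tensor rho_in adj_in)
    qed simp
    ultimately show ?thesis using m by (simp add: nab)
  qed
  then show ?thesis
    using nab_in nab_lin by (auto simp: connection_def compatible_iff linear_on_def)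
qed

context
  assumes comp: "compatible H T M rho"
begin

text \<open>By compatibility rho(hm) replaces h rho(m), so h and m enter only through hm. This is
  the balancedness that lets the extended connection be evaluated on \<open>cotens\<close>.\<close>

lemma ext_gen_cob:
  assumes us: "length us = n" and m: "m \<in> carrier M"
  shows "ext_gen n (mtens H (us @ [h])) m = cob us (act M h m)"
  using ext_gen_adj[OF assms] comp m us by (simp add: cob_def compatible_iff)

lemma bilin_ext_gen: "bilin (tensor_power H (Suc n)) M (ext_gen n)"
proof -
  have "lin (carrier (tensor_power H (Suc n))) fscale (\<lambda>w. lmult Om M n 1 w t)"
    if t: "t \<in> carrier (btensor Om M 1)" for t
    unfolding lmult_def bsum_def[symmetric]
  proof (rule lin_fun_bsum)
    fix e m assume "(e, m) \<in> Poly_Mapping.keys t"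
    note em = keys_btensor[OF t this]
    show "lin (carrier (tensor_power H (Suc n))) fscale (\<lambda>w. btens Om M (n + 1) (prd Om w e) m)"
      using em bilinD[OF bilin_btens] prd_degree_1_in by (simp add: lin_def numeral_2_eq_2)
  qed
  then have "lin (carrier (tensor_power H (Suc n))) fscale (\<lambda>w. ext_gen n w m)" if "m \<in> carrier M" for m
    unfolding ext_gen_def
    by (intro lin_fun_add lin_fun_fscale) (use that nab_in bilinD[OF bilin_btens] dif_in in \<open>simp_all add: lin_def\<close>)
  moreover have "lin (carrier M) (scale M) (ext_gen n w)" if "w \<in> carrier (tensor_power H (Suc n))" for w
    unfolding ext_gen_def[abs_def]
    by (intro lin_fun_add lin_fun_fscale)
      (use that bilinD[OF bilin_btens] dif_in in \<open>simp_all add: lin_def nab_lin\<close>)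
  ultimately show ?thesis by (simp add: bilin_def)
qed

lemma connection_ext_cotens:
  assumes us: "length us = n" and m: "m \<in> carrier M"
  shows "connection_ext Om M nab n (cotens us m) = cob us m"
proof -
  have "bsum (btens Om M n (mtens H (us @ [1])) m) (ext_gen n) = ext_gen n (mtens H (us @ [1])) m"
    by (rule bsum_btens[OF bilin_ext_gen]) (use us m in \<open>simp_all add: ext_gen_cob mtens_in_tensor_power\<close>)
  then show ?thesis using us m by (simp add: connection_ext_eq cotens_def ext_gen_cob)
qed

end

text \<open>
  The extended connection is minus the alternating sum of these cofaces, so its square vanishes by
  the cosimplicial identities; only the identity between the last two cofaces needs \<open>rho\<close> to be
  coassociative.
\<close>

definition face :: "nat \<Rightarrow> 'h list \<Rightarrow> 'm \<Rightarrow> ('h list \<times> 'm \<Rightarrow>\<^sub>0 'k)" where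
  "face i us m = (if i = 0 then gen (1 # us, m)
     else if i \<le> length us then bsum (comult H (us ! (i - 1))) (\<lambda>a b. gen (take (i - 1) us @ a # b # drop i us, m))
     else bsum (rho m) (\<lambda>g m0. gen (us @ [g], m0)))"

lemma face_simps:
  "bsum (face 0 us m) F = F (1 # us) m"
  "i < length us \<Longrightarrow> bsum (face (Suc i) us m) F =
    bsum (comult H (us ! i)) (\<lambda>a b. F (take i us @ a # b # drop (Suc i) us) m)"
  "i = Suc (length us) \<Longrightarrow> bsum (face i us m) F = bsum (rho m) (\<lambda>g m0. F (us @ [g]) m0)"
  by (simp_all add: face_def bsum_bsum)

text \<open>The formula for the extended connection is available on lists of known length and on the
  carrier; a face produces nothing else.\<close>

lemma bsum_face_cong:
  assumes "\<And>vs m0. length vs = Suc (length us) \<Longrightarrow> m0 \<in> carrier M \<Longrightarrow> F vs m0 = F' vs m0" "m \<in> carrier M"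
    "i \<le> Suc (length us)"
  shows "bsum (face i us m) F = bsum (face i us m) F'"
proof -
  consider "i = 0" | k where "i = Suc k" "k < length us" | "i = Suc (length us)"
    using assms(3) by (cases i) (auto simp: le_Suc_eq Suc_le_eq)
  then show ?thesis
    by cases (auto simp: face_simps assms(1,2) keys_rho[OF assms(2)] intro!: bsum_cong)
qed

text \<open>The inserted 1 is face 0 and splitting entry j is face j+1, so the sign (-1)^j of the
  calculus becomes -(-1)^(j+1).\<close>

lemma cob_eq_faces:
  "cob us m = - (\<Sum>i\<le>Suc (length us). fscale ((-1) ^ i) (bsum (face i us m) cotens))"
proof -
  let ?f = "\<lambda>i. fscale ((-1) ^ i) (bsum (face i us m) cotens)"
  have "(\<Sum>i\<le>Suc (length us). ?f i) = ?f 0 + (\<Sum>i<length us. ?f (Suc i)) + ?f (Suc (length us))"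
    by (subst sum.atMost_Suc_shift) (simp flip: lessThan_Suc_atMost)
  then show ?thesis
    by (simp add: cob_def face_simps sum_negf)
qed

text \<open>The relation d_j d_i = d_i d_(j-1) for i < j. Coassociativity is a conditional
  hypothesis because the converse half of \<open>flat_iff\<close> uses the other identities before
  coassociativity is known.\<close>

lemma cosimplicial_identity:
  assumes n: "length us = n" and m: "m \<in> carrier M" and ij: "i < j" "j \<le> Suc (Suc n)"
    and coass: "i = Suc n \<Longrightarrow> coassociative H M rho"
  shows "bsum (face i us m) (\<lambda>vs m'. bsum (face j vs m') cotens) =
    bsum (face (j - 1) us m) (\<lambda>vs m'. bsum (face i vs m') cotens)"
proof -
  have bil: "bilin H H (\<lambda>a b. cotens (p @ a # b # q) m)" for p q
    using mlin_cotens[of "length p + Suc (Suc (length q))"] m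
      multilin_lin_mid[of H p "_ # q" "\<lambda>us. cotens us m"] multilin_lin_mid[of H "p @ [_]" "q" "\<lambda>us. cotens us m"]
    by (auto simp: mlin_def bilin_H_iff)
  have tril: "trilin H H H (\<lambda>a b c. cotens (p @ a # b # c # q) m)" for p q
    using mlin_cotens[of "length p + Suc (Suc (Suc (length q)))"] m
      multilin_lin_mid[of H p "_ # _ # q" "\<lambda>us. cotens us m"]
      multilin_lin_mid[of H "p @ [_]" "_ # q" "\<lambda>us. cotens us m"]
      multilin_lin_mid[of H "p @ [_, _]" "q" "\<lambda>us. cotens us m"]
    by (auto simp: mlin_def trilin_H_iff)
  \<comment> \<open>In order: the coproduct of 1, insertion of 1 against a coproduct and against the
    coaction, one factor split twice, two different factors, a factor against the coaction, and the
    coaction against itself.\<close>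
  consider "i = 0" "j = 1" | k where "i = 0" "j = Suc (Suc k)" "k < n" | "i = 0" "j = Suc (Suc n)"
    | k where "i = Suc k" "j = Suc (Suc k)" "k < n"
    | k l where "i = Suc k" "j = Suc (Suc l)" "k < l" "l < n"
    | k where "i = Suc k" "j = Suc (Suc n)" "k < n"
    | "i = Suc n" "j = Suc (Suc n)"
  proof -
    obtain j' where j': "j = Suc j'" using ij(1) by (cases j) auto
    show thesis
    proof (cases i)
      case 0
      show thesis
      proof (cases j')
        case 0
        then show thesis using that(1) \<open>i = 0\<close> j' by simp
      next
        case (Suc k)
        then show thesis using that(2)[of k] that(3) \<open>i = 0\<close> j' ij(2) by (cases "k < n") auto
      qed
    next
      case (Suc k)
      then obtain l where l: "j' = Suc l" "k \<le> l" using ij(1) j' by (cases j') auto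
      then consider "l = n" "k = n" | "l = n" "k < n" | "l < n" "k = l" | "l < n" "k < l"
        using ij(2) j' by fastforce
      then show thesis
        by cases (use Suc l j' that(4)[of k] that(5)[of k l] that(6)[of k] that(7) in auto)
    qed
  qed
  then show ?thesis
  proof cases
    case 1
    then show ?thesis using bsum_comult_one[OF bil[of "[]" us]] by (simp add: face_simps)
  next
    case 2
    then show ?thesis using n by (simp add: face_simps)
  next
    case 3
    then show ?thesis using n by (simp add: face_simps)
  next
    case (4 k)
    then obtain p x q where us: "us = p @ x # q" "length p = k"
      using n id_take_nth_drop[of k us] by (metis length_take min.absorb4)
    have "bsum (comult H x) (\<lambda>a b. bsum (comult H b) (\<lambda>b1 b2. cotens (p @ a # b1 # b2 # q) m)) =
        bsum (comult H x) (\<lambda>a b. bsum (comult H a) (\<lambda>a1 a2. cotens (p @ a1 # a2 # b # q) m))"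
      by (rule bsum_coassoc[symmetric]) (rule tril)
    then show ?thesis using 4 us by (simp add: face_simps nth_append)
  next
    case (5 k l)
    then obtain p x r where us: "us = p @ x # r" "length p = k"
      using n id_take_nth_drop[of k us] by (metis length_take min.absorb4 order.strict_trans)
    have "l - Suc k < length r" using 5 us n by simp
    then obtain q y s where r: "r = q @ y # s" "length q = l - Suc k"
      using id_take_nth_drop[of "l - Suc k" r] by (metis length_take min.absorb4)
    then have l: "l = Suc (k + length q)" using 5 by simp
    have "bsum (comult H x) (\<lambda>a b. bsum (comult H y) (\<lambda>c d. cotens (p @ a # b # q @ c # d # s) m)) =
       bsum (comult H y) (\<lambda>c d. bsum (comult H x) (\<lambda>a b. cotens (p @ a # b # q @ c # d # s) m))"
      by (rule bsum_swap)
    then show ?thesis using 5(1,2) us r(1) by (simp add: face_simps nth_append l numeral_3_eq_3)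
  next
    case (6 k)
    then obtain p x q where us: "us = p @ x # q" "length p = k"
      using n id_take_nth_drop[of k us] by (metis length_take min.absorb4)
    have "bsum (comult H x) (\<lambda>a b. bsum (rho m) (\<lambda>g m0. cotens (p @ a # b # q @ [g]) m0)) =
       bsum (rho m) (\<lambda>g m0. bsum (comult H x) (\<lambda>a b. cotens (p @ a # b # q @ [g]) m0))"
      by (rule bsum_swap)
    then show ?thesis using 6 us n by (simp add: face_simps nth_append)
  next
    case 7
    have tril': "trilin H H M (\<lambda>a b m. cotens (us @ [a, b]) m)"
      using mlin_cotens[of "Suc (Suc n)"] n
        multilin_lin_mid[of H us "[_]" "\<lambda>us. cotens us m" for m]
        multilin_lin_mid[of H "us @ [_]" "[]" "\<lambda>us. cotens us m" for m]
      by (auto simp: mlin_def trilin_def bilin_H_iff bilin_def)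
    from bsum_coassociative[OF coass[OF 7(1)] this m] show ?thesis
      using 7 n by (simp add: face_simps nth_append)
  qed
qed

context
  assumes comp: "compatible H T M rho"
begin

text \<open>Faces turn \<open>cotens\<close> elements into sums of such elements, so the same
  formula applies a second time; the two minus signs of \<open>cob_eq_faces\<close> cancel.\<close>

lemma connection_ext_twice:
  assumes n: "length us = n" and m: "m \<in> carrier M"
  shows "connection_ext Om M nab (n + 1) (connection_ext Om M nab n (cotens us m)) =
    (\<Sum>i\<le>Suc n. \<Sum>j\<le>Suc (Suc n). fscale ((-1) ^ (i + j))
       (bsum (face i us m) (\<lambda>vs m'. bsum (face j vs m') cotens)))"
proof -
  have ext_lin: "connection_ext Om M nab k (- (\<Sum>i\<in>I. fscale (e i) (bsum (t i) F))) =
      - (\<Sum>i\<in>I. fscale (e i) (bsum (t i) (\<lambda>a b. connection_ext Om M nab k (F a b))))"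
    for k I e and t :: "nat \<Rightarrow> ('h list \<times> 'm \<Rightarrow>\<^sub>0 'k)" and F
    by (simp add: connection_ext_def lext_sum lext_bsum)
  have "connection_ext Om M nab (n + 1) (connection_ext Om M nab n (cotens us m)) =
      - (\<Sum>i\<le>Suc n. fscale ((-1) ^ i) (bsum (face i us m) (\<lambda>vs m'. connection_ext Om M nab (Suc n) (cotens vs m'))))"
    unfolding connection_ext_cotens[OF comp n m] cob_eq_faces n ext_lin by simp
  also have "\<dots> = - (\<Sum>i\<le>Suc n. fscale ((-1) ^ i) (bsum (face i us m)
      (\<lambda>vs m'. - (\<Sum>j\<le>Suc (Suc n). fscale ((-1) ^ j) (bsum (face j vs m') cotens)))))"
    using n m comp
    by (intro arg_cong[of _ _ uminus] sum.cong refl arg_cong[of _ _ "fscale _"] bsum_face_cong)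
      (auto simp: connection_ext_cotens cob_eq_faces simp del: sum.atMost_Suc)
  also have "\<dots> = (\<Sum>i\<le>Suc n. \<Sum>j\<le>Suc (Suc n). fscale ((-1) ^ (i + j))
       (bsum (face i us m) (\<lambda>vs m'. bsum (face j vs m') cotens)))"
    by (simp add: bsum_def case_prod_unfold lext_fun_minus lext_fun_sum lext_fun_fscale sum_negf
        free.scale_sum_right power_add del: sum.atMost_Suc)
  finally show ?thesis .
qed

lemma flat_iff: "flat Om M nab \<longleftrightarrow> coassociative H M rho"
proof
  assume co: "coassociative H M rho"
  show "flat Om M nab"
    unfolding flat_def
  proof (intro allI ballI)
    fix n t assume t: "t \<in> carrier (btensor Om M n)"
    show "connection_ext Om M nab (n + 1) (connection_ext Om M nab n t) = 0"
    proof (rule lin_btensor_eqI[OF t, of _ "\<lambda>_. 0"])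
      fix us :: "'h list" and m assume "length us = n" "m \<in> carrier M"
      then show "connection_ext Om M nab (n + 1) (connection_ext Om M nab n (cotens us m)) = 0"
        unfolding connection_ext_twice[OF \<open>length us = n\<close> \<open>m \<in> carrier M\<close>]
        by (intro cosimplicial_cancel cosimplicial_identity) (use co in auto)
    qed (simp_all add: lin_def connection_ext_eq)
  qed
next
  assume fl: "flat Om M nab"
  show "coassociative H M rho"
    unfolding coassociative_def
  proof
    fix m assume m: "m \<in> carrier M"
    let ?A = "\<lambda>i j. bsum (face i [] m) (\<lambda>vs m'. bsum (face j vs m') cotens)"
    \<comment> \<open>Flatness in degree 0 gives six terms with alternating signs. Two cosimplicial
      identities remove four of them, and equality of the remaining two is coassociativity.\<close>
    have "(\<Sum>i\<le>Suc 0. \<Sum>j\<le>Suc (Suc 0). fscale ((-1) ^ (i + j)) (?A i j)) = 0"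
      using fl m cotens_in[of "[]" 0 m] unfolding flat_def
      by (subst connection_ext_twice[of "[]", symmetric]) auto
    moreover have "?A 0 1 = ?A 0 0" "?A 0 2 = ?A 1 0"
      using cosimplicial_identity[of "[]" 0 m 0 1] cosimplicial_identity[of "[]" 0 m 0 2] m by auto
    ultimately have "?A 1 1 = ?A 1 2"
      by (simp add: numeral_2_eq_2)
    then have A: "bsum (rho m) (\<lambda>g m0. bsum (comult H g) (\<lambda>a b. cotens [a, b] m0)) =
        bsum (rho m) (\<lambda>g m0. bsum (rho m0) (\<lambda>g' m1. cotens [g, g'] m1))"
      by (simp add: face_simps)
    \<comment> \<open>The equation \<open>A\<close> lives in \<Omega>^2 (x)_H M;
      \<open>ev ?G\<close> carries it to H (x) (H (x) M).\<close>
    let ?G = "\<lambda>us m. tens H (tensor H M) (us ! 0) (tens H M (us ! 1) m)"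
    have "mlin (Suc (Suc 0)) ?G"
      using tens_lin[where V = H and W = "tensor H M"]
      by (auto simp: mlin_def lin_def tens_in_tensor intro!: multilin_2I)
    note ev = ev_cotens[OF this]
    have "bsum (rho m) (\<lambda>g m0. bsum (comult H g) (\<lambda>a b. ev ?G (cotens [a, b] m0))) =
        bsum (rho m) (\<lambda>g m0. bsum (rho m0) (\<lambda>g' m1. ev ?G (cotens [g, g'] m1)))"
      using arg_cong[OF A, of "ev ?G"] unfolding ev_def bsum_bsum .
    also have "bsum (rho m) (\<lambda>g m0. bsum (comult H g) (\<lambda>a b. ev ?G (cotens [a, b] m0))) =
        bsum (rho m) (\<lambda>g m0. bsum (comult H g) (\<lambda>a b. ?G [a, b] m0))"
      by (intro bsum_cong refl ev) (simp, metis keys_rho m)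
    also have "bsum (rho m) (\<lambda>g m0. bsum (rho m0) (\<lambda>g' m1. ev ?G (cotens [g, g'] m1))) =
        bsum (rho m) (\<lambda>g m0. bsum (rho m0) (\<lambda>g' m1. ?G [g, g'] m1))"
      by (intro bsum_cong refl ev) (simp, metis keys_rho m)
    finally show "bsum (rho m) (\<lambda>g m0. bsum (comult H g) (\<lambda>a b. tens H (tensor H M) a (tens H M b m0))) =
        bsum (rho m) (\<lambda>g m0. bsum (rho m0) (\<lambda>g' m1. tens H (tensor H M) g (tens H M g' m1)))"
      by simp
  qed
qed

end

end

text \<open>For \<open>T = S\<close> these are the Yetter-Drinfeld modules and for \<open>T = S\<^sup>-\<^sup>1\<close> the anti-Yetter-Drinfeld
  modules, except that the coaction need not be counital.\<close>

definition yd_coaction :: "('k::field, 'h::ring_1) hopf \<Rightarrow> ('h \<Rightarrow> 'h) \<Rightarrow> ('k, 'h, 'm::ab_group_add) lmodule \<Rightarrow>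
    ('m \<Rightarrow> ('h \<times> 'm \<Rightarrow>\<^sub>0 'k)) \<Rightarrow> bool" where
  "yd_coaction H T M rho \<longleftrightarrow> (\<forall>m\<in>carrier M. rho m \<in> carrier (tensor H M)) \<and> lin (carrier M) (scale M) rho \<and>
     compatible H T M rho \<and> coassociative H M rho"

text \<open>The connection lives in \<Omega>^1 (x)_H M and \<open>nabla\<close> in H (x) M;
  \<open>ident\<close> and \<open>of_tensor\<close> pass between them. Compatibility is obtained
  before coassociativity, since \<open>flat_iff\<close> relies on it.\<close>

lemma (in hopf_module) flat_connection_iff:
  "flat_connection H Om M nabla \<longleftrightarrow> yd_coaction H T M (\<lambda>m. nabla m + tens H M 1 m)"
proof
  assume "flat_connection H Om M nabla"
  then obtain nab where conn: "connection Om M nab" "flat Om M nab" "\<And>m. m \<in> carrier M \<Longrightarrow> nabla m = ident H M (nab m)"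
    by (auto simp: flat_connection_def)
  have in1: "nab m \<in> carrier (btensor Om M 1)" if "m \<in> carrier M" for m
    using conn(1) that by (simp add: connection_def linear_on_def)
  have lin_nab: "nab (m + m') = nab m + nab m'" "nab (scale M c m) = fscale c (nab m)"
    if "m \<in> carrier M" "m' \<in> carrier M" for m m' c
    using conn(1) that by (simp_all add: connection_def linear_on_def)
  let ?rho = "\<lambda>m. nabla m + tens H M 1 m"
  interpret hopf_connection H T M ?rho nab
  proof
    show "?rho m \<in> carrier (tensor H M)" if "m \<in> carrier M" for m
      unfolding conn(3)[OF that]
      by (intro free.subspace_add[OF subspace_tensor] ident_in in1 tens_in_tensor that) simp
    show "lin (carrier M) (scale M) ?rho"
      using lin_nab by (simp add: lin_def conn(3) ident_def bsum_def[symmetric] free.scale_right_distrib)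
    show "nab m = of_tensor (?rho m) - cotens [1] m" if "m \<in> carrier M" for m
      using that in1 by (simp add: conn(3) of_tensor_ident of_tensor_tens del: One_nat_def)
  qed
  from connection_iff conn(1) have comp: "compatible H T M ?rho" by simp
  with flat_iff conn(2) have "coassociative H M ?rho" by simp
  then show "yd_coaction H T M ?rho"
    using comp rho_in rho_lin by (simp add: yd_coaction_def)
next
  let ?rho = "\<lambda>m. nabla m + tens H M 1 m"
  assume yd: "yd_coaction H T M ?rho"
  let ?nab = "\<lambda>m. of_tensor (nabla m)"
  interpret hopf_connection H T M ?rho ?nab
    by unfold_locales (use yd in \<open>auto simp: yd_coaction_def of_tensor_tens\<close>)
  have "connection Om M ?nab" "flat Om M ?nab"
    using connection_iff flat_iff yd by (simp_all add: yd_coaction_def)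
  \<comment> \<open>\<open>nabla m\<close> lies in H (x) M as the difference of
    \<open>?rho m\<close> and 1 (x) m.\<close>
  moreover have "nabla m = ident H M (?nab m)" if "m \<in> carrier M" for m
    using free.subspace_diff[OF subspace_tensor rho_in[OF that] tens_in_tensor[of 1 H m M]] that
    by (simp add: ident_of_tensor)
  ultimately show "flat_connection H Om M nabla"
    by (auto simp: flat_connection_def)
qed

text \<open>Coassociativity also evaluates the coaction at the components m_(0) of a formal sum;
  \<open>keys_rho\<close> places these in the carrier, so agreement there is enough.\<close>

lemma (in hopf_module) yd_coaction_cong:
  assumes eq: "\<And>m. m \<in> carrier M \<Longrightarrow> rho m = rho' m"
  shows "yd_coaction H T M rho \<longleftrightarrow> yd_coaction H T M rho'"
proof -
  have "yd_coaction H T M rho'"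
    if yd: "yd_coaction H T M rho" and eq: "\<And>m. m \<in> carrier M \<Longrightarrow> rho m = rho' m" for rho rho'
  proof -
    interpret hopf_coaction H T M rho
      by unfold_locales (use yd in \<open>auto simp: yd_coaction_def\<close>)
    let ?F = "\<lambda>g g' m1. tens H (tensor H M) g (tens H M g' m1)"
    have "bsum (rho m) (\<lambda>g m0. bsum (rho' m0) (?F g)) = bsum (rho m) (\<lambda>g m0. bsum (rho m0) (?F g))"
      if "m \<in> carrier M" for m
      by (rule bsum_cong) (auto simp: eq dest: keys_rho[OF that])
    with yd show ?thesis
      by (simp add: yd_coaction_def lin_def compatible_def coassociative_def eq[symmetric])
  qed
  from this[of rho rho'] this[of rho' rho] eq show ?thesis by auto
qed

section \<open>The product coaction\<close>

locale yd_pair = hopf_algebra H + X: hopf_coaction H "antipode H" X rX + Y: hopf_coaction H T Y rY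
  for H :: "('k::field, 'h::ring_1) hopf" and T :: "'h \<Rightarrow> 'h"
    and X :: "('k, 'h, 'x::ab_group_add) lmodule" and Y :: "('k, 'h, 'y::ab_group_add) lmodule"
    and rX :: "'x \<Rightarrow> ('h \<times> 'x \<Rightarrow>\<^sub>0 'k)" and rY :: "'y \<Rightarrow> ('h \<times> 'y \<Rightarrow>\<^sub>0 'k)" +
  assumes ydX: "compatible H (antipode H) X rX" "coassociative H X rX"
    and ydY: "compatible H T Y rY" "coassociative H Y rY"
begin

section \<open>The diagonal action on the tensor product\<close>

abbreviation "P \<equiv> tensor_module H X Y"

lemma carrier_P: "carrier P = carrier (tensor X Y)" and scale_P [simp]: "scale P = fscale"
  by (simp_all add: tensor_module_def)

text \<open>The formula for the connection refers to the vector space \<open>tensor X Y\<close>, the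
  calculus to the module \<open>P\<close>; equal carriers and scalings give equal relations.\<close>

lemma tens_P: "tens H (tensor X Y) = tens H P"
  by (simp add: tens_def[abs_def] bilin_rel_def carrier_P)

lemmas tens_XY_lin [simp] = tens_lin[where V = X and W = Y]

lemma tens_XY_in [simp]: "x \<in> carrier X \<Longrightarrow> y \<in> carrier Y \<Longrightarrow> tens X Y x y \<in> carrier P"
  by (simp add: carrier_P tens_in_tensor)

lemmas P_eqI = lin_tensor_eqI[OF X.vec_space_M Y.vec_space_M, folded carrier_P]

lemmas keys_P = keys_tensor[OF X.vec_space_M Y.vec_space_M, folded carrier_P]

lemma act_P: "act P h t = bsum t (\<lambda>x y. bsum (comult H h) (\<lambda>a b. tens X Y (act X a x) (act Y b y)))"
  by (simp add: tensor_module_def bsum_def)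

lemma act_P_tens:
  assumes "x \<in> carrier X" "y \<in> carrier Y"
  shows "act P h (tens X Y x y) = bsum (comult H h) (\<lambda>a b. tens X Y (act X a x) (act Y b y))"
  unfolding act_P
  by (rule bsum_tens) (use assms in \<open>auto simp: bilin_def lin_def bsum_fun\<close>)

lemma act_P_in: "t \<in> carrier P \<Longrightarrow> act P h t \<in> carrier P"
  unfolding act_P
  by (intro bsum_in_subspace subspace_tensor[of X Y, folded carrier_P] tens_XY_in X.act_simps(1) Y.act_simps(1))
    (blast intro: keys_P)+

lemma act_P_lin [simp]: "act P h (t + u) = act P h t + act P h u" "act P h (fscale c t) = fscale c (act P h t)"
  by (simp_all add: act_P)

lemma act_P_bsum: "act P h (bsum t F) = bsum t (\<lambda>a b. act P h (F a b))"
  by (simp add: act_P bsum_bsum)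

text \<open>Associativity of the diagonal action is multiplicativity of the coproduct, and the unit
  law is the coproduct of 1.\<close>

lemma left_module_P: "left_module H P"
proof -
  have "act P (a + b) t = act P a t + act P b t" for a b t
    by (simp add: act_P bsum_fun)
  moreover have "act P (scale H c a) t = fscale c (act P a t)" for c a t
    by (simp add: act_P bsum_fun)
  moreover have "act P 1 t = t" if "t \<in> carrier P" for t
  proof (rule P_eqI[OF that])
    fix x y assume "x \<in> carrier X" "y \<in> carrier Y"
    then show "act P 1 (tens X Y x y) = tens X Y x y"
      by (simp add: act_P_tens) (subst bsum_comult_one; simp add: bilin_H_iff lin_UNIV_iff)
  qed (simp_all add: lin_def)
  moreover have "act P (a * b) t = act P a (act P b t)" if "t \<in> carrier P" for a b t
  proof (rule P_eqI[OF that])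
    fix x y assume xy: "x \<in> carrier X" "y \<in> carrier Y"
    then have "act P (a * b) (tens X Y x y) =
        bsum (comult H a) (\<lambda>a1 a2. bsum (comult H b) (\<lambda>b1 b2. tens X Y (act X (a1 * b1) x) (act Y (a2 * b2) y)))"
      by (simp only: act_P_tens) (rule bsum_comult_mult, simp add: bilin_H_iff lin_UNIV_iff)
    also have "\<dots> = act P a (act P b (tens X Y x y))"
      using xy by (simp add: act_P_tens act_P_bsum) (rule bsum_swap)
    finally show "act P (a * b) (tens X Y x y) = act P a (act P b (tens X Y x y))" .
  qed (simp_all add: lin_def)
  moreover have "vec_space P"
    by (simp add: vec_space_def carrier_P subspace_tensor vector_space_fscale)
  ultimately show ?thesis
    by (simp add: left_module_def act_P_in)
qed

sublocale P: hopf_module H T P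
  by unfold_locales (rule left_module_P)

lemma tens_P_fscale [simp]: "t \<in> carrier P \<Longrightarrow> tens H P k (fscale c t) = fscale c (tens H P k t)"
  using P.tens_HM_lin(4)[of t k c] by simp

section \<open>The diagonal coaction, its compatibility and its coassociativity\<close>

definition W :: "'h \<Rightarrow> 'x \<Rightarrow> 'y \<Rightarrow> ('h \<times> ('x \<times> 'y \<Rightarrow>\<^sub>0 'k) \<Rightarrow>\<^sub>0 'k)" where
  "W k x y = tens H P k (tens X Y x y)"

definition rP :: "('x \<times> 'y \<Rightarrow>\<^sub>0 'k) \<Rightarrow> ('h \<times> ('x \<times> 'y \<Rightarrow>\<^sub>0 'k) \<Rightarrow>\<^sub>0 'k)" where
  "rP t = bsum t (\<lambda>x y. bsum (rX x) (\<lambda>g x0. bsum (rY y) (\<lambda>g' y0. W (g * g') x0 y0)))"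

lemma W_lin [simp]:
  "x \<in> carrier X \<Longrightarrow> y \<in> carrier Y \<Longrightarrow> W (k + k') x y = W k x y + W k' x y"
  "x \<in> carrier X \<Longrightarrow> y \<in> carrier Y \<Longrightarrow> W (scale H c k) x y = fscale c (W k x y)"
  "x \<in> carrier X \<Longrightarrow> x' \<in> carrier X \<Longrightarrow> y \<in> carrier Y \<Longrightarrow> W k (x + x') y = W k x y + W k x' y"
  "x \<in> carrier X \<Longrightarrow> y \<in> carrier Y \<Longrightarrow> W k (scale X c x) y = fscale c (W k x y)"
  "x \<in> carrier X \<Longrightarrow> y \<in> carrier Y \<Longrightarrow> y' \<in> carrier Y \<Longrightarrow> W k x (y + y') = W k x y + W k x y'"
  "x \<in> carrier X \<Longrightarrow> y \<in> carrier Y \<Longrightarrow> W k x (scale Y c y) = fscale c (W k x y)"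
  by (simp_all add: W_def)

lemma rP_lin [simp]: "rP (t + u) = rP t + rP u" "rP (fscale c t) = fscale c (rP t)"
  by (simp_all add: rP_def)

lemma rP_bsum: "rP (bsum t F) = bsum t (\<lambda>a b. rP (F a b))"
  by (simp add: rP_def bsum_bsum)

lemma rP_tens:
  assumes "x \<in> carrier X" "y \<in> carrier Y"
  shows "rP (tens X Y x y) = bsum (rX x) (\<lambda>g x0. bsum (rY y) (\<lambda>g' y0. W (g * g') x0 y0))"
  unfolding rP_def
  by (rule bsum_tens) (use assms in \<open>auto simp: bilin_def lin_def bsum_fun\<close>)

lemma rP_in: "t \<in> carrier P \<Longrightarrow> rP t \<in> carrier (tensor H P)"
  unfolding rP_def W_def
proof (intro bsum_in_subspace subspace_tensor tens_in_tensor tens_XY_in)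
  fix x y g x0 g' y0
  assume t: "t \<in> carrier P" "(x, y) \<in> Poly_Mapping.keys t"
    and k: "(g, x0) \<in> Poly_Mapping.keys (rX x)" "(g', y0) \<in> Poly_Mapping.keys (rY y)"
  show "x0 \<in> carrier X" "y0 \<in> carrier Y"
    using X.keys_rho[OF keys_P(1)[OF t] k(1)] Y.keys_rho[OF keys_P(2)[OF t] k(2)] .
qed simp

sublocale P: hopf_coaction H T P rP
  by unfold_locales (simp_all add: rP_in lin_def)

lemma bsum_rP:
  assumes F: "bilin H P F" and xy: "x \<in> carrier X" "y \<in> carrier Y"
  shows "bsum (rP (tens X Y x y)) F =
    bsum (rX x) (\<lambda>g x0. bsum (rY y) (\<lambda>g' y0. F (g * g') (tens X Y x0 y0)))"
  unfolding rP_tens[OF xy] bsum_bsum W_def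
  by (intro bsum_cong refl bsum_tens[OF F]) (auto intro!: tens_XY_in dest: X.keys_rho[OF xy(1)] Y.keys_rho[OF xy(2)])

lemma compatible_P: "compatible H T P rP"
  unfolding compatible_def
proof (intro allI ballI)
  fix h t assume t: "t \<in> carrier P"
  let ?F = "\<lambda>k t0. bsum (comult H h) (\<lambda>a b. bsum (comult H b) (\<lambda>b1 b2. tens H P (a * k * T b2) (act P b1 t0)))"
  have F: "bilin H P ?F"
    by (auto simp: bilin_def intro!: lin_fun_bsum) (auto simp: lin_def distrib_left distrib_right)
  show "rP (act P h t) = bsum (rP t) ?F"
  proof (rule P_eqI[OF t])
    fix x y assume x: "x \<in> carrier X" and y: "y \<in> carrier Y"
    note kX = X.keys_rho[OF x] and kY = Y.keys_rho[OF y]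
    have "rP (act P h (tens X Y x y)) =
        bsum (comult H h) (\<lambda>p q. bsum (rX (act X p x)) (\<lambda>g x0. bsum (rY (act Y q y)) (\<lambda>g' y0. W (g * g') x0 y0)))"
      using x y by (simp add: act_P_tens rP_bsum rP_tens)
    also have "\<dots> = bsum (comult H h) (\<lambda>p q. bsum (rX (act X p x)) (\<lambda>g x0. bsum (rY y) (\<lambda>g' y0.
        bsum (comult H q) (\<lambda>q1 q'. bsum (comult H q') (\<lambda>q2 q3. W (g * (q1 * g' * T q3)) x0 (act Y q2 y0))))))"
      by (intro bsum_cong refl Y.bsum_compatible[OF ydY(1) _ y])
        (auto simp: bilin_def lin_def distrib_left dest!: X.keys_rho[OF X.act_simps(1)[OF x]])
    also have "\<dots> = bsum (comult H h) (\<lambda>p q. bsum (rX x) (\<lambda>g x0.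
        bsum (comult H p) (\<lambda>p1 p'. bsum (comult H p') (\<lambda>p2 p3. bsum (rY y) (\<lambda>g' y0.
        bsum (comult H q) (\<lambda>q1 q'. bsum (comult H q') (\<lambda>q2 q3.
          W (p1 * g * antipode H p3 * (q1 * g' * T q3)) (act X p2 x0) (act Y q2 y0))))))))"
    proof -
      have bil: "bilin H X (\<lambda>g x0. bsum (rY y) (\<lambda>g' y0. bsum (comult H q) (\<lambda>q1 q'. bsum (comult H q')
          (\<lambda>q2 q3. W (g * (q1 * g' * T q3)) x0 (act Y q2 y0)))))" for q
        using kY by (auto simp: bilin_def intro!: lin_fun_bsum) (auto simp: lin_def distrib_right)
      show ?thesis
        by (intro bsum_cong refl X.bsum_compatible[OF ydX(1) bil x])
    qed
    \<comment> \<open>The sums over the two coactions move outward and the product is reassociated,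
      which puts S(p_3) next to q_1.\<close>
    also have "\<dots> = bsum (rX x) (\<lambda>g x0. bsum (rY y) (\<lambda>g' y0.
        bsum (comult H h) (\<lambda>p q. bsum (comult H p) (\<lambda>p1 p'. bsum (comult H p') (\<lambda>p2 p3.
        bsum (comult H q) (\<lambda>q1 q'. bsum (comult H q') (\<lambda>q2 q3.
          W (p1 * g * (antipode H p3 * q1) * g' * T q3) (act X p2 x0) (act Y q2 y0))))))))"
      by (simp only: bsum_swap[of _ "rX x"] bsum_swap[of "comult H _" "rY y"] mult.assoc)
    also have "\<dots> = bsum (rX x) (\<lambda>g x0. bsum (rY y) (\<lambda>g' y0.
        bsum (comult H h) (\<lambda>h1 h'. bsum (comult H h') (\<lambda>h2 h''. bsum (comult H h'') (\<lambda>h3 h4.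
          W (h1 * g * 1 * g' * T h4) (act X h2 x0) (act Y h3 y0))))))"
      by (intro bsum_cong refl bsum_antipode_cancel; drule kX; drule kY)
        (simp_all add: lin_UNIV_iff distrib_left distrib_right)
    \<comment> \<open>Coassociativity makes h_2 and h_3 the legs of a single coproduct, as in the
      diagonal action of \<open>P\<close>.\<close>
    also have "\<dots> = bsum (rX x) (\<lambda>g x0. bsum (rY y) (\<lambda>g' y0.
        bsum (comult H h) (\<lambda>h1 h'. bsum (comult H h') (\<lambda>b1 h4. bsum (comult H b1) (\<lambda>h2 h3.
          W (h1 * g * 1 * g' * T h4) (act X h2 x0) (act Y h3 y0))))))"
      by (intro bsum_cong refl bsum_coassoc[symmetric]; drule kX; drule kY)
        (simp_all add: trilin_H_iff lin_UNIV_iff distrib_left)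
    also have "\<dots> = bsum (rX x) (\<lambda>g x0. bsum (rY y) (\<lambda>g' y0. ?F (g * g') (tens X Y x0 y0)))"
    proof (intro bsum_cong refl)
      fix g x0 g' y0 h1 h' b1 h4 assume "(g, x0) \<in> Poly_Mapping.keys (rX x)" "(g', y0) \<in> Poly_Mapping.keys (rY y)"
      then have x0: "x0 \<in> carrier X" and y0: "y0 \<in> carrier Y" by (auto dest: kX kY)
      have "tens H P k (bsum (comult H b1) (\<lambda>a b. tens X Y (act X a x0) (act Y b y0))) =
          bsum (comult H b1) (\<lambda>a b. W k (act X a x0) (act Y b y0))" for k
      proof -
        have "lin (carrier P) fscale (tens H P k)" by (simp add: lin_def)
        from lin_lin_ext[OF this vector_space_fscale, of "comult H b1" "\<lambda>(a, b). tens X Y (act X a x0) (act Y b y0)"]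
        show ?thesis
          using x0 y0 by (simp add: bsum_def case_prod_unfold W_def carrier_P subspace_tensor tens_in_tensor)
      qed
      then show "bsum (comult H b1) (\<lambda>h2 h3. W (h1 * g * 1 * g' * T h4) (act X h2 x0) (act Y h3 y0)) =
          tens H P (h1 * (g * g') * T h4) (act P b1 (tens X Y x0 y0))"
        using x0 y0 by (simp add: act_P_tens mult.assoc)
    qed
    also have "\<dots> = bsum (rP (tens X Y x y)) ?F"
      by (rule bsum_rP[OF F x y, symmetric])
    finally show "rP (act P h (tens X Y x y)) = bsum (rP (tens X Y x y)) ?F" .
  qed (simp_all add: lin_def)
qed

lemma coassociative_P: "coassociative H P rP"
  unfolding coassociative_def
proof
  fix t assume t: "t \<in> carrier P"
  let ?V = "\<lambda>a b t0. tens H (tensor H P) a (tens H P b t0)"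
  note V_lin [simp] = tens_lin[where V = H and W = "tensor H P", simplified]
  have V_in [simp]: "t0 \<in> carrier P \<Longrightarrow> tens H P b t0 \<in> carrier (tensor H P)" for b t0
    by (simp add: tens_in_tensor)
  show "bsum (rP t) (\<lambda>g t0. bsum (comult H g) (\<lambda>a b. ?V a b t0)) = bsum (rP t) (\<lambda>g t0. bsum (rP t0) (?V g))"
  proof (rule P_eqI[OF t])
    fix x y assume x: "x \<in> carrier X" and y: "y \<in> carrier Y"
    note kX = X.keys_rho[OF x] and kY = Y.keys_rho[OF y]
    have "bsum (rP (tens X Y x y)) (\<lambda>g t0. bsum (comult H g) (\<lambda>a b. ?V a b t0)) =
        bsum (rX x) (\<lambda>g x0. bsum (rY y) (\<lambda>g' y0. bsum (comult H (g * g')) (\<lambda>a b. ?V a b (tens X Y x0 y0))))"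
      by (rule bsum_rP[OF _ x y]) (auto simp: bilin_def intro!: lin_fun_bsum, auto simp: lin_def)
    also have "\<dots> = bsum (rX x) (\<lambda>g x0. bsum (rY y) (\<lambda>g' y0. bsum (comult H g) (\<lambda>a b. bsum (comult H g')
        (\<lambda>c e. ?V (a * c) (b * e) (tens X Y x0 y0)))))"
      by (intro bsum_cong refl bsum_comult_mult; drule kX; drule kY) (simp add: bilin_H_iff lin_UNIV_iff)
    \<comment> \<open>The two inner sums are independent; exchanging them puts the coproduct of g
      directly under the coaction of x, as coassociativity of \<open>rX\<close> requires.\<close>
    also have "\<dots> = bsum (rX x) (\<lambda>g x0. bsum (comult H g) (\<lambda>a b. bsum (rY y) (\<lambda>g' y0. bsum (comult H g')
        (\<lambda>c e. ?V (a * c) (b * e) (tens X Y x0 y0)))))"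
      by (intro bsum_cong refl bsum_swap)
    also have "\<dots> = bsum (rX x) (\<lambda>g x0. bsum (rX x0) (\<lambda>h x1. bsum (rY y) (\<lambda>g' y0. bsum (comult H g')
        (\<lambda>c e. ?V (g * c) (h * e) (tens X Y x1 y0)))))"
    proof (rule X.bsum_coassociative[OF ydX(2) _ x])
      show "trilin H H X (\<lambda>a b x0. bsum (rY y) (\<lambda>g' y0. bsum (comult H g')
          (\<lambda>c e. ?V (a * c) (b * e) (tens X Y x0 y0))))"
        using kY by (auto simp: trilin_def bilin_def intro!: lin_fun_bsum) (auto simp: lin_def distrib_right)
    qed
    \<comment> \<open>With g, h and x1 fixed, the same argument applies to the coaction of
      y.\<close>
    also have "\<dots> = bsum (rX x) (\<lambda>g x0. bsum (rX x0) (\<lambda>h x1. bsum (rY y) (\<lambda>g' y0. bsum (rY y0)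
        (\<lambda>h' y1. ?V (g * g') (h * h') (tens X Y x1 y1)))))"
    proof (rule bsum_cong[OF refl], rule bsum_cong[OF refl])
      fix g x0 h x1 assume k: "(g, x0) \<in> Poly_Mapping.keys (rX x)" "(h, x1) \<in> Poly_Mapping.keys (rX x0)"
      from X.keys_rho[OF kX[OF k(1)] k(2)] have "trilin H H Y (\<lambda>c e y0. ?V (g * c) (h * e) (tens X Y x1 y0))"
        by (auto simp: trilin_def bilin_def lin_def distrib_left)
      from Y.bsum_coassociative[OF ydY(2) this y]
      show "bsum (rY y) (\<lambda>g' y0. bsum (comult H g') (\<lambda>c e. ?V (g * c) (h * e) (tens X Y x1 y0))) =
        bsum (rY y) (\<lambda>g' y0. bsum (rY y0) (\<lambda>h' y1. ?V (g * g') (h * h') (tens X Y x1 y1)))" .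
    qed
    also have "\<dots> = bsum (rX x) (\<lambda>g x0. bsum (rY y) (\<lambda>g' y0. bsum (rX x0) (\<lambda>h x1. bsum (rY y0)
        (\<lambda>h' y1. ?V (g * g') (h * h') (tens X Y x1 y1)))))"
      by (intro bsum_cong refl bsum_swap)
    also have "\<dots> = bsum (rX x) (\<lambda>g x0. bsum (rY y) (\<lambda>g' y0. bsum (rP (tens X Y x0 y0)) (?V (g * g'))))"
      by (intro bsum_cong refl bsum_rP[symmetric] kX kY; assumption?)
        (auto simp: bilin_def lin_def)
    also have "\<dots> = bsum (rP (tens X Y x y)) (\<lambda>g t0. bsum (rP t0) (?V g))"
      by (rule bsum_rP[OF _ x y, symmetric])
        (auto simp: bilin_def intro!: lin_fun_bsum dest: P.keys_rho, auto simp: lin_def dest: P.keys_rho)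
    finally show "bsum (rP (tens X Y x y)) (\<lambda>g t0. bsum (comult H g) (\<lambda>a b. ?V a b t0)) =
        bsum (rP (tens X Y x y)) (\<lambda>g t0. bsum (rP t0) (?V g))" .
  qed (simp_all add: lin_def)
qed

lemma yd_coaction_P: "yd_coaction H T P rP"
  by (simp add: yd_coaction_def rP_in lin_def compatible_P coassociative_P)

section \<open>The formula for the connection\<close>

abbreviation "nX x \<equiv> rX x - tens H X 1 x"
abbreviation "nY y \<equiv> rY y - tens H Y 1 y"

lemma tens_right_bsum: "tens_right H X Y t y = bsum t (\<lambda>g x. W g x y)"
  by (simp add: tens_right_def tens_P W_def bsum_def)

lemma bilin_W: "y \<in> carrier Y \<Longrightarrow> bilin H X (\<lambda>g x. W (g * h) x y)"
  by (auto simp: bilin_def lin_def distrib_right)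

lemma sigma_tens:
  assumes x: "x \<in> carrier X"
  shows "sigma H X (\<lambda>x. nX x) (tens X H x h) = bsum (rX x) (\<lambda>g x0. tens H X (g * h) x0)"
proof -
  have b: "bilin H X (\<lambda>g x0. tens H X (g * h) x0)" for h
    by (auto simp: bilin_def lin_def distrib_right)
  let ?F = "\<lambda>x h. bsum (rX x) (\<lambda>g x0. tens H X (g * h) x0)"
  have F: "bilin X H ?F"
    by (auto simp: bilin_def intro!: lin_fun_bsum dest: X.keys_rho)
      (auto simp: lin_def distrib_left dest: X.keys_rho)
  \<comment> \<open>\<open>E\<close> is the formula of \<open>sigma\<close> as written, and it must
    be bilinear before it may be evaluated on x (x) h. It is, because its second summand cancels the
    shift in \<open>nX\<close> and leaves \<open>?F\<close>.\<close>
  define E where "E x h = bsum (nX x) (\<lambda>g x0. tens H X (g * h) x0) + tens H X h x" for x h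
  have eq: "E x h = ?F x h" if "x \<in> carrier X" for x h
    using that by (simp add: E_def bsum_tens[OF b])
  then have "bilin X H E"
    using F by (simp add: bilin_def lin_def del: X.bsum_rho_lin)
  from bsum_tens[OF this x] show ?thesis
    unfolding eq[OF x] by (simp add: sigma_def E_def[abs_def] bsum_def)
qed

lemma nabla_formula_eq:
  assumes x: "x \<in> carrier X" and y: "y \<in> carrier Y"
  shows "nabla_formula H X Y (\<lambda>x. nX x) (\<lambda>y. nY y) x y = rP (tens X Y x y) - tens H P 1 (tens X Y x y)"
proof -
  note kX = X.keys_rho[OF x]
  have right: "tens_right H X Y (sigma H X (\<lambda>x. nX x) (tens X H x h)) y0 = bsum (rX x) (\<lambda>g x0. W (g * h) x0 y0)"
    if "y0 \<in> carrier Y" "x \<in> carrier X" for h x y0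
    unfolding sigma_tens[OF that(2)] tens_right_bsum bsum_bsum
    using bilin_W[OF that(1), of 1] that
    by (intro bsum_cong refl bsum_tens) (auto dest: X.keys_rho)
  \<comment> \<open>\<open>sigma_id\<close> sums over an unknown representative of x (x) nabla(y),
    so its formula must be bilinear on X and H (x) Y.\<close>
  let ?G = "\<lambda>x u. bsum u (\<lambda>h y. tens_right H X Y (sigma H X (\<lambda>x. nX x) (tens X H x h)) y)"
  have "bilin X (tensor H Y) ?G"
    using tens_lin[where V = X and W = H]
    by (auto simp: bilin_def lin_def sigma_def tens_right_def bsum_fun bsum_def[symmetric] case_prod_unfold)
  moreover have nY: "nY y \<in> carrier (tensor H Y)"
    using y by (intro free.subspace_diff[OF subspace_tensor] Y.rho_in tens_in_tensor) simp_all
  ultimately have "sigma_id H X Y (\<lambda>x. nX x) (tens X (tensor H Y) x (nY y)) = ?G x (nY y)"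
    using x by (simp add: sigma_id_def bsum_def[symmetric] bsum_tens del: bsum_simps)
  also have "\<dots> = bsum (nY y) (\<lambda>h y0. bsum (rX x) (\<lambda>g x0. W (g * h) x0 y0))"
    by (intro bsum_cong refl right x keys_tensor(2)[OF vec_space_H Y.vec_space_M nY])
  \<comment> \<open>The shift in \<open>nY\<close> contributes -rho_X(x) (x) y, which cancels the
    first summand of the formula up to -1 (x) x (x) y.\<close>
  also have "\<dots> = bsum (rY y) (\<lambda>h y0. bsum (rX x) (\<lambda>g x0. W (g * h) x0 y0)) - bsum (rX x) (\<lambda>g x0. W g x0 y)"
  proof -
    have "bilin H Y (\<lambda>h y0. bsum (rX x) (\<lambda>g x0. W (g * h) x0 y0))"
      using kX by (auto simp: bilin_def intro!: lin_fun_bsum) (auto simp: lin_def distrib_left)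
    from bsum_tens[OF this _ y, of 1] show ?thesis by simp
  qed
  also have "bsum (rY y) (\<lambda>h y0. bsum (rX x) (\<lambda>g x0. W (g * h) x0 y0)) = rP (tens X Y x y)"
    unfolding rP_tens[OF x y] by (rule bsum_swap)
  finally show ?thesis
    using bsum_tens[OF bilin_W[OF y, of 1], of 1 x] x
    by (simp add: nabla_formula_def tens_right_bsum W_def)
qed

lemma nabla_tensor_tens:
  assumes "x \<in> carrier X" "y \<in> carrier Y"
  shows "nabla_tensor H X Y (\<lambda>x. nX x) (\<lambda>y. nY y) (tens X Y x y) = nabla_formula H X Y (\<lambda>x. nX x) (\<lambda>y. nY y) x y"
  unfolding nabla_tensor_def bsum_def[symmetric]
proof (rule bsum_tens[OF _ assms])
  show "bilin X Y (nabla_formula H X Y (\<lambda>x. nX x) (\<lambda>y. nY y))"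
    by (auto simp: bilin_def lin_def nabla_formula_eq free.scale_right_diff_distrib)
qed

lemma nabla_tensor_eq:
  assumes "t \<in> carrier P"
  shows "nabla_tensor H X Y (\<lambda>x. nX x) (\<lambda>y. nY y) t + tens H P 1 t = rP t"
proof (rule P_eqI[OF assms])
  show "lin (carrier P) fscale (\<lambda>t. nabla_tensor H X Y (\<lambda>x. nX x) (\<lambda>y. nY y) t + tens H P 1 t)"
    by (rule lin_fun_add) (simp_all add: lin_def nabla_tensor_def)
  show "lin (carrier P) fscale rP"
    by (simp add: lin_def)
qed (simp only: nabla_tensor_tens nabla_formula_eq diff_add_cancel)

lemma flat_connection_tensor:
  "flat_connection H (K_calculus H T) P (nabla_tensor H X Y (\<lambda>x. nX x) (\<lambda>y. nY y))"
  unfolding P.flat_connection_iff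
  by (rule P.yd_coaction_cong[THEN iffD2, OF _ yd_coaction_P]) (rule nabla_tensor_eq)

end

theorem proposition3p16:
  fixes H :: "('k::field, 'h::ring_1) hopf"
    and X :: "('k, 'h, 'x::ab_group_add) lmodule"
    and X' :: "('k, 'h, 'y::ab_group_add) lmodule"
    and nablaX :: "'x \<Rightarrow> ('h \<times> 'x \<Rightarrow>\<^sub>0 'k)"
    and nablaX' :: "'y \<Rightarrow> ('h \<times> 'y \<Rightarrow>\<^sub>0 'k)"
  assumes "hopf_algebra H" and "bij (antipode H)"
    and "left_module H X" and "left_module H X'"
    and "flat_connection H (K_hat H) X nablaX"
    and "flat_connection H (K H) X' nablaX'"
  shows "left_module H (tensor_module H X X') \<and>
    (\<forall>x\<in>carrier X. \<forall>x'\<in>carrier X'.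
       nabla_tensor H X X' nablaX nablaX' (tens X X' x x') =
         tens_right H X X' (nablaX x) x' +
         sigma_id H X X' nablaX (tens X (tensor H X') x (nablaX' x'))) \<and>
    flat_connection H (K H) (tensor_module H X X') (nabla_tensor H X X' nablaX nablaX')"
proof -
  interpret hopf_algebra H by fact
  let ?T = "inv (antipode H)"
  have inv: "?T (antipode H h) = h" "antipode H (?T h) = h" for h
    using assms(2) by (simp_all add: bij_is_inj bij_is_surj surj_f_inv_f)
  \<comment> \<open>Linearity of S passes to its inverse: expand T(S(z)) = z at z = T(g) + T(h) and
    at z = c T(h).\<close>
  have "?T (g + h) = ?T g + ?T h" "?T (scale H c h) = scale H c (?T h)" for g h c
    using inv(1)[of "?T g + ?T h"] inv(1)[of "scale H c (?T h)"] by (simp_all add: inv(2))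
  then interpret X: hopf_module H "antipode H" X + X': hopf_module H ?T X'
    using assms(3,4) by unfold_locales simp_all
  let ?rX = "\<lambda>x. nablaX x + tens H X 1 x" and ?rX' = "\<lambda>x. nablaX' x + tens H X' 1 x"
  have yd: "yd_coaction H (antipode H) X ?rX" "yd_coaction H ?T X' ?rX'"
    using assms(5,6) X.flat_connection_iff X'.flat_connection_iff by (simp_all add: K_def K_hat_def)
  \<comment> \<open>For these coactions \<open>nX\<close> and \<open>nY\<close> subtract the shift
    again and are the given connections.\<close>
  interpret yd_pair H ?T X X' ?rX ?rX'
    by unfold_locales (use yd in \<open>auto simp: yd_coaction_def\<close>)
  show ?thesis
    using left_module_P nabla_tensor_tens flat_connection_tensor by (simp add: nabla_formula_def K_def)
qed

end
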